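(* Let $\beta,\lambda$ satisfy the coefficient assumptions (i)–(iii) of the context, let $y\in\mathbb R$, and let $\Xi_T\in L^2(\mathcal F_T)$ satisfy $\int_0^T\frac{d\,\mathbb E[\Xi_t^2]}{T-t}<\infty$, where $\Xi_t=\mathbb E[\Xi_T\mid\mathcal F_t]$. Let $C_J:=C_{\mathcal H}^2L_Y^2$, let $Q^0$ be the unique minimizer of $J_0$ over $\mathcal Q$, and $Y^0:=Y^{Q^0}$. Then for every $Q\in\mathcal Q$, $$0\le J_0(Q)-J_0(Q^0)=\|Y^Q-Y^0\|^2_{\mathcal H}\le C_J\,\mathbb E\int_0^T(Q_t-Q^0_t)^2\,dt .$$ Consequently, for every $Q\in\mathcal Q_{\rm ac}$ and every $\varepsilon>0$, $$0\le V(\varepsilon)-V(0)\le C_J\,\mathbb E\int_0^T(Q_t-Q^0_t)^2\,dt+\varepsilon\,\mathbb E\int_0^T\dot Q_t^2\,dt .$$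
   Context: Fix $T\in(0,\infty)$ and a filtered probability space $(\Omega,\mathcal F,(\mathcal F_t)_{t\in[0,T]},\mathbb P)$ satisfying the usual conditions; $\mathcal F_{0-}$ is the augmentation of the trivial $\sigma$-field. The integral $\int_0^T\frac{d\,\mathbb E[\Xi_t^2]}{T-t}$ is a Stieltjes integral with respect to the nondecreasing function $t\mapsto\mathbb E[\Xi_t^2]$ on $[0,T]$, with the convention that an atom at $T$ contributes $+\infty$. Coefficient assumptions on the deterministic functions $\beta,\lambda:[0,T]\to(0,\infty)$: (i) $\beta$ is càdlàg and of finite variation. (ii) $\lambda$ is absolutely continuous and bounded away from zero, and its a.e. derivative admits a càdlàg version $\dot\lambda$ of finite variation; $\lambda_{0-}:=\lambda_0$, $\gamma_t:=\log\lambda_t$, $\dot\gamma_t:=\dot\lambda_t/\lambda_t$. (iii) There is $c>0$ with $2\beta_t+\dot\gamma_t>c$ for all $t\in[0,T]$. $\mathcal Q$ is the set of càdlàg semimartingales $Q$ with $\mathbb E[\sup_{t\le T}|Q_t|^2]<\infty$, $Q_{0-}=0$, $Q_T=\Xi_T$. For $Q\in\mathcal Q$, $Y^Q$ is the solution of $dY_t=-\beta_tY_t\,dt+\lambda_t\,dQ_t$, $Y_{0-}=y$. Let $$\langle Y,Z\rangle_{\mathcal H}=\mathbb E\Big[\int_0^T\tfrac{2\beta_t+\dot\gamma_t}{2\lambda_t}Y_tZ_t\,dt+\tfrac1{2\lambda_T}Y_TZ_T\Big],\quad\|Y\|^2_{\mathcal H}=\langle Y,Y\rangle_{\mathcal H},\quad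 J_0(Q)=\|Y^Q\|_{\mathcal H}^2-\tfrac{y^2}{2\lambda_0}$$ ($J_0(Q)$ equals the execution cost $\mathbb E[\int_0^TY^Q_{t-}dQ_t+\frac12[Y^Q,Q]_T]$). It is known that $J_0$ has a unique minimizer $Q^0$ over $\mathcal Q$: with $\eta_t=\frac{\beta_t+\dot\gamma_t}{2\beta_t+\dot\gamma_t}$, $\dot\theta_t=\frac{(\beta_t+\dot\gamma_t)^2}{\lambda_t(2\beta_t+\dot\gamma_t)}$, $\theta_t=\int_0^t\dot\theta_s\,ds$ and the martingale $M_t=\frac{\lambda_T}{1+\lambda_T\theta_T}(\Xi_0+\frac y{\lambda_0})+\int_{(0,t]}\frac{\lambda_T}{1+\lambda_T(\theta_T-\theta_s)}\,d\Xi_s$, its impact process is $Y^0_t=\eta_tM_t$ for $t\in[0,T)$, $Y^0_T=M_T$, and $Q^0_t=\frac{Y^0_t}{\lambda_t}-\frac y{\lambda_0}+\int_0^t\frac{\beta_s+\dot\gamma_s}{\lambda_s}Y^0_s\,ds$ for $t\in[0,T]$. $\mathcal Q_{\rm ac}\subset\mathcal Q$ consists of the $Q_t=\int_0^tu_s\,ds$ with $u$ progressively measurable, $\mathbb E\int_0^Tu_t^2\,dt<\infty$ and $Q_T=\Xi_T$. For $\varepsilon>0$ and $Q\in\mathcal Q_{\rm ac}$, $J_\varepsilon(Q)=J_0(Q)+\varepsilon\,\mathbb E\int_0^T\dot Q_t^2\,dt$; $V(0)=\inf_{Q\in\mathcal Q}J_0(Q)$ and $V(\varepsilon)=\inf_{Q\in\mathcal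 Q_{\rm ac}}J_\varepsilon(Q)$. Constants: $$C_{\mathcal H}^2=\tfrac12\max\Big\{\Big\|\tfrac{2\beta+\dot\gamma}{\lambda}\Big\|_{L^\infty(0,T)},\tfrac1{\lambda_T}\Big\},\qquad L_Y=\|\lambda\|_{L^\infty(0,T)}\sqrt{2+T(T+2)\|\beta+\dot\gamma\|^2_{L^\infty(0,T)}}.$$ *)

theory Defs
  imports "HOL-Probability.Probability"
begin

text \<open>
  Everything takes place on the time interval [0, T].  Paths, processes and filtrations are
  functions on all of \<^typ>\<open>real\<close>, but only their values at times in [0, T] are ever used.
  The time 0- is not an index: a process that may jump at time 0 is always understood to have
  the value 0 (for the impact process: y) at 0-, so that its jump at 0 is visible only as its
  value at 0.
\<close>

section \<open>Paths\<close>

definition cadlag_on :: "real \<Rightarrow> (real \<Rightarrow> real) \<Rightarrow> bool" where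
  "cadlag_on T f \<longleftrightarrow>
     (\<forall>t\<in>{0..<T}. continuous (at_right t) f) \<and>
     (\<forall>t\<in>{0<..T}. \<exists>l. (f \<longlongrightarrow> l) (at_left t))"

definition is_partition :: "real \<Rightarrow> nat \<Rightarrow> (nat \<Rightarrow> real) \<Rightarrow> bool" where
  "is_partition T k p \<longleftrightarrow> p 0 = 0 \<and> p k = T \<and> (\<forall>i<k. p i < p (Suc i))"

definition finite_variation_on :: "real \<Rightarrow> (real \<Rightarrow> real) \<Rightarrow> bool" where
  "finite_variation_on T f \<longleftrightarrow>
     bdd_above {(\<Sum>i<k. \<bar>f (p (Suc i)) - f (p i)\<bar>) | k p. is_partition T k p}"

definition abs_continuous_on :: "real \<Rightarrow> (real \<Rightarrow> real) \<Rightarrow> bool" where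
  "abs_continuous_on T f \<longleftrightarrow>
     (\<forall>e>0. \<exists>d>0. \<forall>(k::nat) a b.
        (\<forall>i<k. 0 \<le> a i \<and> a i \<le> b i \<and> b i \<le> T) \<and>
        (\<forall>i<k. \<forall>j<k. i \<noteq> j \<longrightarrow> b i \<le> a j \<or> b j \<le> a i) \<and>
        (\<Sum>i<k. b i - a i) < d \<longrightarrow>
        (\<Sum>i<k. \<bar>f (b i) - f (a i)\<bar>) < e)"

definition Linf_norm :: "real \<Rightarrow> (real \<Rightarrow> real) \<Rightarrow> real" where
  "Linf_norm T f = real_of_ereal (esssup (restrict_space lborel {0<..<T}) (\<lambda>t. ereal \<bar>f t\<bar>))"

text \<open>
  The derivative of \<open>lam\<close> is a parameter: \<open>lam'\<close> is the given cadlag version of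
  the a.e. derivative, and the logarithmic derivative of \<open>lam\<close> is \<open>lam' t / lam t\<close>.
\<close>

definition coefficient_assms ::
  "real \<Rightarrow> (real \<Rightarrow> real) \<Rightarrow> (real \<Rightarrow> real) \<Rightarrow> (real \<Rightarrow> real) \<Rightarrow> bool" where
  "coefficient_assms T \<beta> lam lam' \<longleftrightarrow>
     (\<forall>t\<in>{0..T}. 0 < \<beta> t \<and> 0 < lam t) \<and>
     cadlag_on T \<beta> \<and> finite_variation_on T \<beta> \<and>
     abs_continuous_on T lam \<and> (\<exists>c>0. \<forall>t\<in>{0..T}. c \<le> lam t) \<and>
     (AE t in lborel. t \<in> {0<..<T} \<longrightarrow> (lam has_real_derivative lam' t) (at t)) \<and>
     cadlag_on T lam' \<and> finite_variation_on T lam' \<and>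
     (\<exists>c>0. \<forall>t\<in>{0..T}. c < 2 * \<beta> t + lam' t / lam t)"

section \<open>Filtered probability spaces and semimartingales\<close>

locale usual_filtered_prob_space = prob_space M + complete_measure M for M :: "'a measure" +
  fixes F :: "real \<Rightarrow> 'a measure" and T :: real
  assumes T_pos: "0 < T"
    and subalgebra_F: "t \<in> {0..T} \<Longrightarrow> subalgebra M (F t)"
    and F_mono: "0 \<le> s \<Longrightarrow> s \<le> t \<Longrightarrow> t \<le> T \<Longrightarrow> sets (F s) \<subseteq> sets (F t)"
    and F_right_continuous: "t \<in> {0..<T} \<Longrightarrow> sets (F t) = (\<Inter>s\<in>{t<..T}. sets (F s))"
    and null_sets_F: "null_sets M \<subseteq> sets (F 0)"

definition adapted :: "(real \<Rightarrow> 'a measure) \<Rightarrow> real \<Rightarrow> (real \<Rightarrow> 'a \<Rightarrow> real) \<Rightarrow> bool" where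
  "adapted F T X \<longleftrightarrow> (\<forall>t\<in>{0..T}. X t \<in> borel_measurable (F t))"

definition cadlag_process :: "'a measure \<Rightarrow> real \<Rightarrow> (real \<Rightarrow> 'a \<Rightarrow> real) \<Rightarrow> bool" where
  "cadlag_process M T X \<longleftrightarrow> (\<forall>\<omega>\<in>space M. cadlag_on T (\<lambda>t. X t \<omega>))"

definition progressive :: "(real \<Rightarrow> 'a measure) \<Rightarrow> real \<Rightarrow> (real \<Rightarrow> 'a \<Rightarrow> real) \<Rightarrow> bool" where
  "progressive F T X \<longleftrightarrow>
     (\<forall>t\<in>{0..T}. (\<lambda>(s, \<omega>). X s \<omega>) \<in> borel_measurable (restrict_space borel {0..t} \<Otimes>\<^sub>M F t))"

definition martingale ::
  "'a measure \<Rightarrow> (real \<Rightarrow> 'a measure) \<Rightarrow> real \<Rightarrow> (real \<Rightarrow> 'a \<Rightarrow> real) \<Rightarrow> bool" where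
  "martingale M F T X \<longleftrightarrow>
     adapted F T X \<and> (\<forall>t\<in>{0..T}. integrable M (X t)) \<and>
     (\<forall>s\<in>{0..T}. \<forall>t\<in>{s..T}. AE \<omega> in M. real_cond_exp M (F s) (X t) \<omega> = X s \<omega>)"

text \<open>
  The library notion \<^const>\<open>stopping_time\<close> quantifies over all real times, hence the
  filtration is frozen outside [0, T].  On the closed interval [0, T] a localizing sequence has
  to reach T after finitely many steps.
\<close>

definition local_martingale ::
  "'a measure \<Rightarrow> (real \<Rightarrow> 'a measure) \<Rightarrow> real \<Rightarrow> (real \<Rightarrow> 'a \<Rightarrow> real) \<Rightarrow> bool" where
  "local_martingale M F T X \<longleftrightarrow>
     adapted F T X \<and> cadlag_process M T X \<and>
     (\<exists>\<tau> :: nat \<Rightarrow> 'a \<Rightarrow> real.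
        (\<forall>n. stopping_time (\<lambda>t. F (max 0 (min t T))) (\<tau> n)) \<and>
        (\<forall>n. \<forall>\<omega>\<in>space M. \<tau> n \<omega> \<in> {0..T} \<and> \<tau> n \<omega> \<le> \<tau> (Suc n) \<omega>) \<and>
        (AE \<omega> in M. \<exists>n. \<tau> n \<omega> = T) \<and>
        (\<forall>n. martingale M F T (\<lambda>t \<omega>. X (min t (\<tau> n \<omega>)) \<omega> - X 0 \<omega>)))"

definition finite_variation_process ::
  "'a measure \<Rightarrow> (real \<Rightarrow> 'a measure) \<Rightarrow> real \<Rightarrow> (real \<Rightarrow> 'a \<Rightarrow> real) \<Rightarrow> bool" where
  "finite_variation_process M F T X \<longleftrightarrow>
     adapted F T X \<and> cadlag_process M T X \<and>
     (\<forall>\<omega>\<in>space M. finite_variation_on T (\<lambda>t. X t \<omega>))"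

definition semimartingale ::
  "'a measure \<Rightarrow> (real \<Rightarrow> 'a measure) \<Rightarrow> real \<Rightarrow> (real \<Rightarrow> 'a \<Rightarrow> real) \<Rightarrow> bool" where
  "semimartingale M F T X \<longleftrightarrow>
     adapted F T X \<and> cadlag_process M T X \<and>
     (\<exists>N A. local_martingale M F T N \<and> finite_variation_process M F T A \<and>
        (AE \<omega> in M. \<forall>t\<in>{0..T}. X t \<omega> = N t \<omega> + A t \<omega>))"

text \<open>
  \<open>is_stoch_integral M F T H X I\<close>: the process \<open>I\<close> is the stochastic integral over the closed
  intervals [0, t] of the deterministic continuous integrand \<open>H\<close> against \<open>X\<close> (with value 0 at
  0-, so that the jump at time 0 contributes \<open>H 0 * X 0\<close>), i.e. the limit, uniformly in time and
  in probability, of the left-point Riemann sums as the mesh of the partition tends to 0.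
  Here \<open>p (Suc i)\<close> and \<open>p i\<close> are stopped at \<open>t\<close>.
\<close>

definition is_stoch_integral ::
  "'a measure \<Rightarrow> (real \<Rightarrow> 'a measure) \<Rightarrow> real \<Rightarrow>
   (real \<Rightarrow> real) \<Rightarrow> (real \<Rightarrow> 'a \<Rightarrow> real) \<Rightarrow> (real \<Rightarrow> 'a \<Rightarrow> real) \<Rightarrow> bool" where
  "is_stoch_integral M F T H X I \<longleftrightarrow>
     adapted F T I \<and> cadlag_process M T I \<and>
     (\<forall>e>0. \<exists>d>0. \<forall>k p. is_partition T k p \<and> (\<forall>i<k. p (Suc i) - p i < d) \<longrightarrow>
        measure M {\<omega>\<in>space M. \<exists>t\<in>{0..T}.
          e < \<bar>H 0 * X 0 \<omega> + (\<Sum>i<k. H (p i) * (X (min (p (Suc i)) t) \<omega> - X (min (p i) t) \<omega>))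
               - I t \<omega>\<bar>} < e)"

section \<open>Strategies, impact process and cost\<close>

text \<open>\<open>Xi t\<close> is the conditional expectation of the terminal position \<open>XiT\<close> given \<open>F t\<close>.\<close>

definition Xi ::
  "'a measure \<Rightarrow> (real \<Rightarrow> 'a measure) \<Rightarrow> ('a \<Rightarrow> real) \<Rightarrow> real \<Rightarrow> 'a \<Rightarrow> real" where
  "Xi M F XiT t = real_cond_exp M (F t) XiT"

text \<open>
  The Stieltjes measure of the second moment on [0, T]; the integrator is extended to the real
  line by constants, so there is no atom at 0 (an atom at 0 would only add a finite term).
  In \<^typ>\<open>ennreal\<close> the integrand \<open>1 / (T - t)\<close> is infinite at \<open>t = T\<close>, so an atom at
  T contributes infinity.
\<close>

definition stieltjes_condition ::
  "'a measure \<Rightarrow> (real \<Rightarrow> 'a measure) \<Rightarrow> real \<Rightarrow> ('a \<Rightarrow> real) \<Rightarrow> bool" where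
  "stieltjes_condition M F T XiT \<longleftrightarrow>
     (\<integral>\<^sup>+ t\<in>{0..T}. (1 / ennreal (T - t))
        \<partial>interval_measure (\<lambda>t. \<integral>\<omega>. (Xi M F XiT (max 0 (min t T)) \<omega>)\<^sup>2 \<partial>M)) < \<infinity>"

definition strategies ::
  "'a measure \<Rightarrow> (real \<Rightarrow> 'a measure) \<Rightarrow> real \<Rightarrow> ('a \<Rightarrow> real) \<Rightarrow> (real \<Rightarrow> 'a \<Rightarrow> real) set" where
  "strategies M F T XiT =
     {Q. semimartingale M F T Q \<and>
         (\<integral>\<^sup>+ \<omega>. (SUP t\<in>{0..T}. ennreal ((Q t \<omega>)\<^sup>2)) \<partial>M) < \<infinity> \<and>
         (AE \<omega> in M. Q T \<omega> = Xi M F XiT T \<omega>)}"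

text \<open>
  \<open>Y\<close> solves \<open>dY = - \<beta> Y dt + lam dQ\<close> with \<open>Y = y\<close> at time 0-.  Solutions are unique only
  up to indistinguishability; \<open>impact\<close> picks one of them.
\<close>

definition is_impact ::
  "'a measure \<Rightarrow> (real \<Rightarrow> 'a measure) \<Rightarrow> real \<Rightarrow> (real \<Rightarrow> real) \<Rightarrow> (real \<Rightarrow> real) \<Rightarrow> real \<Rightarrow>
   (real \<Rightarrow> 'a \<Rightarrow> real) \<Rightarrow> (real \<Rightarrow> 'a \<Rightarrow> real) \<Rightarrow> bool" where
  "is_impact M F T \<beta> lam y Q Y \<longleftrightarrow>
     adapted F T Y \<and> cadlag_process M T Y \<and>
     (\<exists>I. is_stoch_integral M F T lam Q I \<and>
        (AE \<omega> in M. \<forall>t\<in>{0..T}. Y t \<omega> = y - (LBINT s:{0..t}. \<beta> s * Y s \<omega>) + I t \<omega>))"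

definition impact ::
  "'a measure \<Rightarrow> (real \<Rightarrow> 'a measure) \<Rightarrow> real \<Rightarrow> (real \<Rightarrow> real) \<Rightarrow> (real \<Rightarrow> real) \<Rightarrow> real \<Rightarrow>
   (real \<Rightarrow> 'a \<Rightarrow> real) \<Rightarrow> (real \<Rightarrow> 'a \<Rightarrow> real)" where
  "impact M F T \<beta> lam y Q = (SOME Y. is_impact M F T \<beta> lam y Q Y)"

definition inner_H ::
  "'a measure \<Rightarrow> real \<Rightarrow> (real \<Rightarrow> real) \<Rightarrow> (real \<Rightarrow> real) \<Rightarrow> (real \<Rightarrow> real) \<Rightarrow>
   (real \<Rightarrow> 'a \<Rightarrow> real) \<Rightarrow> (real \<Rightarrow> 'a \<Rightarrow> real) \<Rightarrow> real" where
  "inner_H M T \<beta> lam lam' Y Z =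
     (\<integral>\<omega>. (LBINT t:{0..T}. (2 * \<beta> t + lam' t / lam t) / (2 * lam t) * Y t \<omega> * Z t \<omega>)
          + 1 / (2 * lam T) * Y T \<omega> * Z T \<omega> \<partial>M)"

text \<open>The square of the norm.\<close>

definition norm_H_sq ::
  "'a measure \<Rightarrow> real \<Rightarrow> (real \<Rightarrow> real) \<Rightarrow> (real \<Rightarrow> real) \<Rightarrow> (real \<Rightarrow> real) \<Rightarrow>
   (real \<Rightarrow> 'a \<Rightarrow> real) \<Rightarrow> real" where
  "norm_H_sq M T \<beta> lam lam' Y = inner_H M T \<beta> lam lam' Y Y"

definition J0 ::
  "'a measure \<Rightarrow> (real \<Rightarrow> 'a measure) \<Rightarrow> real \<Rightarrow> (real \<Rightarrow> real) \<Rightarrow> (real \<Rightarrow> real) \<Rightarrow>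
   (real \<Rightarrow> real) \<Rightarrow> real \<Rightarrow> (real \<Rightarrow> 'a \<Rightarrow> real) \<Rightarrow> real" where
  "J0 M F T \<beta> lam lam' y Q =
     norm_H_sq M T \<beta> lam lam' (impact M F T \<beta> lam y Q) - y\<^sup>2 / (2 * lam 0)"

text \<open>
  \<open>is_rate M F T Q u\<close>: \<open>Q\<close> is (up to indistinguishability) the indefinite integral of \<open>u\<close>;
  such a \<open>u\<close> is unique up to null sets of time and scenario, and \<open>rate\<close>, the time derivative
  of \<open>Q\<close>, picks one version.
\<close>

definition is_rate ::
  "'a measure \<Rightarrow> (real \<Rightarrow> 'a measure) \<Rightarrow> real \<Rightarrow>
   (real \<Rightarrow> 'a \<Rightarrow> real) \<Rightarrow> (real \<Rightarrow> 'a \<Rightarrow> real) \<Rightarrow> bool" where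
  "is_rate M F T Q u \<longleftrightarrow>
     progressive F T u \<and>
     (\<integral>\<^sup>+ \<omega>. (\<integral>\<^sup>+ t\<in>{0..T}. ennreal ((u t \<omega>)\<^sup>2) \<partial>lborel) \<partial>M) < \<infinity> \<and>
     (AE \<omega> in M. \<forall>t\<in>{0..T}. Q t \<omega> = (LBINT s:{0..t}. u s \<omega>))"

definition rate ::
  "'a measure \<Rightarrow> (real \<Rightarrow> 'a measure) \<Rightarrow> real \<Rightarrow> (real \<Rightarrow> 'a \<Rightarrow> real) \<Rightarrow> (real \<Rightarrow> 'a \<Rightarrow> real)"
  where "rate M F T Q = (SOME u. is_rate M F T Q u)"

definition ac_strategies ::
  "'a measure \<Rightarrow> (real \<Rightarrow> 'a measure) \<Rightarrow> real \<Rightarrow> ('a \<Rightarrow> real) \<Rightarrow> (real \<Rightarrow> 'a \<Rightarrow> real) set" where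
  "ac_strategies M F T XiT = {Q \<in> strategies M F T XiT. \<exists>u. is_rate M F T Q u}"

text \<open>The expectation of the time integral of the square of a process.\<close>

definition L2_sq :: "'a measure \<Rightarrow> real \<Rightarrow> (real \<Rightarrow> 'a \<Rightarrow> real) \<Rightarrow> real" where
  "L2_sq M T X = (\<integral>\<omega>. (LBINT t:{0..T}. (X t \<omega>)\<^sup>2) \<partial>M)"

definition J_eps ::
  "'a measure \<Rightarrow> (real \<Rightarrow> 'a measure) \<Rightarrow> real \<Rightarrow> (real \<Rightarrow> real) \<Rightarrow> (real \<Rightarrow> real) \<Rightarrow>
   (real \<Rightarrow> real) \<Rightarrow> real \<Rightarrow> real \<Rightarrow> (real \<Rightarrow> 'a \<Rightarrow> real) \<Rightarrow> real" where
  "J_eps M F T \<beta> lam lam' y \<epsilon> Q = J0 M F T \<beta> lam lam' y Q + \<epsilon> * L2_sq M T (rate M F T Q)"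

text \<open>The infima are taken in the extended reals; the infimum over the empty set is infinite.\<close>

definition V ::
  "'a measure \<Rightarrow> (real \<Rightarrow> 'a measure) \<Rightarrow> real \<Rightarrow> (real \<Rightarrow> real) \<Rightarrow> (real \<Rightarrow> real) \<Rightarrow>
   (real \<Rightarrow> real) \<Rightarrow> real \<Rightarrow> ('a \<Rightarrow> real) \<Rightarrow> real \<Rightarrow> ereal" where
  "V M F T \<beta> lam lam' y XiT \<epsilon> =
     (if \<epsilon> = 0 then (INF Q\<in>strategies M F T XiT. ereal (J0 M F T \<beta> lam lam' y Q))
      else (INF Q\<in>ac_strategies M F T XiT. ereal (J_eps M F T \<beta> lam lam' y \<epsilon> Q)))"

section \<open>Constants\<close>

definition C_H_sq :: "real \<Rightarrow> (real \<Rightarrow> real) \<Rightarrow> (real \<Rightarrow> real) \<Rightarrow> (real \<Rightarrow> real) \<Rightarrow> real" where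
  "C_H_sq T \<beta> lam lam' =
     1 / 2 * max (Linf_norm T (\<lambda>t. (2 * \<beta> t + lam' t / lam t) / lam t)) (1 / lam T)"

definition L_Y :: "real \<Rightarrow> (real \<Rightarrow> real) \<Rightarrow> (real \<Rightarrow> real) \<Rightarrow> (real \<Rightarrow> real) \<Rightarrow> real" where
  "L_Y T \<beta> lam lam' =
     Linf_norm T lam * sqrt (2 + T * (T + 2) * (Linf_norm T (\<lambda>t. \<beta> t + lam' t / lam t))\<^sup>2)"

definition C_J :: "real \<Rightarrow> (real \<Rightarrow> real) \<Rightarrow> (real \<Rightarrow> real) \<Rightarrow> (real \<Rightarrow> real) \<Rightarrow> real" where
  "C_J T \<beta> lam lam' = C_H_sq T \<beta> lam lam' * (L_Y T \<beta> lam lam')\<^sup>2"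

end

theory Submission
  imports Defs
begin

text \<open>
  Since \<open>lam\<close> is absolutely continuous, summation by parts turns the stochastic integral of
  \<open>lam\<close> against \<open>Q\<close> into the pathwise expression \<open>lam t * Q t\<close> minus the integral of
  \<open>lam' s * Q s\<close>, and variation of constants makes the impact process an explicit affine
  function of the path of \<open>Q\<close>. As the strategies form an affine space, the cost restricted to the
  line through the minimizer \<open>Q0\<close> and \<open>Q\<close> is a quadratic polynomial whose leading coefficient is
  the squared norm of the difference of the impact processes; minimality at \<open>Q0\<close> kills the linear
  term, which is the asserted identity. The upper bound is a Cauchy-Schwarz estimate of the
  explicit formula for a difference of strategies, which vanishes at time \<open>T\<close>.

  That strategies form an affine space rests on optional sampling: two local martingales have to
  be stopped at the minimum of their localizing sequences.
\<close>

section \<open>Cadlag paths\<close>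

text \<open>The obstacle is that \<open>impact\<close> is a choice made by \<open>SOME\<close> and
  that the stochastic integral is given only as a limit in probability. A cost can be computed only
  after existence and almost sure uniqueness of that limit are known; from then on the work concerns
  single cadlag paths, integrated over \<omega> at the end. Minimality has to be used on the whole
  line and not only between the two strategies: parameters in [0, 1] alone would bound the gap from
  one side, and the equality comes from negative parameters. The constant \<open>C_J\<close> is the
  product of two estimates. \<open>C_H_sq\<close> bounds both weights of the norm by one number. The
  square of \<open>L_Y\<close> bounds the time integral plus the terminal value of the squared
  impact path by the time integral of the squared strategy. A terminal value of a strategy is not
  controlled by its time integral, so the vanishing of the difference at \<open>T\<close> is what
  makes the second estimate possible.\<close>

lemma cadlag_on_right:
  "cadlag_on T f \<Longrightarrow> t \<in> {0..<T} \<Longrightarrow> (f \<longlongrightarrow> f t) (at_right t)"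
  by (auto simp: cadlag_on_def continuous_within)

lemma cadlag_on_add:
  assumes "cadlag_on T f" "cadlag_on T g" shows "cadlag_on T (\<lambda>t. f t + g t)"
  using assms unfolding cadlag_on_def by (blast intro: tendsto_add continuous_add)

lemma cadlag_on_mult:
  assumes "cadlag_on T f" "cadlag_on T g" shows "cadlag_on T (\<lambda>t. f t * g t :: real)"
  using assms unfolding cadlag_on_def by (blast intro: tendsto_mult continuous_mult)

lemma cadlag_on_continuous:
  fixes f :: "real \<Rightarrow> real"
  assumes "continuous_on {0..T} f" shows "cadlag_on T f"
  unfolding cadlag_on_def
proof safe
  fix t assume t: "t \<in> {0..<T}"
  have "(f \<longlongrightarrow> f t) (at t within {t..T})"
    by (rule tendsto_within_subset[where S = "{0..T}"]) (use assms t in \<open>auto simp: continuous_on_def\<close>)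
  then show "continuous (at_right t) f"
    using t by (simp add: continuous_within at_within_Icc_at_right)
next
  fix t assume t: "t \<in> {0<..T}"
  have "(f \<longlongrightarrow> f t) (at t within {0..t})"
    by (rule tendsto_within_subset[where S = "{0..T}"]) (use assms t in \<open>auto simp: continuous_on_def\<close>)
  then show "\<exists>l. (f \<longlongrightarrow> l) (at_left t)"
    using t by (auto simp: at_within_Icc_at_left)
qed

lemma cadlag_on_const: "cadlag_on T (\<lambda>t. c)"
  by (intro cadlag_on_continuous continuous_on_const)

lemma cadlag_on_cmult:
  assumes "cadlag_on T f" shows "cadlag_on T (\<lambda>t. c * f t)"
  by (intro cadlag_on_mult cadlag_on_const assms)

lemma cadlag_on_diff:
  assumes "cadlag_on T f" "cadlag_on T g" shows "cadlag_on T (\<lambda>t. f t - g t)"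
  using cadlag_on_add[OF assms(1) cadlag_on_cmult[OF assms(2), of "-1"]] by simp

text \<open>Bounds on adjacent intervals combine by a maximum, so bisection leaves only a
  neighbourhood of a point \<open>x\<close>: right continuity controls the right side, the left
  limit controls the left side, and \<open>x\<close> itself, whose value need not be near the left
  limit, is added separately.\<close>

lemma cadlag_on_bounded:
  assumes f: "cadlag_on T f" and T: "0 \<le> T"
  obtains K where "0 \<le> K" "\<And>t. t \<in> {0..T} \<Longrightarrow> \<bar>f t\<bar> \<le> K"
proof -
  define P where "P a b \<longleftrightarrow> (\<exists>K. \<forall>t\<in>{a..b} \<inter> {0..T}. \<bar>f t\<bar> \<le> K)" for a b
  have "P 0 T" using T
  proof (induction rule: Bolzano)
    case (trans a b c)
    then obtain K L where "\<forall>t\<in>{a..b} \<inter> {0..T}. \<bar>f t\<bar> \<le> K" "\<forall>t\<in>{b..c} \<inter> {0..T}. \<bar>f t\<bar> \<le> L"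
      by (auto simp: P_def)
    then have "\<forall>t\<in>{a..c} \<inter> {0..T}. \<bar>f t\<bar> \<le> max K L"
      by (metis (no_types, opaque_lifting) Int_iff atLeastAtMost_iff le_max_iff_disj linear)
    then show ?case by (auto simp: P_def)
  next
    case (local x)
    have "\<exists>d>0. \<exists>K. \<forall>t\<in>{x<..<x+d} \<inter> {0..T}. \<bar>f t\<bar> \<le> K"
    proof (cases "x < T")
      case True
      then have "\<forall>\<^sub>F t in at_right x. dist (f t) (f x) < 1"
        using cadlag_on_right[OF f, of x] local by (auto simp: tendsto_iff)
      then obtain b where "b > x" "\<forall>t>x. t < b \<longrightarrow> dist (f t) (f x) < 1"
        by (auto simp: eventually_at_right_field)
      then show ?thesis
        by (intro exI[of _ "b - x"] conjI exI[of _ "1 + \<bar>f x\<bar>"]) (force simp: dist_real_def)+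
    next
      case False
      then show ?thesis by (intro exI[of _ 1]) auto
    qed
    then obtain d1 K1 where 1: "d1 > 0" "\<forall>t\<in>{x<..<x+d1} \<inter> {0..T}. \<bar>f t\<bar> \<le> K1" by auto
    have "\<exists>d>0. \<exists>K. \<forall>t\<in>{x-d<..<x} \<inter> {0..T}. \<bar>f t\<bar> \<le> K"
    proof (cases "x > 0")
      case True
      then obtain l where "(f \<longlongrightarrow> l) (at_left x)"
        using f local unfolding cadlag_on_def by (metis greaterThanAtMost_iff)
      then have "\<forall>\<^sub>F t in at_left x. dist (f t) l < 1" by (auto simp: tendsto_iff)
      then obtain b where "b < x" "\<forall>t<x. b < t \<longrightarrow> dist (f t) l < 1"
        by (auto simp: eventually_at_left_field)
      then show ?thesis
        by (intro exI[of _ "x - b"] conjI exI[of _ "1 + \<bar>l\<bar>"]) (force simp: dist_real_def)+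
    next
      case False
      then show ?thesis by (intro exI[of _ 1]) auto
    qed
    then obtain d2 K2 where 2: "d2 > 0" "\<forall>t\<in>{x-d2<..<x} \<inter> {0..T}. \<bar>f t\<bar> \<le> K2" by auto
    show ?case
    proof (intro exI[of _ "min d1 d2"] conjI allI impI)
      fix a b assume ab: "a \<le> x \<and> x \<le> b \<and> b - a < min d1 d2"
      have "\<bar>f t\<bar> \<le> max \<bar>f x\<bar> (max K1 K2)" if "t \<in> {a..b} \<inter> {0..T}" for t
      proof (cases t x rule: linorder_cases)
        case less
        then have "\<bar>f t\<bar> \<le> K2" using that ab by (intro bspec[OF 2(2)]) auto
        then show ?thesis by simp
      next
        case greater
        then have "\<bar>f t\<bar> \<le> K1" using that ab by (intro bspec[OF 1(2)]) auto
        then show ?thesis by simp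
      qed simp
      then show "P a b" unfolding P_def by (intro exI ballI)
    qed (use 1 2 in auto)
  qed
  then obtain K where K: "\<And>t. t \<in> {0..T} \<Longrightarrow> \<bar>f t\<bar> \<le> K" unfolding P_def by blast
  show ?thesis
    by (rule that[of "max K 0"]) (use K in \<open>auto simp: le_max_iff_disj\<close>)
qed

text \<open>Freezing the path outside [0, u] gives a function on the whole line that is
  right-continuous everywhere. It reads the path only on [0, u], which later keeps it measurable
  with respect to the information at \<open>u\<close>.\<close>

lemma cadlag_on_clamp:
  assumes f: "cadlag_on T f" and u: "u \<in> {0..T}"
  shows "continuous (at_right t) (\<lambda>s. f (max 0 (min s u)))"
proof -
  consider "t < 0" | "0 \<le> t" "t < u" | "u \<le> t" "0 \<le> t" by linarith
  then have "((\<lambda>s. f (max 0 (min s u))) \<longlongrightarrow> f (max 0 (min t u))) (at_right t)"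
  proof cases
    case 1
    have "\<forall>\<^sub>F s in at_right t. f (max 0 (min t u)) = f (max 0 (min s u))"
      using 1 u by (auto simp: eventually_at_right[of t 0] intro!: exI[of _ 0])
    then show ?thesis by (rule Lim_transform_eventually[OF tendsto_const])
  next
    case 2
    have "\<forall>\<^sub>F s in at_right t. f s = f (max 0 (min s u))"
      using 2 u by (auto simp: eventually_at_right[of t u] intro!: exI[of _ u])
    then have "((\<lambda>s. f (max 0 (min s u))) \<longlongrightarrow> f t) (at_right t)"
      by (rule Lim_transform_eventually[rotated]) (use 2 u cadlag_on_right[OF f, of t] in auto)
    then show ?thesis using 2 by simp
  next
    case 3
    have "\<forall>\<^sub>F s in at_right t. f (max 0 (min t u)) = f (max 0 (min s u))"
      using 3 u by (auto simp: eventually_at_right[of t "t+1"] intro!: exI[of _ "t+1"])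
    then show ?thesis by (rule Lim_transform_eventually[OF tendsto_const])
  qed
  then show ?thesis by (simp add: continuous_within)
qed

text \<open>Rounding the time up to a grid of mesh 1 / (n + 1) leaves countably many sections, so
  the rounded process is measurable; right continuity recovers the process in the limit.\<close>

lemma right_continuous_joint_measurable:
  fixes X :: "real \<Rightarrow> 'a \<Rightarrow> real"
  assumes X: "\<And>t. X t \<in> borel_measurable N"
    and right: "\<And>\<omega> t. \<omega> \<in> space N \<Longrightarrow> continuous (at_right t) (\<lambda>s. X s \<omega>)"
  shows "(\<lambda>(s, \<omega>). X s \<omega>) \<in> borel_measurable (borel \<Otimes>\<^sub>M N)"
proof -
  \<comment> \<open>Floor plus one, and not the ceiling, so that \<open>g n s\<close> is strictly
    above \<open>s\<close> even at grid points: the convergence is then one along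
    \<open>at_right\<close>.\<close>
  define g where "g n s = (of_int \<lfloor>real (Suc n) * s\<rfloor> + 1) / real (Suc n)" for n and s :: real
  have g: "s < g n s" "g n s \<le> s + 1 / real (Suc n)" for n s
  proof -
    have "real (Suc n) * s < of_int \<lfloor>real (Suc n) * s\<rfloor> + 1" by linarith
    then show "s < g n s" by (simp add: g_def field_simps)
    have "of_int \<lfloor>real (Suc n) * s\<rfloor> + 1 \<le> real (Suc n) * s + 1" by linarith
    then show "g n s \<le> s + 1 / real (Suc n)" unfolding g_def
      by (metis add_divide_distrib divide_right_mono nonzero_mult_div_cancel_left of_nat_0_le_iff
          of_nat_eq_0_iff old.nat.distinct(2))
  qed
  have "(\<lambda>p. X (g n (fst p)) (snd p)) \<in> borel_measurable (borel \<Otimes>\<^sub>M N)" for n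
  proof -
    have "(\<lambda>p. X ((of_int i + 1) / real (Suc n)) (snd p)) \<in> borel_measurable (borel \<Otimes>\<^sub>M N)" for i :: int
      using X by measurable
    then have "(\<lambda>p. (\<lambda>i p. X ((of_int i + 1) / real (Suc n)) (snd p)) \<lfloor>real (Suc n) * fst p\<rfloor> p)
        \<in> borel_measurable (borel \<Otimes>\<^sub>M N)"
      by (rule measurable_compose_countable) measurable
    then show ?thesis by (simp add: g_def)
  qed
  moreover have "(\<lambda>n. X (g n (fst p)) (snd p)) \<longlonglongrightarrow> X (fst p) (snd p)"
    if "p \<in> space (borel \<Otimes>\<^sub>M N)" for p
  proof -
    have "(\<lambda>n. g n (fst p)) \<longlonglongrightarrow> fst p"
    proof (rule tendsto_sandwich[where f = "\<lambda>n. fst p" and h = "\<lambda>n. fst p + 1 / real (Suc n)"])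
      show "(\<lambda>n. fst p + 1 / real (Suc n)) \<longlonglongrightarrow> fst p"
        using tendsto_add[OF tendsto_const[of "fst p"] LIMSEQ_inverse_real_of_nat]
        by (simp add: inverse_eq_divide)
      show "\<forall>\<^sub>F n in sequentially. fst p \<le> g n (fst p)"
        using g(1) by (intro always_eventually allI less_imp_le)
      show "\<forall>\<^sub>F n in sequentially. g n (fst p) \<le> fst p + 1 / real (Suc n)"
        using g(2) by (intro always_eventually allI)
    qed simp
    moreover have "g n (fst p) \<in> {fst p<..}" "g n (fst p) \<noteq> fst p" for n
      using g(1)[of "fst p" n] by auto
    ultimately have "filterlim (\<lambda>n. g n (fst p)) (at_right (fst p)) sequentially"
      unfolding filterlim_at by (intro conjI always_eventually allI)
    moreover have "((\<lambda>s. X s (snd p)) \<longlongrightarrow> X (fst p) (snd p)) (at_right (fst p))"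
      using right[of "snd p" "fst p"] that by (auto simp: continuous_within space_pair_measure)
    ultimately show ?thesis by (rule filterlim_compose[where g = "\<lambda>s. X s (snd p)", rotated])
  qed
  ultimately have "(\<lambda>p. X (fst p) (snd p)) \<in> borel_measurable (borel \<Otimes>\<^sub>M N)"
    by (rule borel_measurable_LIMSEQ_real[where u = "\<lambda>n p. X (g n (fst p)) (snd p)", rotated])
  then show ?thesis by (simp add: case_prod_beta)
qed

section \<open>Measurability and time integrals of a single path\<close>

lemma cadlag_on_clamp_measurable:
  assumes "cadlag_on T f" "u \<in> {0..T}"
  shows "(\<lambda>s. f (max 0 (min s u))) \<in> borel_measurable borel"
proof -
  \<comment> \<open>A one-point space turns joint measurability into measurability in time
    alone.\<close>
  have "(\<lambda>(s, \<omega>::unit). f (max 0 (min s u))) \<in> borel_measurable (borel \<Otimes>\<^sub>M count_space UNIV)"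
    by (rule right_continuous_joint_measurable) (use cadlag_on_clamp[OF assms] in auto)
  from measurable_compose[OF measurable_Pair[OF measurable_ident_sets[OF refl] measurable_const[of "()"]] this]
  show ?thesis by simp
qed

lemma cadlag_on_set_borel_measurable:
  assumes f: "cadlag_on T f" and "0 \<le> T" "A \<in> sets borel" "A \<subseteq> {0..T}"
  shows "set_borel_measurable lborel A f"
proof -
  have [measurable]: "(\<lambda>s. f (max 0 (min s T))) \<in> borel_measurable borel"
    using cadlag_on_clamp_measurable[OF f, of T] assms by auto
  have "(\<lambda>s. indicator A s *\<^sub>R f (max 0 (min s T))) \<in> borel_measurable lborel"
    using assms by measurable
  also have "(\<lambda>s. indicator A s *\<^sub>R f (max 0 (min s T))) = (\<lambda>s. indicator A s *\<^sub>R f s)"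
    using assms by (auto simp: fun_eq_iff indicator_def min_def max_def split: if_splits)
  finally show ?thesis by (simp add: set_borel_measurable_def)
qed

lemma cadlag_on_set_integrable:
  assumes f: "cadlag_on T f" and T: "0 \<le> T" and ab: "0 \<le> a" "b \<le> T"
  shows "set_integrable lborel {a..b} f"
proof -
  obtain K where K: "0 \<le> K" "\<And>t. t \<in> {0..T} \<Longrightarrow> \<bar>f t\<bar> \<le> K" using cadlag_on_bounded[OF f T] by blast
  show ?thesis
  proof (rule set_integrable_bound)
    show "set_integrable lborel {a..b} (\<lambda>_. K)"
      by (intro borel_integrable_atLeastAtMost' continuous_on_const)
    show "set_borel_measurable lborel {a..b} f"
      by (rule cadlag_on_set_borel_measurable[OF f T]) (use ab in auto)
  qed (use K ab in \<open>auto intro!: AE_I2\<close>)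
qed

lemma set_integral_split:
  fixes f :: "real \<Rightarrow> real"
  assumes "set_integrable lborel {a..c} f" "a \<le> b" "b \<le> c"
  shows "(LBINT s:{a..c}. f s) = (LBINT s:{a..b}. f s) + (LBINT s:{b..c}. f s)"
proof -
  have i: "set_integrable lborel {a..b} f" "set_integrable lborel {b..c} f"
    by (rule set_integrable_subset[OF assms(1)]; use assms in auto)+
  have "(LBINT s:{a..c}. f s) = (LBINT s:{a..b} \<union> {b..c}. f s)"
    using assms by (simp add: ivl_disj_un)
  also have "\<dots> = (LBINT s:{a..b}. f s) + (LBINT s:{b..c}. f s)"
  proof (rule set_integral_Un_AE)
    show "AE x in lborel. \<not> (x \<in> {a..b} \<and> x \<in> {b..c})"
      using AE_lborel_singleton[of b] by eventually_elim auto
  qed (use i in auto)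
  finally show ?thesis .
qed

lemma cadlag_integral_lipschitz:
  assumes f: "cadlag_on T f" and K: "\<And>t. t \<in> {0..T} \<Longrightarrow> \<bar>f t\<bar> \<le> K"
    and ab: "0 \<le> a" "a \<le> b" "b \<le> T"
  shows "\<bar>LBINT s:{a..b}. f s\<bar> \<le> K * (b - a)"
proof -
  have i: "set_integrable lborel {a..b} f" using cadlag_on_set_integrable[OF f] ab by auto
  have "\<bar>LBINT s:{a..b}. f s\<bar> \<le> (LBINT s:{a..b}. \<bar>f s\<bar>)"
    using set_integral_norm_bound[OF i] by simp
  also have "\<dots> \<le> (LBINT s:{a..b}. K)"
    by (rule set_integral_mono[OF set_integrable_abs[OF i]
          borel_integrable_atLeastAtMost'[OF continuous_on_const]]) (use K ab in auto)
  also have "\<dots> = K * (b - a)" using ab by (simp add: set_lebesgue_integral_def)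
  finally show ?thesis .
qed

lemma cadlag_integral_continuous:
  assumes f: "cadlag_on T f" shows "continuous_on {0..T} (\<lambda>t. LBINT s:{0..t}. f s)"
proof (cases "0 \<le> T")
  case T: True
  obtain K where K: "0 \<le> K" "\<And>t. t \<in> {0..T} \<Longrightarrow> \<bar>f t\<bar> \<le> K" using cadlag_on_bounded[OF f T] by blast
  have *: "dist (LBINT s:{0..a}. f s) (LBINT s:{0..b}. f s) \<le> K * dist a b"
    if "a \<in> {0..T}" "b \<in> {0..T}" "a \<le> b" for a b
  proof -
    have "(LBINT s:{0..b}. f s) = (LBINT s:{0..a}. f s) + (LBINT s:{a..b}. f s)"
      by (rule set_integral_split[OF cadlag_on_set_integrable[OF f T]]) (use that in auto)
    then show ?thesis
      using cadlag_integral_lipschitz[OF f K(2), of a b] that by (simp add: dist_real_def)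
  qed
  have "K-lipschitz_on {0..T} (\<lambda>t. LBINT s:{0..t}. f s)"
    by (rule lipschitz_onI) (use * K in \<open>metis dist_commute linear\<close>, use K in auto)
  then show ?thesis by (rule lipschitz_on_continuous_on)
qed auto

text \<open>Only the right derivative exists in general: at a jump of \<open>f\<close> the integral
  has a kink.\<close>

lemma cadlag_integral_right_derivative:
  assumes f: "cadlag_on T f" and t: "t \<in> {0..<T}"
  shows "((\<lambda>u. LBINT s:{0..u}. f s) has_real_derivative f t) (at_right t)"
proof -
  have T: "0 \<le> T" using t by auto
  note i = cadlag_on_set_integrable[OF f T]
  have "((\<lambda>u. integral {t..u} f) has_vector_derivative f t) (at t within {t..T} - {})"
  proof (rule integral_has_vector_derivative_continuous_at)
    show "f integrable_on {t..T}" using set_borel_integral_eq_integral(1)[OF i[of t T]] t by auto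
    show "continuous (at t within {t..T} - {}) f"
      using f t by (simp add: cadlag_on_def at_within_Icc_at_right)
  qed (use t in auto)
  then have "((\<lambda>u. integral {t..u} f) has_real_derivative f t) (at t within {t..T})"
    by (simp add: has_real_derivative_iff_has_vector_derivative)
  then have d: "((\<lambda>u. (LBINT s:{0..t}. f s) + integral {t..u} f) has_real_derivative f t)
      (at t within {t..T})"
    using DERIV_add[OF DERIV_const, of _ "f t"] by simp
  have eq: "(LBINT s:{0..t}. f s) + integral {t..u} f = (LBINT s:{0..u}. f s)" if "t \<le> u" "u \<le> T" for u
    using set_integral_split[OF i[of 0 u], of t] set_borel_integral_eq_integral(2)[OF i[of t u]] that t
    by simp
  have "((\<lambda>u. LBINT s:{0..u}. f s) has_real_derivative f t) (at t within {t..T})"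
  proof (rule has_field_derivative_transform_within[OF d zero_less_one])
    show "t \<in> {t..T}" using t by simp
    show "(LBINT s:{0..t}. f s) + integral {t..u} f = (LBINT s:{0..u}. f s)" if "u \<in> {t..T}" for u
      using that by (intro eq) auto
  qed
  then show ?thesis using t by (simp add: at_within_Icc_at_right)
qed

text \<open>With a derivative from one side only, the mean value theorem does not apply directly.
  For every slope \<open>e > 0\<close> the bound \<open>e * (s - a)\<close> on the increment is
  pushed from \<open>a\<close> to \<open>b\<close> by a supremum argument, and then \<open>e\<close>
  tends to 0.\<close>

lemma right_derivative_zero_const:
  fixes \<phi> :: "real \<Rightarrow> real"
  assumes cont: "continuous_on {a..b} \<phi>"
    and der: "\<And>t. t \<in> {a..<b} \<Longrightarrow> (\<phi> has_real_derivative 0) (at_right t)"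
    and ab: "a \<le> b"
  shows "\<phi> b = \<phi> a"
proof -
  have "\<bar>\<phi> b - \<phi> a\<bar> \<le> e * (b - a)" if e: "0 < e" for e
  proof -
    define S where "S = {t \<in> {a..b}. \<forall>s\<in>{a..t}. \<bar>\<phi> s - \<phi> a\<bar> \<le> e * (s - a)}"
    define c where "c = Sup S"
    have aS: "a \<in> S" using ab by (auto simp: S_def)
    have bdd: "bdd_above S" by (auto simp: S_def bdd_above_def)
    have ac: "a \<le> c" unfolding c_def by (rule cSup_upper[OF aS bdd])
    have cb: "c \<le> b" unfolding c_def by (rule cSup_least) (use aS in \<open>auto simp: S_def\<close>)
    have below: "\<bar>\<phi> s - \<phi> a\<bar> \<le> e * (s - a)" if s: "s \<in> {a..<c}" for s
    proof -
      obtain t where "t \<in> S" "s < t" using s less_cSup_iff[of S s] aS bdd by (auto simp: c_def)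
      then show ?thesis using s by (auto simp: S_def)
    qed
    have at_c: "\<bar>\<phi> c - \<phi> a\<bar> \<le> e * (c - a)"
    proof (cases "a = c")
      case False
      then have lt: "a < c" using ac by simp
      have "(\<phi> \<longlongrightarrow> \<phi> c) (at c within {a..c})"
        by (rule tendsto_within_subset[where S = "{a..b}"])
           (use cont lt cb in \<open>auto simp: continuous_on_def\<close>)
      then have 1: "((\<lambda>s. \<bar>\<phi> s - \<phi> a\<bar>) \<longlongrightarrow> \<bar>\<phi> c - \<phi> a\<bar>) (at_left c)"
        using lt by (auto simp: at_within_Icc_at_left intro!: tendsto_intros)
      have 2: "((\<lambda>s. e * (s - a)) \<longlongrightarrow> e * (c - a)) (at_left c)" by (intro tendsto_intros)
      show ?thesis
        by (rule tendsto_le[OF _ 2 1])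
           (use lt below in \<open>auto simp: eventually_at_left[of a c] intro!: exI[of _ a]\<close>)
    qed simp
    \<comment> \<open>If \<open>c < b\<close>, the right derivative 0 at \<open>c\<close> keeps the
      difference quotients below \<open>e\<close> on a short interval, so points beyond
      \<open>c\<close> still lie in \<open>S\<close>.\<close>
    have "c = b"
    proof (rule ccontr)
      assume "c \<noteq> b"
      then have cb': "c < b" using cb by simp
      have "((\<lambda>s. (\<phi> s - \<phi> c) / (s - c)) \<longlongrightarrow> 0) (at_right c)"
        using der[of c] ac cb' by (simp add: has_field_derivative_iff)
      then have "\<forall>\<^sub>F s in at_right c. \<bar>(\<phi> s - \<phi> c) / (s - c)\<bar> < e"
        using e by (auto simp: tendsto_iff dist_real_def)
      then obtain d where d: "d > c" "\<And>s. c < s \<Longrightarrow> s < d \<Longrightarrow> \<bar>(\<phi> s - \<phi> c) / (s - c)\<bar> < e"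
        by (auto simp: eventually_at_right_field)
      define u where "u = min b ((c + d) / 2)"
      have u: "c < u" "u \<le> b" "u < d" using d cb' by (auto simp: u_def min_def field_simps)
      have "\<bar>\<phi> s - \<phi> a\<bar> \<le> e * (s - a)" if s: "s \<in> {a..u}" for s
      proof (cases s c rule: linorder_cases)
        case less
        then show ?thesis using below s by auto
      next
        case greater
        then have "\<bar>\<phi> s - \<phi> c\<bar> \<le> e * (s - c)"
          using d(2)[of s] s u by (auto simp: abs_divide field_simps)
        then show ?thesis using at_c by (simp add: algebra_simps)
      qed (use at_c in simp)
      then have "u \<in> S" using u ac by (auto simp: S_def)
      then have "u \<le> c" unfolding c_def by (rule cSup_upper[OF _ bdd])
      then show False using u by simp
    qed
    then show ?thesis using at_c by simp
  qed
  then have "\<bar>\<phi> b - \<phi> a\<bar> \<le> e" if "0 < e" for e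
  proof -
    \<comment> \<open>The \<open>+ 1\<close> keeps the divisor positive when
      \<open>a = b\<close>.\<close>
    have "\<bar>\<phi> b - \<phi> a\<bar> \<le> e / (b - a + 1) * (b - a)"
      using \<open>\<And>e. 0 < e \<Longrightarrow> \<bar>\<phi> b - \<phi> a\<bar> \<le> e * (b - a)\<close>[of "e / (b - a + 1)"] that ab by auto
    also have "\<dots> \<le> e" using that ab by (simp add: field_simps)
    finally show ?thesis .
  qed
  then have "\<bar>\<phi> b - \<phi> a\<bar> \<le> 0" by (rule field_le_epsilon) simp
  then show ?thesis by simp
qed

text \<open>
  The exceptional null set is covered by an open set so small that absolute continuity controls
  the increments over the intervals tagged in it.
\<close>

lemma abs_continuous_has_integral:
  fixes f f' :: "real \<Rightarrow> real"
  assumes ac: "abs_continuous_on T f"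
    and der: "AE t in lborel. t \<in> {0<..<T} \<longrightarrow> (f has_real_derivative f' t) (at t)"
    and b: "0 \<le> b" "b \<le> T"
  shows "(f' has_integral (f b - f 0)) {0..b}"
proof -
  obtain N0 where N0: "{t. \<not> (t \<in> {0<..<T} \<longrightarrow> (f has_real_derivative f' t) (at t))} \<subseteq> N0"
    "N0 \<in> null_sets lborel"
    using der by (auto elim!: AE_E simp: null_sets_def)
  \<comment> \<open>The endpoints join the exceptional set, since differentiability is assumed only
    in the open interval.\<close>
  define N where "N = insert 0 (insert T N0)"
  have N: "N \<in> null_sets lborel" 
  proof -
    have "N = {0, T} \<union> N0" by (auto simp: N_def)
    then show ?thesis using null_sets.Un[OF finite_imp_null_set_lborel[of "{0, T}"] N0(2)] by simp
  qed
  have der: "(f has_real_derivative f' t) (at t)" if "t \<in> {0..b} - N" for t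
    using that b subsetD[OF N0(1), of t] by (auto simp: N_def)
  \<comment> \<open>With value 0 on \<open>N\<close>, a term tagged in \<open>N\<close> contributes
    nothing to the Riemann sum, and its error is just the increment of \<open>f\<close>.\<close>
  define g where "g t = (if t \<in> N then 0 else f' t)" for t
  have "(g has_integral (f b - f 0)) {0..b}"
    unfolding has_integral_real
  proof (intro allI impI)
    fix e :: real assume e: "0 < e"
    \<comment> \<open>\<open>b + 1\<close> in place of \<open>b\<close> avoids a division by zero
      and makes \<open>e' * b\<close> strictly smaller than \<open>e / 2\<close>.\<close>
    define e' where "e' = e / (2 * (b + 1))"
    have e': "0 < e'" "e' * (b + 1) = e / 2" using e b by (auto simp: e'_def field_simps)
    then have e'b: "e' * b < e / 2" by (simp add: distrib_left)
    obtain d where d: "d > 0" and ac': "\<And>(k::nat) a b. (\<forall>i<k. 0 \<le> a i \<and> a i \<le> b i \<and> b i \<le> T) \<Longrightarrow>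
        (\<forall>i<k. \<forall>j<k. i \<noteq> j \<longrightarrow> b i \<le> a j \<or> b j \<le> a i) \<Longrightarrow>
        (\<Sum>i<k. b i - a i) < d \<Longrightarrow> (\<Sum>i<k. \<bar>f (b i) - f (a i)\<bar>) < e / 2"
      using ac[unfolded abs_continuous_on_def, rule_format, of "e/2"] e by auto
    obtain U where U: "open U" "N \<subseteq> U" "emeasure lborel (U - N) < ennreal d"
      by (rule outer_regular_lborel[of N d]) (use N d in auto)
    have Ud: "emeasure lborel U < ennreal d"
    proof -
      have "emeasure lborel U = emeasure lborel (U - N)"
        using U N by (intro emeasure_Diff_null_set[symmetric]) auto
      then show ?thesis using U by simp
    qed
    have "\<exists>r>0. \<forall>s. \<bar>s - t\<bar> < r \<longrightarrow> \<bar>f s - f t - f' t * (s - t)\<bar> \<le> e' * \<bar>s - t\<bar>"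
      if "t \<in> {0..b} - N" for t
      using der[OF that] e'(1) unfolding has_field_derivative_def has_derivative_within_alt
      by (auto simp: mult.commute)
    then obtain r where r: "\<And>t. t \<in> {0..b} - N \<Longrightarrow> 0 < r t"
      "\<And>t s. t \<in> {0..b} - N \<Longrightarrow> \<bar>s - t\<bar> < r t \<Longrightarrow> \<bar>f s - f t - f' t * (s - t)\<bar> \<le> e' * \<bar>s - t\<bar>"
      by metis
    \<comment> \<open>Outside \<open>N\<close> the gauge enforces the difference quotient estimate;
      at tags in \<open>N\<close> it confines the interval to \<open>U\<close>, whose measure is
      below \<open>d\<close>.\<close>
    define \<gamma> where "\<gamma> t = (if t \<in> N then U else if t \<in> {0..b} then ball t (r t) else UNIV)" for t
    have gauge: "gauge \<gamma>" using U r(1) by (auto simp: gauge_def \<gamma>_def)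
    have bound: "norm ((\<Sum>(x,k)\<in>p. measure lborel k *\<^sub>R g x) - (f b - f 0)) < e"
      if p: "p tagged_division_of {0..b}" and fine: "\<gamma> fine p" for p
    proof -
      note tag = tagged_division_ofD[OF p]
      have ivl: "\<exists>u v. k = {u..v} \<and> u \<le> v \<and> Inf k = u \<and> Sup k = v \<and> 0 \<le> u \<and> v \<le> b \<and> x \<in> {u..v} \<and> {u..v} \<subseteq> \<gamma> x"
        if xk: "(x, k) \<in> p" for x k
      proof -
        obtain u v where k: "k = cbox u v" using tag(4)[OF xk] by auto
        moreover have "x \<in> k" using tag(2)[OF xk] .
        moreover have "k \<subseteq> {0..b}" using tag(3)[OF xk] .
        moreover have "k \<subseteq> \<gamma> x" using fine xk by (auto simp: fine_def)
        ultimately show ?thesis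
          by (intro exI[of _ u] exI[of _ v]) (auto simp: subset_iff)
      qed
      let ?\<delta> = "\<lambda>(x,k). f (Sup k) - f (Inf k)"
      let ?err = "\<lambda>(x,k). measure lborel k *\<^sub>R g x - (f (Sup k) - f (Inf k))"
      have sum: "(\<Sum>(x,k)\<in>p. f (Sup k) - f (Inf k)) = f b - f 0"
        using additive_tagged_division_1[OF b(1) p, of f] .
      \<comment> \<open>Degenerate intervals are left out because one of them may sit inside another
        interval of the division, which would violate the ordering demanded by
        \<open>abs_continuous_on\<close>. Their error is 0, so they belong to the harmless
        part.\<close>
      define P where "P = {(x,k) \<in> p. x \<in> N \<and> Inf k < Sup k}"
      have finP: "finite P" by (rule finite_subset[OF _ tag(1)]) (auto simp: P_def)
      have good: "\<bar>?err z\<bar> \<le> e' * measure lborel (snd z)" if z: "z \<in> p - P" for z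
      proof -
        obtain x k where zk: "z = (x, k)" by force
        obtain u v where k: "k = {u..v}" "u \<le> v" "Inf k = u" "Sup k = v" "0 \<le> u" "v \<le> b"
          "x \<in> {u..v}" "{u..v} \<subseteq> \<gamma> x" using ivl[of x k] z zk by auto
        show ?thesis
        proof (cases "u = v")
          case False
          then have x: "x \<in> {0..b} - N" using z zk k by (auto simp: P_def)
          then have "\<bar>u - x\<bar> < r x" "\<bar>v - x\<bar> < r x"
            using k(2) subsetD[OF k(8), of u] subsetD[OF k(8), of v]
            by (auto simp: \<gamma>_def dist_real_def abs_minus_commute)
          then have "\<bar>f u - f x - f' x * (u - x)\<bar> \<le> e' * \<bar>u - x\<bar>"
            "\<bar>f v - f x - f' x * (v - x)\<bar> \<le> e' * \<bar>v - x\<bar>" using r(2)[OF x] by auto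
          \<comment> \<open>The tag splits [u, v], so the two one-sided estimates at
            \<open>x\<close> add up to \<open>e' * (v - u)\<close>.\<close>
          then have 1: "\<bar>f u - f x - f' x * (u - x)\<bar> + \<bar>f v - f x - f' x * (v - x)\<bar> \<le> e' * (v - u)"
            using k(7) by (auto simp: algebra_simps)
          have "?err z = (f u - f x - f' x * (u - x)) - (f v - f x - f' x * (v - x))"
            using k x unfolding zk by (simp add: g_def algebra_simps)
          then have "\<bar>?err z\<bar> \<le> \<bar>f u - f x - f' x * (u - x)\<bar> + \<bar>f v - f x - f' x * (v - x)\<bar>"
            by linarith
          also note 1
          finally show ?thesis using k zk by simp
        qed (use k zk in simp)
      qed
      have "\<bar>\<Sum>z\<in>p - P. ?err z\<bar> \<le> (\<Sum>z\<in>p - P. e' * measure lborel (snd z))"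
        using good by (intro sum_abs[THEN order_trans] sum_mono) auto
      also have "\<dots> \<le> (\<Sum>z\<in>p. e' * measure lborel (snd z))"
        using tag(1) e' by (intro sum_mono2) auto
      also have "\<dots> = e' * b"
        using additive_content_tagged_division[of p 0 b] p b
        by (simp add: sum_distrib_left[symmetric] case_prod_beta)
      finally have G: "\<bar>\<Sum>z\<in>p - P. ?err z\<bar> \<le> e' * b" .
      obtain h where h: "bij_betw h {0..<card P} P" using ex_bij_betw_nat_finite[OF finP] by auto
      define l where "l i = Inf (snd (h i))" for i
      define u where "u i = Sup (snd (h i))" for i
      have hi: "snd (h i) = {l i..u i}" "l i < u i" "0 \<le> l i" "u i \<le> b" "{l i..u i} \<subseteq> U" "h i \<in> p"
        if "i < card P" for i
      proof -
        have "h i \<in> P" using h that by (auto simp: bij_betw_def)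
        then have hp: "(fst (h i), snd (h i)) \<in> p" "fst (h i) \<in> N" "Inf (snd (h i)) < Sup (snd (h i))"
          by (auto simp: P_def)
        then show "h i \<in> p" by simp
        obtain u' v where k: "snd (h i) = {u'..v}" "u' \<le> v" "Inf (snd (h i)) = u'" "Sup (snd (h i)) = v"
          "0 \<le> u'" "v \<le> b" "{u'..v} \<subseteq> \<gamma> (fst (h i))" using ivl[OF hp(1)] by auto
        then show "snd (h i) = {l i..u i}" "l i < u i" "0 \<le> l i" "u i \<le> b" "{l i..u i} \<subseteq> U"
          using hp by (auto simp: l_def u_def \<gamma>_def)
      qed
      have disj: "{l i<..<u i} \<inter> {l j<..<u j} = {}" if "i < card P" "j < card P" "i \<noteq> j" for i j
      proof -
        have "h i \<noteq> h j" using h that by (auto simp: bij_betw_def inj_on_def)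
        moreover have "(fst (h i), snd (h i)) \<in> p" "(fst (h j), snd (h j)) \<in> p" using hi(6) that by auto
        ultimately have "interior (snd (h i)) \<inter> interior (snd (h j)) = {}"
          using tag(5)[of "fst (h i)" "snd (h i)" "fst (h j)" "snd (h j)"] by (simp add: prod_eq_iff)
        then show ?thesis using hi(1) that by (simp add: interior_atLeastAtMost_real)
      qed
      have "(\<Sum>z\<in>P. \<bar>?\<delta> z\<bar>) = (\<Sum>i<card P. \<bar>?\<delta> (h i)\<bar>)"
        using sum.reindex_bij_betw[OF h, of "\<lambda>z. \<bar>?\<delta> z\<bar>"] by (simp add: atLeast0LessThan)
      also have "\<dots> = (\<Sum>i<card P. \<bar>f (u i) - f (l i)\<bar>)"
        by (simp add: l_def u_def case_prod_beta)
      also have "\<dots> < e / 2"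
      proof (rule ac')
        show "\<forall>i<card P. 0 \<le> l i \<and> l i \<le> u i \<and> u i \<le> T"
          using hi b by (meson less_imp_le order_trans)
        show "\<forall>i<card P. \<forall>j<card P. i \<noteq> j \<longrightarrow> u i \<le> l j \<or> u j \<le> l i"
        proof (intro allI impI, rule ccontr)
          fix i j assume ij: "i < card P" "j < card P" "i \<noteq> j" "\<not> (u i \<le> l j \<or> u j \<le> l i)"
          obtain m where "max (l i) (l j) < m" "m < min (u i) (u j)"
            using dense[of "max (l i) (l j)" "min (u i) (u j)"] ij hi(2)[of i] hi(2)[of j] by auto
          then have "m \<in> {l i<..<u i} \<inter> {l j<..<u j}" by auto
          then show False using disj[OF ij(1-3)] by blast
        qed
        have "ennreal (\<Sum>i<card P. u i - l i) = (\<Sum>i<card P. emeasure lborel {l i<..<u i})"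
          using hi(2) by (subst sum_ennreal[symmetric]) (auto simp: less_imp_le intro!: sum.cong)
        also have "\<dots> = emeasure lborel (\<Union>i<card P. {l i<..<u i})"
          using disj by (intro sum_emeasure) (auto simp: disjoint_family_on_def)
        also have "\<dots> \<le> emeasure lborel U"
          using hi(5) U(1) by (intro emeasure_mono) fastforce+
        also note Ud
        finally show "(\<Sum>i<card P. u i - l i) < d"
          
          by (rule ennreal_less_iff[THEN iffD1, rotated]) (auto intro!: sum_nonneg dest: hi(2))
      qed
      finally have B: "(\<Sum>z\<in>P. \<bar>?\<delta> z\<bar>) < e / 2" .
      have "(\<Sum>z\<in>P. ?err z) = - (\<Sum>z\<in>P. ?\<delta> z)"
        unfolding sum_negf[symmetric] by (intro sum.cong) (auto simp: P_def g_def)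
      then have "\<bar>\<Sum>z\<in>P. ?err z\<bar> = \<bar>\<Sum>z\<in>P. ?\<delta> z\<bar>" by (simp only: abs_minus_cancel)
      also have "\<dots> \<le> (\<Sum>z\<in>P. \<bar>?\<delta> z\<bar>)" by (rule sum_abs)
      also note B
      finally have "\<bar>\<Sum>z\<in>P. ?err z\<bar> < e / 2" .
      moreover have "(\<Sum>z\<in>p. ?err z) = (\<Sum>z\<in>p - P. ?err z) + (\<Sum>z\<in>P. ?err z)"
        using tag(1) by (intro sum.subset_diff) (auto simp: P_def)
      ultimately have "\<bar>\<Sum>z\<in>p. ?err z\<bar> < e" using G e'b by linarith
      moreover have "(\<Sum>z\<in>p. ?err z) = (\<Sum>(x,k)\<in>p. measure lborel k *\<^sub>R g x) - (f b - f 0)"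
        unfolding sum[symmetric] sum_subtractf[symmetric] by (intro sum.cong) auto
      ultimately show ?thesis by simp
    qed
    show "\<exists>\<gamma>. gauge \<gamma> \<and> (\<forall>p. p tagged_division_of {0..b} \<and> \<gamma> fine p \<longrightarrow>
        norm ((\<Sum>(x,k)\<in>p. measure lborel k *\<^sub>R g x) - (f b - f 0)) < e)"
      by (rule exI[of _ \<gamma>]) (use gauge bound in simp)
  qed
  moreover have "negligible N"
    using N by (auto simp: negligible_iff_null_sets intro: null_sets_completionI)
  ultimately show ?thesis
    by (rule has_integral_spike[rotated 2]) (auto simp: g_def)
qed

lemma LBINT_singleton: "(LBINT s:{a}. f s) = (0::real)"
proof -
  have "AE s in lborel. indicator {a} s *\<^sub>R f s = 0"
    using AE_lborel_singleton[of a] by eventually_elim auto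
  then show ?thesis unfolding set_lebesgue_integral_def by (rule integral_eq_zero_AE)
qed

text \<open>
  The paths involved are differentiable from the right only, which still suffices because a
  continuous function with vanishing right derivative is constant.
\<close>

lemma variation_of_constants:
  fixes \<beta> h u :: "real \<Rightarrow> real"
  assumes \<beta>: "cadlag_on T \<beta>" and h: "cadlag_on T h" and u: "cadlag_on T u"
  defines "B \<equiv> \<lambda>t. LBINT s:{0..t}. \<beta> s"
  shows "(\<forall>t\<in>{0..T}. u t = y - (LBINT s:{0..t}. \<beta> s * u s + h s)) \<longleftrightarrow>
    (\<forall>t\<in>{0..T}. u t = exp (- B t) * (y - (LBINT s:{0..t}. exp (B s) * h s)))"
proof -
  define G where "G t = (LBINT s:{0..t}. exp (B s) * h s)" for t
  define I where "I t = (LBINT s:{0..t}. \<beta> s * u s + h s)" for t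
  have Bc: "continuous_on {0..T} B" unfolding B_def by (rule cadlag_integral_continuous[OF \<beta>])
  have c: "cadlag_on T (\<lambda>s. exp (B s) * h s)" "cadlag_on T (\<lambda>s. \<beta> s * u s + h s)"
    by (intro cadlag_on_mult cadlag_on_add \<beta> h u cadlag_on_continuous continuous_intros Bc)+
  have cont: "continuous_on {0..T} G" "continuous_on {0..T} I"
    unfolding G_def I_def by (intro cadlag_integral_continuous c)+
  have der: "(B has_real_derivative \<beta> t) (at_right t)"
    "(G has_real_derivative exp (B t) * h t) (at_right t)"
    "(I has_real_derivative \<beta> t * u t + h t) (at_right t)" if "t \<in> {0..<T}" for t
    unfolding B_def G_def I_def
    using cadlag_integral_right_derivative[OF \<beta> that] cadlag_integral_right_derivative[OF c(1) that]
      cadlag_integral_right_derivative[OF c(2) that] by (simp_all add: B_def)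
  have 0: "B 0 = 0" "G 0 = 0" "I 0 = 0" by (simp_all add: B_def G_def I_def LBINT_singleton)
  show ?thesis unfolding G_def[symmetric] I_def[symmetric]
  proof safe
    fix t assume eq: "\<forall>t\<in>{0..T}. u t = y - I t" and t: "t \<in> {0..T}"
    \<comment> \<open>Integrating factor: by the equation for \<open>u\<close>, the right derivative
      of \<open>exp (B t) * (y - I t)\<close> is \<open>- exp (B t) * h t\<close>, which
      \<open>G\<close> compensates.\<close>
    have "exp (B t) * (y - I t) + G t = exp (B 0) * (y - I 0) + G 0"
    proof (rule right_derivative_zero_const[where \<phi> = "\<lambda>t. exp (B t) * (y - I t) + G t"])
      show "continuous_on {0..t} (\<lambda>t. exp (B t) * (y - I t) + G t)"
        using t by (intro continuous_intros continuous_on_subset[OF Bc] continuous_on_subset[OF cont(1)]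
            continuous_on_subset[OF cont(2)]) auto
      fix s assume "s \<in> {0..<t}"
      then have s: "s \<in> {0..<T}" using t by auto
      show "((\<lambda>t. exp (B t) * (y - I t) + G t) has_real_derivative 0) (at_right s)"
        by (rule derivative_eq_intros der[OF s] refl)+ (use eq s in \<open>auto simp: algebra_simps\<close>)
    qed (use t in auto)
    then have "exp (B t) * (y - I t) = y - G t" by (simp add: 0)
    then have "y - I t = exp (- B t) * (y - G t)"
      by (simp add: exp_minus field_simps)
    then show "u t = exp (- B t) * (y - G t)" using eq t by auto
  next
    fix t assume eq: "\<forall>t\<in>{0..T}. u t = exp (- B t) * (y - G t)" and t: "t \<in> {0..T}"
    \<comment> \<open>Conversely, the right derivative of the explicit formula is
      \<open>- \<beta> t * u t - h t\<close>, which \<open>I\<close> compensates.\<close>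
    have "exp (- B t) * (y - G t) + I t = exp (- B 0) * (y - G 0) + I 0"
    proof (rule right_derivative_zero_const[where \<phi> = "\<lambda>t. exp (- B t) * (y - G t) + I t"])
      show "continuous_on {0..t} (\<lambda>t. exp (- B t) * (y - G t) + I t)"
        using t by (intro continuous_intros continuous_on_subset[OF Bc] continuous_on_subset[OF cont(1)]
            continuous_on_subset[OF cont(2)]) auto
      fix s assume "s \<in> {0..<t}"
      then have s: "s \<in> {0..<T}" using t by auto
      have us: "u s = exp (- B s) * (y - G s)" using eq s by auto
      have e1: "exp (B s) * exp (- B s) = 1" by (simp add: exp_minus)
      show "((\<lambda>t. exp (- B t) * (y - G t) + I t) has_real_derivative 0) (at_right s)"
        by (rule derivative_eq_intros der[OF s] refl)+
           (simp add: us algebra_simps e1)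
    qed (use t in auto)
    then show "u t = y - I t" using eq t by (simp add: 0)
  qed
qed

section \<open>Stochastic integrals of absolutely continuous integrands\<close>

lemma cadlag_on_stopped:
  assumes f: "cadlag_on T f" and c: "c \<in> {0..T}"
  shows "cadlag_on T (\<lambda>t. f (min c t))"
  unfolding cadlag_on_def
proof safe
  fix t assume t: "t \<in> {0..<T}"
  have "\<forall>\<^sub>F s in at_right t. f (max 0 (min s c)) = f (min c s)"
    using eventually_at_right_less[of t]
    by eventually_elim (use t c in \<open>simp add: min.commute max_absorb2\<close>)
  moreover have "((\<lambda>s. f (max 0 (min s c))) \<longlongrightarrow> f (min c t)) (at_right t)"
    using cadlag_on_clamp[OF f c, of t] t c
    by (simp add: continuous_within min.commute[of t] max_absorb2)
  ultimately show "continuous (at_right t) (\<lambda>t. f (min c t))"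
    unfolding continuous_within by (rule Lim_transform_eventually[rotated])
next
  fix t assume t: "t \<in> {0<..T}"
  show "\<exists>l. ((\<lambda>t. f (min c t)) \<longlongrightarrow> l) (at_left t)"
  proof (cases "t \<le> c")
    case True
    obtain l where l: "(f \<longlongrightarrow> l) (at_left t)" using f t unfolding cadlag_on_def by blast
    have "\<forall>\<^sub>F s in at_left t. f s = f (min c s)"
      using eventually_at_left_real[of 0 t] t
      by (auto elim!: eventually_mono simp: min_absorb2 less_imp_le[OF less_le_trans[OF _ True]])
    then show ?thesis using l by (auto intro: Lim_transform_eventually)
  next
    case False
    have "\<forall>\<^sub>F s in at_left t. f c = f (min c s)"
      using eventually_at_left_real[of c t] False by (auto elim!: eventually_mono simp: min_absorb1)
    then have "((\<lambda>t. f (min c t)) \<longlongrightarrow> f c) (at_left t)"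
      by (rule Lim_transform_eventually[OF tendsto_const])
    then show ?thesis ..
  qed
qed

lemma cadlag_on_sum:
  assumes "\<And>i. i \<in> A \<Longrightarrow> cadlag_on T (f i)"
  shows "cadlag_on T (\<lambda>t. \<Sum>i\<in>A. f i t)"
  using assms by (induction A rule: infinite_finite_induct) (auto intro: cadlag_on_const cadlag_on_add)

text \<open>\<open>T\<close> is added by hand: it has no right neighbourhood in [0, T], and a jump
  at \<open>T\<close> is invisible from earlier times.\<close>

definition dense_times :: "real \<Rightarrow> real set" where
  "dense_times T = insert T ({0..T} \<inter> \<rat>)"

lemma countable_dense_times: "countable (dense_times T)"
  by (auto simp: dense_times_def intro: countable_subset[OF _ countable_rat])

lemma dense_times_subset: "0 \<le> T \<Longrightarrow> dense_times T \<subseteq> {0..T}"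
  by (auto simp: dense_times_def)

text \<open>An open condition that holds at \<open>t < T\<close> persists just to the right of
  \<open>t\<close> and is met there by a rational time. Suprema and exceedance events over [0, T]
  thereby become countable.\<close>

lemma cadlag_on_dense_times:
  assumes f: "cadlag_on T f" and U: "open U" and t: "t \<in> {0..T}" "f t \<in> U"
  shows "\<exists>s\<in>dense_times T. f s \<in> U"
proof (cases "t = T")
  case False
  then have "\<forall>\<^sub>F s in at_right t. f s \<in> U"
    using cadlag_on_right[OF f, of t] t U by (auto simp: topological_tendstoD)
  then obtain b where b: "b > t" "\<And>s. t < s \<Longrightarrow> s < b \<Longrightarrow> f s \<in> U"
    by (auto simp: eventually_at_right_field)
  obtain s where "s \<in> \<rat>" "t < s" "s < min b T"
    using Rats_dense_in_real[of t "min b T"] b t False by auto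
  then show ?thesis using b t by (intro bexI[of _ s]) (auto simp: dense_times_def)
qed (use t in \<open>auto simp: dense_times_def\<close>)

text \<open>
  The oscillation to the right of \<open>s\<close>; for right-continuous paths rational increments suffice,
  which makes it jointly measurable for a process.
\<close>

definition path_osc :: "real \<Rightarrow> (real \<Rightarrow> real) \<Rightarrow> nat \<Rightarrow> real \<Rightarrow> ennreal" where
  "path_osc T f n s = (SUP q\<in>{0..1 / real (Suc n)} \<inter> \<rat>.
     ennreal \<bar>f (max 0 (min (s + q) T)) - f (max 0 (min s T))\<bar>)"

lemma path_osc_antimono: "n \<le> m \<Longrightarrow> path_osc T f m s \<le> path_osc T f n s"
  unfolding path_osc_def
proof (rule SUP_subset_mono)
  assume "n \<le> m"
  then have "1 / real (Suc m) \<le> 1 / real (Suc n)" by (intro divide_left_mono) auto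
  then show "{0..1 / real (Suc m)} \<inter> \<rat> \<subseteq> {0..1 / real (Suc n)} \<inter> \<rat>" by auto
qed simp

lemma path_osc_ge:
  assumes f: "cadlag_on T f" and s: "0 \<le> s" "s \<le> r" "r \<le> T" and r: "r - s < 1 / real (Suc n)"
  shows "ennreal \<bar>f r - f s\<bar> \<le> path_osc T f n s"
proof (rule ccontr)
  assume "\<not> ?thesis"
  then have less: "path_osc T f n s < ennreal \<bar>f r - f s\<bar>" by simp
  have "continuous (at_right r) (\<lambda>s. f (max 0 (min s T)))"
    using cadlag_on_clamp[OF f, of T r] s by auto
  then have "((\<lambda>s. f (max 0 (min s T))) \<longlongrightarrow> f r) (at_right r)"
    using s by (simp add: continuous_within)
  then have "((\<lambda>x. ennreal \<bar>f (max 0 (min x T)) - f s\<bar>) \<longlongrightarrow> ennreal \<bar>f r - f s\<bar>) (at_right r)"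
    by (intro tendsto_intros)
  then have "\<forall>\<^sub>F x in at_right r. path_osc T f n s < ennreal \<bar>f (max 0 (min x T)) - f s\<bar>"
    using less by (rule order_tendstoD)
  then obtain b where b: "b > r"
    "\<And>x. r < x \<Longrightarrow> x < b \<Longrightarrow> path_osc T f n s < ennreal \<bar>f (max 0 (min x T)) - f s\<bar>"
    by (auto simp: eventually_at_right_field)
  obtain q where q: "q \<in> \<rat>" "r - s < q" "q < min (b - s) (1 / real (Suc n))"
    using Rats_dense_in_real[of "r - s" "min (b - s) (1 / real (Suc n))"] b r by auto
  have "ennreal \<bar>f (max 0 (min (s + q) T)) - f (max 0 (min s T))\<bar> \<le> path_osc T f n s"
    unfolding path_osc_def by (rule SUP_upper) (use q s in auto)
  moreover have "path_osc T f n s < ennreal \<bar>f (max 0 (min (s + q) T)) - f s\<bar>"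
    by (rule b(2)) (use q in auto)
  ultimately show False using s by simp
qed

lemma path_osc_bounded:
  assumes K: "\<And>t. t \<in> {0..T} \<Longrightarrow> \<bar>f t\<bar> \<le> K" and T: "0 \<le> T"
  shows "path_osc T f n s \<le> ennreal (2 * K)"
  unfolding path_osc_def
proof (rule SUP_least, rule ennreal_leI)
  fix q
  define g where "g = (\<lambda>s. f (max 0 (min s T)))"
  have "\<bar>g x\<bar> \<le> K" for x unfolding g_def by (rule K) (use T in auto)
  from this[of "s + q"] this[of s] have "\<bar>g (s + q) - g s\<bar> \<le> 2 * K" by linarith
  then show "\<bar>f (max 0 (min (s + q) T)) - f (max 0 (min s T))\<bar> \<le> 2 * K" by (simp only: g_def)
qed

lemma path_osc_tendsto:
  assumes f: "cadlag_on T f" and T: "0 \<le> T"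
  shows "(\<lambda>n. path_osc T f n s) \<longlonglongrightarrow> 0"
proof -
  define g where "g = (\<lambda>s. f (max 0 (min s T)))"
  have g: "(g \<longlongrightarrow> g s) (at_right s)"
    using cadlag_on_clamp[OF f, of T s] T by (simp add: continuous_within g_def)
  have "\<exists>n. path_osc T f n s \<le> ennreal e" if e: "0 < e" for e
  proof -
    have "\<forall>\<^sub>F x in at_right s. dist (g x) (g s) < e" using g e by (rule tendstoD)
    then obtain b where b: "b > s" "\<And>x. s < x \<Longrightarrow> x < b \<Longrightarrow> \<bar>g x - g s\<bar> < e"
      by (auto simp: eventually_at_right_field dist_real_def)
    obtain n where n: "1 / real (Suc n) < b - s"
      using reals_Archimedean[of "b - s"] b(1) by (auto simp: inverse_eq_divide)
    have "path_osc T f n s \<le> ennreal e"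
      
      unfolding path_osc_def g_def[symmetric, THEN fun_cong]
    proof (rule SUP_least, rule ennreal_leI)
      fix q assume "q \<in> {0..1 / real (Suc n)} \<inter> \<rat>"
      then show "\<bar>g (s + q) - g s\<bar> \<le> e"
        using b(2)[of "s + q"] n e by (cases "q = 0") auto
    qed
    then show ?thesis ..
  qed
  note small = this
  show ?thesis
  proof (rule order_tendstoI)
    fix a :: ennreal assume "0 < a"
    then have "\<exists>e>0. ennreal e < a"
    proof (cases a)
      case (real r)
      with \<open>0 < a\<close> show ?thesis by (intro exI[of _ "r / 2"]) (auto intro!: ennreal_lessI)
    qed (auto intro!: exI[of _ 1])
    then obtain e where e: "0 < e" "ennreal e < a" by blast
    obtain n where "path_osc T f n s \<le> ennreal e" using small[OF e(1)] ..
    then have "\<And>m. n \<le> m \<Longrightarrow> path_osc T f m s < a"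
      using path_osc_antimono[of n] e(2) by (blast intro: order_le_less_trans)
    then show "\<forall>\<^sub>F n in sequentially. path_osc T f n s < a" by (auto simp: eventually_sequentially)
  qed simp
qed

lemma path_osc_joint_measurable:
  fixes X :: "real \<Rightarrow> 'a \<Rightarrow> real"
  assumes X: "(\<lambda>(s, \<omega>). X (max 0 (min s T)) \<omega>) \<in> borel_measurable (borel \<Otimes>\<^sub>M N)"
  shows "(\<lambda>(s, \<omega>). path_osc T (\<lambda>t. X t \<omega>) n s) \<in> borel_measurable (borel \<Otimes>\<^sub>M N)"
proof -
  have 1: "(\<lambda>p. X (max 0 (min (fst p + q) T)) (snd p)) \<in> borel_measurable (borel \<Otimes>\<^sub>M N)" for q
  proof -
    have "(\<lambda>p. (fst p + q, snd p)) \<in> borel \<Otimes>\<^sub>M N \<rightarrow>\<^sub>M borel \<Otimes>\<^sub>M N" by measurable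
    from measurable_compose[OF this X] show ?thesis by simp
  qed
  have [measurable]: "(\<lambda>p. X (max 0 (min (fst p) T)) (snd p)) \<in> borel_measurable (borel \<Otimes>\<^sub>M N)"
    using 1[of 0] by simp
  show ?thesis unfolding path_osc_def case_prod_beta
  proof (rule borel_measurable_SUP)
    show "countable ({0..1 / real (Suc n)} \<inter> \<rat>)"
      by (rule countable_subset[OF _ countable_rat]) auto
  qed (use 1 in measurable)
qed

lemma path_osc_measurable:
  assumes "cadlag_on T f" "0 \<le> T"
  shows "path_osc T f n \<in> borel_measurable borel"
proof -
  have [measurable]: "(\<lambda>s. f (max 0 (min s T))) \<in> borel_measurable borel"
    using cadlag_on_clamp_measurable[OF assms(1), of T] assms(2) by auto
  have "(\<lambda>s. f (max 0 (min (s + q) T))) \<in> borel_measurable borel" for q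
    by (rule measurable_compose[where g = "\<lambda>s. f (max 0 (min s T))"]) measurable
  note [measurable] = this
  have "(\<lambda>s. path_osc T f n s) \<in> borel_measurable borel" unfolding path_osc_def
  proof (rule borel_measurable_SUP)
    show "countable ({0..1 / real (Suc n)} \<inter> \<rat>)"
      by (rule countable_subset[OF _ countable_rat]) auto
  qed measurable
  then show ?thesis .
qed

text \<open>The convergence is not uniform in \<open>s\<close>: shortly before a jump the
  oscillation stays large. The time integral still tends to 0 by dominated convergence, with twice a
  bound of the path as majorant.\<close>

lemma nn_integral_path_osc_tendsto:
  assumes f: "cadlag_on T f" and T: "0 \<le> T"
  shows "(\<lambda>n. \<integral>\<^sup>+ s\<in>{0..T}. path_osc T f n s \<partial>lborel) \<longlonglongrightarrow> 0"
proof -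
  obtain K where K: "0 \<le> K" "\<And>t. t \<in> {0..T} \<Longrightarrow> \<bar>f t\<bar> \<le> K" using cadlag_on_bounded[OF f T] by blast
  have [measurable]: "path_osc T f n \<in> borel_measurable borel" for n by (rule path_osc_measurable[OF f T])
  have "(\<lambda>n. \<integral>\<^sup>+ s. path_osc T f n s * indicator {0..T} s \<partial>lborel) \<longlonglongrightarrow> (\<integral>\<^sup>+ (s::real). 0 \<partial>lborel)"
  proof (rule nn_integral_dominated_convergence[where w = "\<lambda>s. ennreal (2 * K) * indicator {0..T} s"])
    show "AE s in lborel. path_osc T f n s * indicator {0..T} s \<le> ennreal (2 * K) * indicator {0..T} s" for n
      using path_osc_bounded[OF K(2) T, of _ n] by (auto intro!: AE_I2 mult_right_mono)
    show "AE s in lborel. (\<lambda>n. path_osc T f n s * indicator {0..T} s) \<longlonglongrightarrow> 0"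
      using path_osc_tendsto[OF f T] by (auto simp: indicator_def intro!: AE_I2)
    show "(\<integral>\<^sup>+ s. ennreal (2 * K) * indicator {0..T} s \<partial>lborel) < \<infinity>"
      using T by (simp add: nn_integral_cmult ennreal_mult_less_top)
  qed auto
  then show ?thesis by simp
qed

text \<open>
  Summation by parts: on each subinterval [a, b] of the partition the error is the integral of
  \<open>lam' s * (f s - f b)\<close>.
\<close>

lemma riemann_sum_error:
  assumes f: "cadlag_on T f" and lam': "cadlag_on T lam'"
    and K: "\<And>t. t \<in> {0..T} \<Longrightarrow> \<bar>lam' t\<bar> \<le> K"
    and lam: "\<And>t. t \<in> {0..T} \<Longrightarrow> lam t = lam 0 + (LBINT s:{0..t}. lam' s)"
    and p: "is_partition T k p" "\<And>i. i < k \<Longrightarrow> p (Suc i) - p i < 1 / real (Suc n)"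
    and t: "t \<in> {0..T}"
  shows "ennreal \<bar>lam 0 * f 0 + (\<Sum>i<k. lam (p i) * (f (min (p (Suc i)) t) - f (min (p i) t)))
      - (lam t * f t - (LBINT s:{0..t}. lam' s * f s))\<bar>
    \<le> ennreal K * (\<integral>\<^sup>+ s\<in>{0..T}. path_osc T f n s \<partial>lborel)"
proof -
  have T: "0 \<le> T" using t by auto
  have K0: "0 \<le> K" using K[OF t] by linarith
  note [measurable] = path_osc_measurable[OF f T]
  have p0: "p 0 = 0" "p k = T" and pS: "\<And>i. i < k \<Longrightarrow> p i < p (Suc i)"
    using p(1) by (auto simp: is_partition_def)
  have p_pos: "i \<le> k \<Longrightarrow> 0 \<le> p i" for i
  proof (induction i)
    case (Suc i)
    then show ?case using pS[of i] by auto
  qed (simp add: p0)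
  have lf: "cadlag_on T (\<lambda>s. lam' s * f s)" by (rule cadlag_on_mult[OF lam' f])
  define \<Phi> where "\<Phi> t = lam t * f t - (LBINT s:{0..t}. lam' s * f s)" for t
  define A where "A i = min (p i) t" for i
  \<comment> \<open>\<open>err j\<close> is the error accumulated up to the \<open>j\<close>-th
    partition point stopped at \<open>t\<close>; the \<open>\<Phi>\<close> terms telescope, so each
    interval can be treated separately.\<close>
  define err where "err j = (\<Sum>i<j. lam (p i) * (f (A (Suc i)) - f (A i))) - (\<Phi> (A j) - \<Phi> 0)" for j
  have "ennreal \<bar>err j\<bar> \<le> ennreal K * (\<integral>\<^sup>+ s\<in>{0..A j}. path_osc T f n s \<partial>lborel)" if "j \<le> k" for j
    using that
  proof (induction j)
    case 0
    then show ?case using p0 t by (simp add: err_def A_def)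
  next
    case (Suc j)
    define a b where "a = A j" and "b = A (Suc j)"
    have ab: "0 \<le> a" "a \<le> b" "b \<le> T" "b - a < 1 / real (Suc n)"
      using p_pos[of j] pS[of j] p(2)[of j] t Suc.prems by (auto simp: a_def b_def A_def min_def)
    define D where "D = lam (p j) * (f b - f a) - (\<Phi> b - \<Phi> a)"
    have err: "err (Suc j) = err j + D" by (simp add: err_def D_def a_def b_def)
    \<comment> \<open>If \<open>t\<close> is at most \<open>p j\<close>, then
      \<open>a = b = t\<close> and both sides are 0; otherwise \<open>a = p j\<close>.\<close>
    have "lam (p j) * (f b - f a) = lam a * (f b - f a)"
      using pS[of j] Suc.prems by (auto simp: a_def b_def A_def min_def)
    then have "D = (lam a - lam b) * f b + ((LBINT s:{0..b}. lam' s * f s) - (LBINT s:{0..a}. lam' s * f s))"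
      by (simp add: D_def \<Phi>_def algebra_simps)
    also have "(LBINT s:{0..b}. lam' s * f s) - (LBINT s:{0..a}. lam' s * f s) = (LBINT s:{a..b}. lam' s * f s)"
      using set_integral_split[OF cadlag_on_set_integrable[OF lf T], of 0 b a] ab by simp
    also have "lam a - lam b = - (LBINT s:{a..b}. lam' s)"
      using set_integral_split[OF cadlag_on_set_integrable[OF lam' T], of 0 b a] lam[of a] lam[of b] ab by simp
    also have "- (LBINT s:{a..b}. lam' s) * f b + (LBINT s:{a..b}. lam' s * f s)
        = (LBINT s:{a..b}. lam' s * f s) - (LBINT s:{a..b}. lam' s * f b)" by simp
    also have "\<dots> = (LBINT s:{a..b}. lam' s * f s - lam' s * f b)"
      using ab by (intro set_integral_diff(2)[symmetric] set_integrable_mult_left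
          cadlag_on_set_integrable[OF lf T] cadlag_on_set_integrable[OF lam' T])
    finally have D: "D = (LBINT s:{a..b}. lam' s * f s - lam' s * f b)" .
    have "ennreal \<bar>D\<bar> \<le> (\<integral>\<^sup>+ s. ennreal (norm (indicator {a..b} s *\<^sub>R (lam' s * f s - lam' s * f b))) \<partial>lborel)"
      unfolding D set_lebesgue_integral_def real_norm_def[symmetric]
    proof (rule integral_norm_bound_ennreal)
      show "integrable lborel (\<lambda>s. indicator {a..b} s *\<^sub>R (lam' s * f s - lam' s * f b))"
        unfolding set_integrable_def[symmetric] using ab
        by (intro set_integral_diff(1) set_integrable_mult_left
            cadlag_on_set_integrable[OF lf T] cadlag_on_set_integrable[OF lam' T])
    qed
    \<comment> \<open>Passing to the half-open interval costs only a null set and makes consecutive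
      pieces disjoint for the summation.\<close>
    also have "\<dots> \<le> (\<integral>\<^sup>+ s. ennreal K * (path_osc T f n s * indicator {a<..b} s) \<partial>lborel)"
    proof (rule nn_integral_mono_AE)
      show "AE s in lborel. ennreal (norm (indicator {a..b} s *\<^sub>R (lam' s * f s - lam' s * f b)))
        \<le> ennreal K * (path_osc T f n s * indicator {a<..b} s)"
        using AE_lborel_singleton[of a]
      proof eventually_elim
        case (elim s)
        show ?case
        proof (cases "s \<in> {a<..b}")
          case True
          have "norm (lam' s * f s - lam' s * f b) = \<bar>lam' s\<bar> * \<bar>f b - f s\<bar>"
            by (simp add: right_diff_distrib[symmetric] abs_mult abs_minus_commute)
          also have "\<dots> \<le> K * \<bar>f b - f s\<bar>" using True ab by (intro mult_right_mono K) auto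
          finally have "ennreal (norm (lam' s * f s - lam' s * f b)) \<le> ennreal K * ennreal \<bar>f b - f s\<bar>"
            using K0 by (simp add: ennreal_mult[symmetric])
          also have "\<dots> \<le> ennreal K * path_osc T f n s"
            using True ab by (intro mult_left_mono path_osc_ge[OF f]) auto
          finally show ?thesis using True by simp
        qed (use elim in \<open>auto simp: indicator_def\<close>)
      qed
    qed
    also have "\<dots> = ennreal K * (\<integral>\<^sup>+ s\<in>{a<..b}. path_osc T f n s \<partial>lborel)"
      by (intro nn_integral_cmult) measurable
    finally have "ennreal \<bar>D\<bar> \<le> \<dots>" .
    moreover have "ennreal \<bar>err (Suc j)\<bar> \<le> ennreal \<bar>err j\<bar> + ennreal \<bar>D\<bar>"
      unfolding err by (simp add: ennreal_plus[symmetric] del: ennreal_plus)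
    ultimately have "ennreal \<bar>err (Suc j)\<bar> \<le> ennreal K *
        ((\<integral>\<^sup>+ s\<in>{0..a}. path_osc T f n s \<partial>lborel) + (\<integral>\<^sup>+ s\<in>{a<..b}. path_osc T f n s \<partial>lborel))"
      using Suc by (auto simp: distrib_left a_def[symmetric] intro: order_trans add_mono)
    also have "(\<integral>\<^sup>+ s\<in>{0..a}. path_osc T f n s \<partial>lborel) + (\<integral>\<^sup>+ s\<in>{a<..b}. path_osc T f n s \<partial>lborel)
        = (\<integral>\<^sup>+ s\<in>{0..a} \<union> {a<..b}. path_osc T f n s \<partial>lborel)"
      by (intro nn_integral_disjoint_pair[symmetric]) auto
    also have "{0..a} \<union> {a<..b} = {0..b}" using ab by auto
    finally show ?case by (simp add: b_def)
  qed
  from this[of k] have "ennreal \<bar>err k\<bar> \<le> ennreal K * (\<integral>\<^sup>+ s\<in>{0..t}. path_osc T f n s \<partial>lborel)"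
    using p0 t by (simp add: A_def min_absorb2)
  also have "\<dots> \<le> ennreal K * (\<integral>\<^sup>+ s\<in>{0..T}. path_osc T f n s \<partial>lborel)"
    using t by (intro mult_left_mono nn_integral_mono mult_left_mono) (auto simp: indicator_def)
  finally have "ennreal \<bar>err k\<bar> \<le> \<dots>" .
  moreover have "\<Phi> 0 = lam 0 * f 0" by (simp add: \<Phi>_def LBINT_singleton)
  then have "err k = lam 0 * f 0 + (\<Sum>i<k. lam (p i) * (f (min (p (Suc i)) t) - f (min (p i) t))) - \<Phi> t"
    using p0 t by (simp add: err_def A_def min_absorb2)
  ultimately show ?thesis unfolding \<Phi>_def by simp
qed

section \<open>Adapted cadlag processes, and existence and uniqueness of the stochastic
  integral\<close>

context usual_filtered_prob_space
begin

lemma space_F: "t \<in> {0..T} \<Longrightarrow> space (F t) = space M"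
  using subalgebra_F by (auto simp: subalgebra_def)

lemma sets_F: "t \<in> {0..T} \<Longrightarrow> A \<in> sets (F t) \<Longrightarrow> A \<in> sets M"
  using subalgebra_F by (auto simp: subalgebra_def)

lemma measurable_F_mono:
  assumes "f \<in> borel_measurable (F s)" "0 \<le> s" "s \<le> t" "t \<le> T"
  shows "f \<in> borel_measurable (F t)"
proof (rule measurable_from_subalg[OF _ assms(1)])
  show "subalgebra (F t) (F s)"
    using F_mono[of s t] space_F[of s] space_F[of t] assms by (auto simp: subalgebra_def)
qed

lemma adaptedD: "adapted F T X \<Longrightarrow> t \<in> {0..T} \<Longrightarrow> X t \<in> borel_measurable (F t)"
  by (auto simp: adapted_def)

lemma adapted_measurable: "adapted F T X \<Longrightarrow> t \<in> {0..T} \<Longrightarrow> X t \<in> borel_measurable M"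
  unfolding adapted_def using measurable_from_subalg[OF subalgebra_F] by blast

lemma cadlag_processD: "cadlag_process M T X \<Longrightarrow> \<omega> \<in> space M \<Longrightarrow> cadlag_on T (\<lambda>t. X t \<omega>)"
  by (auto simp: cadlag_process_def)

text \<open>This is progressive measurability: a process frozen at \<open>u\<close> takes only
  values known at \<open>u\<close>.\<close>

lemma adapted_joint_measurable:
  assumes X: "adapted F T X" "cadlag_process M T X" and u: "u \<in> {0..T}"
  shows "(\<lambda>(s, \<omega>). X (max 0 (min s u)) \<omega>) \<in> borel_measurable (borel \<Otimes>\<^sub>M F u)"
proof (rule right_continuous_joint_measurable)
  show "X (max 0 (min t u)) \<in> borel_measurable (F u)" for t
    by (rule measurable_F_mono[OF adaptedD[OF X(1)]]) (use u in auto)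
  show "continuous (at_right t) (\<lambda>s. X (max 0 (min s u)) \<omega>)" if "\<omega> \<in> space (F u)" for \<omega> t
    using cadlag_on_clamp[OF cadlag_processD[OF X(2), of \<omega>] u] that space_F[OF u] by simp
qed

lemma joint_measurable:
  assumes X: "\<And>t. t \<in> {0..T} \<Longrightarrow> X t \<in> borel_measurable M" "cadlag_process M T X"
  shows "(\<lambda>(s, \<omega>). X (max 0 (min s T)) \<omega>) \<in> borel_measurable (borel \<Otimes>\<^sub>M M)"
proof (rule right_continuous_joint_measurable)
  show "X (max 0 (min t T)) \<in> borel_measurable M" for t
    by (rule X(1)) (use T_pos in auto)
  show "continuous (at_right t) (\<lambda>s. X (max 0 (min s T)) \<omega>)" if "\<omega> \<in> space M" for \<omega> t
    using cadlag_on_clamp[OF cadlag_processD[OF X(2) that], of T t] T_pos by simp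
qed

lemma adapted_cadlag_integral:
  assumes X: "adapted F T X" "cadlag_process M T X"
  shows "adapted F T (\<lambda>t \<omega>. LBINT s:{0..t}. X s \<omega>)" "cadlag_process M T (\<lambda>t \<omega>. LBINT s:{0..t}. X s \<omega>)"
proof -
  show "adapted F T (\<lambda>t \<omega>. LBINT s:{0..t}. X s \<omega>)" unfolding adapted_def
  proof
    fix t assume t: "t \<in> {0..T}"
    have "(\<lambda>(\<omega>, s). (s, \<omega>)) \<in> F t \<Otimes>\<^sub>M borel \<rightarrow>\<^sub>M borel \<Otimes>\<^sub>M F t" by measurable
    from measurable_compose[OF this adapted_joint_measurable[OF X t]]
    have [measurable]: "(\<lambda>p. X (max 0 (min (snd p) t)) (fst p)) \<in> borel_measurable (F t \<Otimes>\<^sub>M borel)"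
      by (simp add: case_prod_beta)
    have "(\<lambda>\<omega>. \<integral>s. indicator {0..t} s *\<^sub>R X (max 0 (min s t)) \<omega> \<partial>lborel) \<in> borel_measurable (F t)"
      by (rule lborel.borel_measurable_lebesgue_integral) (simp add: case_prod_beta, measurable)
    also have "(\<lambda>\<omega>. \<integral>s. indicator {0..t} s *\<^sub>R X (max 0 (min s t)) \<omega> \<partial>lborel) = (\<lambda>\<omega>. LBINT s:{0..t}. X s \<omega>)"
      unfolding set_lebesgue_integral_def
      by (intro ext Bochner_Integration.integral_cong) (auto simp: indicator_def)
    finally show "(\<lambda>\<omega>. LBINT s:{0..t}. X s \<omega>) \<in> borel_measurable (F t)" .
  qed
  show "cadlag_process M T (\<lambda>t \<omega>. LBINT s:{0..t}. X s \<omega>)"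
    unfolding cadlag_process_def
    by (intro ballI cadlag_on_continuous cadlag_integral_continuous cadlag_processD[OF X(2)])
qed

lemma exceedance_measurable:
  assumes X: "\<And>t. t \<in> {0..T} \<Longrightarrow> X t \<in> borel_measurable M" "cadlag_process M T X"
  shows "{\<omega> \<in> space M. \<exists>t\<in>{0..T}. e < \<bar>X t \<omega>\<bar>} \<in> sets M"
proof -
  note sub = dense_times_subset[OF less_imp_le[OF T_pos]]
  have "\<exists>s\<in>dense_times T. e < \<bar>X s \<omega>\<bar>" if "\<omega> \<in> space M" "t \<in> {0..T}" "e < \<bar>X t \<omega>\<bar>" for \<omega> t
    using cadlag_on_dense_times[OF cadlag_processD[OF X(2) that(1)], of "{x. e < \<bar>x\<bar>}" t] that
    by (auto simp: open_Collect_less continuous_intros)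
  then have "{\<omega> \<in> space M. \<exists>t\<in>{0..T}. e < \<bar>X t \<omega>\<bar>} = (\<Union>s\<in>dense_times T. {\<omega> \<in> space M. e < \<bar>X s \<omega>\<bar>})"
    using sub by blast
  also have "\<dots> \<in> sets M"
  proof (intro sets.countable_UN'' countable_dense_times)
    fix s assume "s \<in> dense_times T"
    then have [measurable]: "X s \<in> borel_measurable M" using X(1) sub by auto
    show "{\<omega> \<in> space M. e < \<bar>X s \<omega>\<bar>} \<in> sets M" by measurable
  qed
  finally show ?thesis .
qed

text \<open>In every scenario the integrated oscillation decreases to 0 in \<open>n\<close>, so the
  events that its multiple by \<open>K\<close> is at least \<open>e\<close> decrease to the empty
  set and their probabilities tend to 0.\<close>

lemma path_osc_integral_small:
  assumes X: "\<And>t. t \<in> {0..T} \<Longrightarrow> X t \<in> borel_measurable M" "cadlag_process M T X" and e: "0 < e" "0 < \<delta>"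
  shows "\<exists>n. measure M {\<omega> \<in> space M.
      ennreal e \<le> ennreal K * (\<integral>\<^sup>+ s\<in>{0..T}. path_osc T (\<lambda>t. X t \<omega>) n s \<partial>lborel)} < \<delta>"
    and "{\<omega> \<in> space M. ennreal e \<le> ennreal K * (\<integral>\<^sup>+ s\<in>{0..T}. path_osc T (\<lambda>t. X t \<omega>) n s \<partial>lborel)} \<in> sets M"
proof -
  define W where "W n \<omega> = ennreal K * (\<integral>\<^sup>+ s\<in>{0..T}. path_osc T (\<lambda>t. X t \<omega>) n s \<partial>lborel)" for n \<omega>
  have [measurable]: "W n \<in> borel_measurable M" for n
  proof -
    have "(\<lambda>(\<omega>, s). (s, \<omega>)) \<in> M \<Otimes>\<^sub>M borel \<rightarrow>\<^sub>M borel \<Otimes>\<^sub>M M" by measurable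
    from measurable_compose[OF this path_osc_joint_measurable[OF joint_measurable[OF X]]]
    have [measurable]: "(\<lambda>p. path_osc T (\<lambda>t. X t (fst p)) n (snd p)) \<in> borel_measurable (M \<Otimes>\<^sub>M borel)"
      by (simp add: case_prod_beta)
    have "(\<lambda>\<omega>. \<integral>\<^sup>+ s. path_osc T (\<lambda>t. X t \<omega>) n s * indicator {0..T} s \<partial>lborel) \<in> borel_measurable M"
      by (rule lborel.borel_measurable_nn_integral) (simp add: case_prod_beta, measurable)
    then show ?thesis unfolding W_def by measurable
  qed
  have W_lim: "(\<lambda>n. W n \<omega>) \<longlonglongrightarrow> 0" if "\<omega> \<in> space M" for \<omega>
    using ennreal_tendsto_cmult[OF _ nn_integral_path_osc_tendsto[OF cadlag_processD[OF X(2) that]], of "ennreal K"]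
      T_pos by (simp add: W_def)
  define A where "A n = {\<omega> \<in> space M. ennreal e \<le> W n \<omega>}" for n
  have A: "A n \<in> sets M" for n unfolding A_def by measurable
  then show "{\<omega> \<in> space M. ennreal e \<le> ennreal K * (\<integral>\<^sup>+ s\<in>{0..T}. path_osc T (\<lambda>t. X t \<omega>) n s \<partial>lborel)} \<in> sets M"
    by (simp add: A_def W_def)
  have "W m \<omega> \<le> W n \<omega>" if "n \<le> m" for n m \<omega>
    unfolding W_def by (intro mult_left_mono nn_integral_mono mult_right_mono path_osc_antimono that) auto
  then have "decseq A" by (fastforce simp: decseq_def A_def intro: order_trans)
  then have "(\<lambda>n. measure M (A n)) \<longlonglongrightarrow> measure M (\<Inter>n. A n)"
    using A by (intro finite_Lim_measure_decseq) auto
  moreover have "(\<Inter>n. A n) = {}"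
  proof -
    have "\<exists>n. \<omega> \<notin> A n" if "\<omega> \<in> space M" for \<omega>
    proof -
      have "\<forall>\<^sub>F n in sequentially. W n \<omega> < ennreal e"
        using order_tendstoD(2)[OF W_lim[OF that], of "ennreal e"] e by simp
      then show ?thesis by (auto simp: A_def eventually_sequentially not_le)
    qed
    then show ?thesis by (auto simp: A_def)
  qed
  ultimately have "(\<lambda>n. measure M (A n)) \<longlonglongrightarrow> 0" by simp
  then have "\<forall>\<^sub>F n in sequentially. measure M (A n) < \<delta>" using e(2) by (rule order_tendstoD(2))
  then show "\<exists>n. measure M {\<omega> \<in> space M.
      ennreal e \<le> ennreal K * (\<integral>\<^sup>+ s\<in>{0..T}. path_osc T (\<lambda>t. X t \<omega>) n s \<partial>lborel)} < \<delta>"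
    by (auto simp: eventually_sequentially A_def W_def)
qed

text \<open>The error bound of \<open>riemann_sum_error\<close> depends neither on \<open>t\<close>
  nor on the partition beyond its mesh. One event of small probability therefore contains all bad
  scenarios, which gives convergence uniformly in time and in probability.\<close>

lemma stoch_integral_by_parts:
  assumes X: "adapted F T X" "cadlag_process M T X" and lam': "cadlag_on T lam'"
    and lam: "\<And>t. t \<in> {0..T} \<Longrightarrow> lam t = lam 0 + (LBINT s:{0..t}. lam' s)"
  shows "is_stoch_integral M F T lam X (\<lambda>t \<omega>. lam t * X t \<omega> - (LBINT s:{0..t}. lam' s * X s \<omega>))"
proof -
  have lamc: "continuous_on {0..T} lam"
    using continuous_on_add[OF continuous_on_const cadlag_integral_continuous[OF lam'], of "lam 0"]
    by (rule continuous_on_eq) (rule lam[symmetric])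
  have lX: "adapted F T (\<lambda>t \<omega>. lam' t * X t \<omega>)" "cadlag_process M T (\<lambda>t \<omega>. lam' t * X t \<omega>)"
    using X lam' unfolding adapted_def cadlag_process_def
    by (intro ballI borel_measurable_times borel_measurable_const cadlag_on_mult; simp)+
  note I = adapted_cadlag_integral[OF lX]
  obtain K where K: "0 \<le> K" "\<And>t. t \<in> {0..T} \<Longrightarrow> \<bar>lam' t\<bar> \<le> K"
    using cadlag_on_bounded[OF lam' less_imp_le[OF T_pos]] by blast
  note Xm = adapted_measurable[OF X(1)]
  show ?thesis unfolding is_stoch_integral_def
  proof (intro conjI allI impI)
    show "adapted F T (\<lambda>t \<omega>. lam t * X t \<omega> - (LBINT s:{0..t}. lam' s * X s \<omega>))"
      unfolding adapted_def
      by (intro ballI borel_measurable_diff borel_measurable_times borel_measurable_const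
          adaptedD[OF X(1)] adaptedD[OF I(1)])
    show "cadlag_process M T (\<lambda>t \<omega>. lam t * X t \<omega> - (LBINT s:{0..t}. lam' s * X s \<omega>))"
      unfolding cadlag_process_def
      by (intro ballI cadlag_on_diff cadlag_on_mult cadlag_on_continuous[OF lamc]
          cadlag_processD[OF X(2)] cadlag_processD[OF I(2)])
    fix e :: real assume e: "0 < e"
    let ?A = "\<lambda>n. {\<omega> \<in> space M. ennreal e \<le> ennreal K * (\<integral>\<^sup>+ s\<in>{0..T}. path_osc T (\<lambda>t. X t \<omega>) n s \<partial>lborel)}"
    obtain n where n: "measure M (?A n) < e"
      using path_osc_integral_small(1)[OF Xm X(2) e e] by blast
    show "\<exists>d>0. \<forall>k p. is_partition T k p \<and> (\<forall>i<k. p (Suc i) - p i < d) \<longrightarrow>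
        measure M {\<omega> \<in> space M. \<exists>t\<in>{0..T}. e < \<bar>lam 0 * X 0 \<omega> +
          (\<Sum>i<k. lam (p i) * (X (min (p (Suc i)) t) \<omega> - X (min (p i) t) \<omega>)) -
          (lam t * X t \<omega> - (LBINT s:{0..t}. lam' s * X s \<omega>))\<bar>} < e"
    proof (intro exI[of _ "1 / real (Suc n)"] conjI allI impI)
      fix k :: nat and p assume p: "is_partition T k p \<and> (\<forall>i<k. p (Suc i) - p i < 1 / real (Suc n))"
      have "{\<omega> \<in> space M. \<exists>t\<in>{0..T}. e < \<bar>lam 0 * X 0 \<omega> +
          (\<Sum>i<k. lam (p i) * (X (min (p (Suc i)) t) \<omega> - X (min (p i) t) \<omega>)) -
          (lam t * X t \<omega> - (LBINT s:{0..t}. lam' s * X s \<omega>))\<bar>} \<subseteq> ?A n"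
      proof safe
        fix \<omega> t assume \<omega>: "\<omega> \<in> space M" and t: "t \<in> {0..T}" and lt: "e < \<bar>lam 0 * X 0 \<omega> +
          (\<Sum>i<k. lam (p i) * (X (min (p (Suc i)) t) \<omega> - X (min (p i) t) \<omega>)) -
          (lam t * X t \<omega> - (LBINT s:{0..t}. lam' s * X s \<omega>))\<bar>"
        have "ennreal e \<le> ennreal \<bar>lam 0 * X 0 \<omega> +
          (\<Sum>i<k. lam (p i) * (X (min (p (Suc i)) t) \<omega> - X (min (p i) t) \<omega>)) -
          (lam t * X t \<omega> - (LBINT s:{0..t}. lam' s * X s \<omega>))\<bar>"
          using lt by (intro ennreal_leI) simp
        also have "\<dots> \<le> ennreal K * (\<integral>\<^sup>+ s\<in>{0..T}. path_osc T (\<lambda>t. X t \<omega>) n s \<partial>lborel)"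
          by (rule riemann_sum_error[OF cadlag_processD[OF X(2) \<omega>] lam' K(2) lam _ _ t])
             (use p in auto)
        finally show "ennreal e \<le> ennreal K * (\<integral>\<^sup>+ s\<in>{0..T}. path_osc T (\<lambda>t. X t \<omega>) n s \<partial>lborel)" .
      qed
      then have "measure M {\<omega> \<in> space M. \<exists>t\<in>{0..T}. e < \<bar>lam 0 * X 0 \<omega> +
          (\<Sum>i<k. lam (p i) * (X (min (p (Suc i)) t) \<omega> - X (min (p i) t) \<omega>)) -
          (lam t * X t \<omega> - (LBINT s:{0..t}. lam' s * X s \<omega>))\<bar>} \<le> measure M (?A n)"
        by (rule finite_measure_mono) (rule path_osc_integral_small(2)[OF Xm X(2) e e])
      then show "measure M {\<omega> \<in> space M. \<exists>t\<in>{0..T}. e < \<bar>lam 0 * X 0 \<omega> +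
          (\<Sum>i<k. lam (p i) * (X (min (p (Suc i)) t) \<omega> - X (min (p i) t) \<omega>)) -
          (lam t * X t \<omega> - (LBINT s:{0..t}. lam' s * X s \<omega>))\<bar>} < e"
        using n by simp
    qed simp
  qed
qed

text \<open>Both integrals are approximated by the Riemann sums of one fine partition, so their
  distance exceeds \<open>2 * e\<close> only where one of the two errors exceeds
  \<open>e\<close>.\<close>

lemma stoch_integral_unique:
  assumes X: "adapted F T X" "cadlag_process M T X"
    and I: "is_stoch_integral M F T H X I" and J: "is_stoch_integral M F T H X J"
  shows "AE \<omega> in M. \<forall>t\<in>{0..T}. I t \<omega> = J t \<omega>"
proof -
  have Ia: "adapted F T I" "cadlag_process M T I" and Ja: "adapted F T J" "cadlag_process M T J"
    using I J by (auto simp: is_stoch_integral_def)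
  define N where "N e = {\<omega> \<in> space M. \<exists>t\<in>{0..T}. e < \<bar>I t \<omega> - J t \<omega>\<bar>}" for e
  have D: "cadlag_process M T (\<lambda>t \<omega>. I t \<omega> - J t \<omega>)"
    using Ia Ja by (auto simp: cadlag_process_def intro: cadlag_on_diff)
  have Nm: "N e \<in> sets M" for e unfolding N_def
    by (rule exceedance_measurable[OF _ D])
       (intro borel_measurable_diff adapted_measurable[OF Ia(1)] adapted_measurable[OF Ja(1)])
  have N_small: "measure M (N (2 * e)) \<le> 2 * e" if e: "0 < e" for e
  proof -
    obtain d1 where d1: "0 < d1" "\<And>k p. is_partition T k p \<Longrightarrow> (\<forall>i<k. p (Suc i) - p i < d1) \<Longrightarrow>
        measure M {\<omega>\<in>space M. \<exists>t\<in>{0..T}.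
          e < \<bar>H 0 * X 0 \<omega> + (\<Sum>i<k. H (p i) * (X (min (p (Suc i)) t) \<omega> - X (min (p i) t) \<omega>)) - I t \<omega>\<bar>} < e"
      using I e unfolding is_stoch_integral_def by meson
    obtain d2 where d2: "0 < d2" "\<And>k p. is_partition T k p \<Longrightarrow> (\<forall>i<k. p (Suc i) - p i < d2) \<Longrightarrow>
        measure M {\<omega>\<in>space M. \<exists>t\<in>{0..T}.
          e < \<bar>H 0 * X 0 \<omega> + (\<Sum>i<k. H (p i) * (X (min (p (Suc i)) t) \<omega> - X (min (p i) t) \<omega>)) - J t \<omega>\<bar>} < e"
      using J e unfolding is_stoch_integral_def by meson
    obtain k :: nat where k: "T / min d1 d2 < k" using reals_Archimedean2 by blast
    have k0: "0 < k" using k T_pos d1(1) d2(1)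
      by (metis divide_pos_pos less_trans min_less_iff_conj of_nat_0_less_iff)
    define p where "p i = T * real i / real k" for i
    have p: "is_partition T k p" using k0 T_pos by (auto simp: is_partition_def p_def divide_simps)
    have mesh: "p (Suc i) - p i < min d1 d2" for i
    proof -
      have "p (Suc i) - p i = T / k" by (simp add: p_def diff_divide_distrib[symmetric] algebra_simps)
      moreover have "0 < min d1 d2" using d1(1) d2(1) by simp
      ultimately show ?thesis
        using k k0 by (simp only: pos_divide_less_eq of_nat_0_less_iff mult.commute)
    qed
    define R where "R t \<omega> = H 0 * X 0 \<omega> + (\<Sum>i<k. H (p i) * (X (min (p (Suc i)) t) \<omega> - X (min (p i) t) \<omega>))" for t \<omega>
    have p_in: "p i \<in> {0..T}" if "i \<le> k" for i
      using that k0 T_pos by (auto simp: p_def divide_simps)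
    have R: "R t \<in> borel_measurable M" if t: "t \<in> {0..T}" for t
      unfolding R_def using t T_pos p_in
      by (intro borel_measurable_add borel_measurable_times borel_measurable_const borel_measurable_sum
          borel_measurable_diff adapted_measurable[OF X(1)]) (auto simp: min_def)
    have Rc: "cadlag_process M T R" unfolding R_def cadlag_process_def
      by (intro ballI cadlag_on_add cadlag_on_const cadlag_on_sum cadlag_on_cmult cadlag_on_diff
          cadlag_on_stopped cadlag_processD[OF X(2)] p_in) auto
    \<comment> \<open>\<open>measure\<close> assigns 0 to non-measurable sets, so the smallness in
      the definition becomes informative only once these events are known to be measurable.\<close>
    have S: "{\<omega> \<in> space M. \<exists>t\<in>{0..T}. e < \<bar>R t \<omega> - Z t \<omega>\<bar>} \<in> sets M"
      if "adapted F T Z" "cadlag_process M T Z" for Z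
    proof (rule exceedance_measurable)
      show "(\<lambda>\<omega>. R t \<omega> - Z t \<omega>) \<in> borel_measurable M" if "t \<in> {0..T}" for t
        using R that adapted_measurable[OF \<open>adapted F T Z\<close>] by (intro borel_measurable_diff)
      show "cadlag_process M T (\<lambda>t \<omega>. R t \<omega> - Z t \<omega>)"
        using Rc that by (auto simp: cadlag_process_def intro: cadlag_on_diff)
    qed
    let ?S1 = "{\<omega> \<in> space M. \<exists>t\<in>{0..T}. e < \<bar>R t \<omega> - I t \<omega>\<bar>}"
    let ?S2 = "{\<omega> \<in> space M. \<exists>t\<in>{0..T}. e < \<bar>R t \<omega> - J t \<omega>\<bar>}"
    have "N (2 * e) \<subseteq> ?S1 \<union> ?S2"
    proof
      fix \<omega> assume "\<omega> \<in> N (2 * e)"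
      then obtain t where t: "\<omega> \<in> space M" "t \<in> {0..T}" "2 * e < \<bar>I t \<omega> - J t \<omega>\<bar>" by (auto simp: N_def)
      then have "e < \<bar>R t \<omega> - I t \<omega>\<bar> \<or> e < \<bar>R t \<omega> - J t \<omega>\<bar>" by linarith
      then show "\<omega> \<in> ?S1 \<union> ?S2" using t by blast
    qed
    then have "measure M (N (2 * e)) \<le> measure M (?S1 \<union> ?S2)"
      by (rule finite_measure_mono) (intro sets.Un S Ia Ja)
    also have "\<dots> \<le> measure M ?S1 + measure M ?S2"
      by (intro measure_Un_le S Ia Ja)
    also have "\<dots> \<le> e + e"
      using d1(2)[OF p] d2(2)[OF p] mesh unfolding R_def by (intro add_mono less_imp_le) auto
    finally show ?thesis by simp
  qed
  have N0: "measure M (N \<epsilon>) = 0" if \<epsilon>: "0 < \<epsilon>" for \<epsilon>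
  proof -
    have "measure M (N \<epsilon>) \<le> 0 + \<eta>" if \<eta>: "0 < \<eta>" for \<eta>
    proof -
      \<comment> \<open>\<open>2 * e\<close> is at most \<open>\<epsilon>\<close>, which gives the
        inclusion, and at most \<open>\<eta>\<close>, which gives the bound.\<close>
      define e where "e = min \<epsilon> \<eta> / 2"
      have "N \<epsilon> \<subseteq> N (2 * e)" by (auto simp: N_def e_def intro!: bexI order_le_less_trans[OF min.cobounded1])
      then have "measure M (N \<epsilon>) \<le> measure M (N (2 * e))" by (rule finite_measure_mono[OF _ Nm])
      also have "\<dots> \<le> 2 * e" by (rule N_small) (use \<epsilon> \<eta> in \<open>auto simp: e_def\<close>)
      finally show ?thesis by (auto simp: e_def)
    qed
    then have "measure M (N \<epsilon>) \<le> 0" by (rule field_le_epsilon)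
    then show ?thesis by (simp add: measure_le_0_iff)
  qed
  have "AE \<omega> in M. \<forall>n. \<omega> \<notin> N (1 / real (Suc n))"
    unfolding AE_all_countable
    using N0 Nm by (intro allI AE_not_in) (auto simp: null_sets_def emeasure_eq_measure)
  then show ?thesis
  proof (rule AE_mp, intro AE_I2 impI ballI)
    fix \<omega> t assume \<omega>: "\<omega> \<in> space M" "\<forall>n. \<omega> \<notin> N (1 / real (Suc n))" and t: "t \<in> {0..T}"
    have "\<bar>I t \<omega> - J t \<omega>\<bar> \<le> 1 / real (Suc n)" for n using \<omega> t by (auto simp: N_def not_less)
    then have "\<bar>I t \<omega> - J t \<omega>\<bar> \<le> 0"
      by (intro LIMSEQ_le_const[OF LIMSEQ_inverse_real_of_nat]) (auto simp: inverse_eq_divide)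
    then show "I t \<omega> = J t \<omega>" by simp
  qed
qed

end

section \<open>The impact process\<close>

text \<open>The term \<open>lam t * q t\<close> carries the jumps of the impact. The remainder
  solves a linear equation with decay rate \<open>\<beta>\<close> and forcing
  \<open>- (\<beta> * lam + lam') * q\<close>, and the rest of the formula is its solution by an
  integrating factor.\<close>

definition impact_path ::
  "(real \<Rightarrow> real) \<Rightarrow> (real \<Rightarrow> real) \<Rightarrow> (real \<Rightarrow> real) \<Rightarrow> real \<Rightarrow> (real \<Rightarrow> real) \<Rightarrow> real \<Rightarrow> real" where
  "impact_path \<beta> lam lam' y q t = lam t * q t + exp (- (LBINT s:{0..t}. \<beta> s)) *
     (y - (LBINT s:{0..t}. exp (LBINT r:{0..s}. \<beta> r) * ((\<beta> s * lam s + lam' s) * q s)))"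

locale impact_coefficients = usual_filtered_prob_space M F T
  for M :: "'a measure" and F T +
  fixes \<beta> lam lam' :: "real \<Rightarrow> real"
  assumes coefficients: "coefficient_assms T \<beta> lam lam'"
begin

lemma T_nonneg: "0 \<le> T" using T_pos by simp

lemma beta_cadlag: "cadlag_on T \<beta>" and lam'_cadlag: "cadlag_on T lam'"
  and beta_pos: "t \<in> {0..T} \<Longrightarrow> 0 < \<beta> t" and lam_pos: "t \<in> {0..T} \<Longrightarrow> 0 < lam t"
  using coefficients by (auto simp: coefficient_assms_def)

lemma lam_integral:
  assumes t: "t \<in> {0..T}" shows "lam t = lam 0 + (LBINT s:{0..t}. lam' s)"
proof -
  have "(lam' has_integral (lam t - lam 0)) {0..t}"
    using coefficients t by (intro abs_continuous_has_integral) (auto simp: coefficient_assms_def)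
  then have "integral {0..t} lam' = lam t - lam 0" by (rule integral_unique)
  moreover have "(LBINT s:{0..t}. lam' s) = integral {0..t} lam'"
    using t by (intro set_borel_integral_eq_integral(2) cadlag_on_set_integrable[OF lam'_cadlag]) auto
  ultimately show ?thesis by simp
qed

lemma lam_continuous: "continuous_on {0..T} lam"
  using continuous_on_add[OF continuous_on_const cadlag_integral_continuous[OF lam'_cadlag], of "lam 0"]
  by (rule continuous_on_eq) (rule lam_integral[symmetric])

lemma lam_cadlag: "cadlag_on T lam"
  by (rule cadlag_on_continuous[OF lam_continuous])

lemma exp_beta_cadlag: "cadlag_on T (\<lambda>t. exp (LBINT s:{0..t}. \<beta> s))"
  "cadlag_on T (\<lambda>t. exp (- (LBINT s:{0..t}. \<beta> s)))"
  by (intro cadlag_on_continuous continuous_intros cadlag_integral_continuous beta_cadlag)+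

lemma impact_integrand_cadlag:
  "cadlag_on T q \<Longrightarrow> cadlag_on T (\<lambda>s. exp (LBINT r:{0..s}. \<beta> r) * ((\<beta> s * lam s + lam' s) * q s))"
  by (intro cadlag_on_mult cadlag_on_add exp_beta_cadlag beta_cadlag lam_cadlag lam'_cadlag)

lemma impact_path_cadlag:
  assumes q: "cadlag_on T q" shows "cadlag_on T (impact_path \<beta> lam lam' y q)"
  unfolding impact_path_def[abs_def]
  by (intro cadlag_on_add cadlag_on_mult lam_cadlag q exp_beta_cadlag cadlag_on_diff cadlag_on_const
      cadlag_on_continuous[OF cadlag_integral_continuous] impact_integrand_cadlag)

text \<open>The initial value takes part in the linearity: weights with sum 1 keep the start
  \<open>y\<close>, and the weights 1 and -1 turn it into 0.\<close>

lemma impact_path_linear: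
  assumes q: "cadlag_on T q" "cadlag_on T q'" and t: "t \<in> {0..T}"
  shows "impact_path \<beta> lam lam' (a * y + b * y') (\<lambda>s. a * q s + b * q' s) t
    = a * impact_path \<beta> lam lam' y q t + b * impact_path \<beta> lam lam' y' q' t"
proof -
  let ?k = "\<lambda>q s. exp (LBINT r:{0..s}. \<beta> r) * ((\<beta> s * lam s + lam' s) * q s)"
  have i: "set_integrable lborel {0..t} (?k q)" "set_integrable lborel {0..t} (?k q')"
    using t by (intro cadlag_on_set_integrable[OF impact_integrand_cadlag] q; simp)+
  have "(LBINT s:{0..t}. ?k (\<lambda>s. a * q s + b * q' s) s) = (LBINT s:{0..t}. a * ?k q s + b * ?k q' s)"
    by (simp add: algebra_simps)
  also have "\<dots> = a * (LBINT s:{0..t}. ?k q s) + b * (LBINT s:{0..t}. ?k q' s)"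
    using i by (subst set_integral_add(2)) (auto intro: set_integrable_mult_right)
  finally show ?thesis unfolding impact_path_def by (simp add: algebra_simps)
qed

text \<open>Subtracting \<open>lam t * q t\<close> from \<open>u\<close> removes the integrator and
  leaves the linear equation of \<open>variation_of_constants\<close> with forcing
  \<open>h\<close>.\<close>

lemma impact_path_iff:
  assumes q: "cadlag_on T q" and u: "cadlag_on T u"
  shows "(\<forall>t\<in>{0..T}. u t = y - (LBINT s:{0..t}. \<beta> s * u s) + (lam t * q t - (LBINT s:{0..t}. lam' s * q s)))
    \<longleftrightarrow> (\<forall>t\<in>{0..T}. u t = impact_path \<beta> lam lam' y q t)"
proof -
  define v where "v t = u t - lam t * q t" for t
  define h where "h t = (\<beta> t * lam t + lam' t) * q t" for t
  have c: "cadlag_on T v" "cadlag_on T h" "cadlag_on T (\<lambda>s. \<beta> s * u s)" "cadlag_on T (\<lambda>s. lam' s * q s)"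
    unfolding v_def h_def
    by (intro cadlag_on_diff cadlag_on_mult cadlag_on_add u q lam_cadlag beta_cadlag lam'_cadlag)+
  have "(LBINT s:{0..t}. \<beta> s * v s + h s) = (LBINT s:{0..t}. \<beta> s * u s) + (LBINT s:{0..t}. lam' s * q s)"
    if "t \<in> {0..T}" for t
  proof -
    have "(LBINT s:{0..t}. \<beta> s * v s + h s) = (LBINT s:{0..t}. \<beta> s * u s + lam' s * q s)"
      by (simp add: v_def h_def algebra_simps)
    also have "\<dots> = (LBINT s:{0..t}. \<beta> s * u s) + (LBINT s:{0..t}. lam' s * q s)"
      using that 
      by (intro set_integral_add(2) cadlag_on_set_integrable[OF c(3) T_nonneg]
          cadlag_on_set_integrable[OF c(4) T_nonneg]) auto
    finally show ?thesis .
  qed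
  then have "(\<forall>t\<in>{0..T}. u t = y - (LBINT s:{0..t}. \<beta> s * u s) + (lam t * q t - (LBINT s:{0..t}. lam' s * q s)))
      \<longleftrightarrow> (\<forall>t\<in>{0..T}. v t = y - (LBINT s:{0..t}. \<beta> s * v s + h s))"
    by (intro ball_cong) (auto simp: v_def)
  also have "\<dots> \<longleftrightarrow> (\<forall>t\<in>{0..T}. v t = exp (- (LBINT s:{0..t}. \<beta> s)) *
      (y - (LBINT s:{0..t}. exp (LBINT r:{0..s}. \<beta> r) * h s)))"
    by (rule variation_of_constants[OF beta_cadlag c(2,1)])
  also have "\<dots> \<longleftrightarrow> (\<forall>t\<in>{0..T}. u t = impact_path \<beta> lam lam' y q t)"
    by (intro ball_cong) (auto simp: v_def h_def impact_path_def)
  finally show ?thesis .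
qed

lemma impact_path_adapted:
  assumes Q: "adapted F T Q" "cadlag_process M T Q"
  shows "adapted F T (\<lambda>t \<omega>. impact_path \<beta> lam lam' y (\<lambda>s. Q s \<omega>) t)"
    and "cadlag_process M T (\<lambda>t \<omega>. impact_path \<beta> lam lam' y (\<lambda>s. Q s \<omega>) t)"
proof -
  let ?X = "\<lambda>t \<omega>. exp (LBINT r:{0..t}. \<beta> r) * ((\<beta> t * lam t + lam' t) * Q t \<omega>)"
  have "adapted F T ?X" "cadlag_process M T ?X"
    unfolding adapted_def cadlag_process_def
    by (intro ballI borel_measurable_times borel_measurable_const adaptedD[OF Q(1)]
        impact_integrand_cadlag cadlag_processD[OF Q(2)]; assumption)+
  note I = adapted_cadlag_integral[OF this]
  show "adapted F T (\<lambda>t \<omega>. impact_path \<beta> lam lam' y (\<lambda>s. Q s \<omega>) t)"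
    unfolding adapted_def impact_path_def
    by (intro ballI borel_measurable_add borel_measurable_times borel_measurable_diff
        borel_measurable_const adaptedD[OF Q(1)] adaptedD[OF I(1)])
  show "cadlag_process M T (\<lambda>t \<omega>. impact_path \<beta> lam lam' y (\<lambda>s. Q s \<omega>) t)"
    unfolding cadlag_process_def
    by (intro ballI impact_path_cadlag cadlag_processD[OF Q(2)])
qed

text \<open>The explicit formula shows that there is something for \<open>impact\<close> to choose.
  Uniqueness of the stochastic integral, together with uniqueness for the pathwise equation, then
  identifies the choice outside a null set.\<close>

lemma impact_eq_impact_path:
  assumes Q: "adapted F T Q" "cadlag_process M T Q"
  shows "adapted F T (impact M F T \<beta> lam y Q)" "cadlag_process M T (impact M F T \<beta> lam y Q)"
    and "AE \<omega> in M. \<forall>t\<in>{0..T}. impact M F T \<beta> lam y Q t \<omega> = impact_path \<beta> lam lam' y (\<lambda>s. Q s \<omega>) t"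
proof -
  let ?I = "\<lambda>t \<omega>. lam t * Q t \<omega> - (LBINT s:{0..t}. lam' s * Q s \<omega>)"
  have I: "is_stoch_integral M F T lam Q ?I"
    by (rule stoch_integral_by_parts[OF Q lam'_cadlag lam_integral])
  have "is_impact M F T \<beta> lam y Q (\<lambda>t \<omega>. impact_path \<beta> lam lam' y (\<lambda>s. Q s \<omega>) t)"
    unfolding is_impact_def
  proof (intro conjI impact_path_adapted[OF Q] exI[of _ ?I] I AE_I2)
    fix \<omega> assume \<omega>: "\<omega> \<in> space M"
    note q = cadlag_processD[OF Q(2) \<omega>]
    show "\<forall>t\<in>{0..T}. impact_path \<beta> lam lam' y (\<lambda>s. Q s \<omega>) t =
        y - (LBINT s:{0..t}. \<beta> s * impact_path \<beta> lam lam' y (\<lambda>s. Q s \<omega>) s) + ?I t \<omega>"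
      using impact_path_iff[OF q impact_path_cadlag[OF q], of y y] by simp
  qed
  then have imp: "is_impact M F T \<beta> lam y Q (impact M F T \<beta> lam y Q)"
    unfolding impact_def by (rule someI[where P = "is_impact M F T \<beta> lam y Q"])
  then show ac: "adapted F T (impact M F T \<beta> lam y Q)" "cadlag_process M T (impact M F T \<beta> lam y Q)"
    by (auto simp: is_impact_def)
  obtain J where J: "is_stoch_integral M F T lam Q J"
    "AE \<omega> in M. \<forall>t\<in>{0..T}. impact M F T \<beta> lam y Q t \<omega> =
      y - (LBINT s:{0..t}. \<beta> s * impact M F T \<beta> lam y Q s \<omega>) + J t \<omega>"
    using imp unfolding is_impact_def by blast
  show "AE \<omega> in M. \<forall>t\<in>{0..T}. impact M F T \<beta> lam y Q t \<omega> = impact_path \<beta> lam lam' y (\<lambda>s. Q s \<omega>) t"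
    using J(2) stoch_integral_unique[OF Q J(1) I] AE_space
  proof eventually_elim
    case (elim \<omega>)
    then have "\<forall>t\<in>{0..T}. impact M F T \<beta> lam y Q t \<omega> =
        y - (LBINT s:{0..t}. \<beta> s * impact M F T \<beta> lam y Q s \<omega>) + ?I t \<omega>"
      by metis
    then show ?case
      using impact_path_iff[OF cadlag_processD[OF Q(2) elim(3)] cadlag_processD[OF ac(2) elim(3)]] by blast
  qed
qed

end

section \<open>Optional sampling\<close>

text \<open>For \<open>0 \<le> K\<close> this is the distance of \<open>x\<close> from the interval
  [-K, K]. Bounds on its expectation for large \<open>K\<close> express uniform
  integrability.\<close>

definition excess :: "real \<Rightarrow> real \<Rightarrow> real" where
  "excess K x = max (\<bar>x\<bar> - K) 0"

lemma excess_nonneg: "0 \<le> excess K x"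
  by (simp add: excess_def)

lemma continuous_excess: "continuous_on UNIV (excess K)"
  unfolding excess_def by (intro continuous_intros)

lemma measurable_excess [measurable]: "excess K \<in> borel_measurable borel"
  by (rule borel_measurable_continuous_onI[OF continuous_excess])

lemma excess_le: "0 \<le> K \<Longrightarrow> excess K x \<le> \<bar>x\<bar>"
  by (auto simp: excess_def)

text \<open>\<open>excess\<close> is the distance of a number to its clipped value, so this is the
  triangle inequality through the two clipped values.\<close>

lemma diff_le_excess_clip:
  "0 \<le> K \<Longrightarrow> \<bar>x - y\<bar> \<le> excess K x + excess K y + \<bar>max (-K) (min x K) - max (-K) (min y K)\<bar>"
  by (auto simp: excess_def max_def min_def)

lemma (in finite_measure) excess_integral_small:
  assumes X: "integrable M X" and e: "0 < e"
  shows "\<exists>K\<ge>0. (\<integral>\<omega>. excess K (X \<omega>) \<partial>M) < e"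
proof -
  have [measurable]: "X \<in> borel_measurable M" using X by auto
  have "(\<lambda>n. \<integral>\<omega>. excess (real n) (X \<omega>) \<partial>M) \<longlonglongrightarrow> (\<integral>\<omega>. 0 \<partial>M)"
  proof (rule integral_dominated_convergence)
    show "integrable M (\<lambda>\<omega>. \<bar>X \<omega>\<bar>)" using X by auto
    show "AE \<omega> in M. (\<lambda>n. excess (real n) (X \<omega>)) \<longlonglongrightarrow> 0"
    proof (rule AE_I2, rule tendsto_eventually)
      fix \<omega>
      obtain n0 :: nat where "\<bar>X \<omega>\<bar> \<le> real n0" using real_arch_simple by blast
      then show "\<forall>\<^sub>F n in sequentially. excess (real n) (X \<omega>) = 0"
        unfolding eventually_sequentially by (intro exI[of _ n0]) (auto simp: excess_def)
    qed
    show "AE \<omega> in M. norm (excess (real n) (X \<omega>)) \<le> \<bar>X \<omega>\<bar>" for n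
      using excess_le[of "real n"] excess_nonneg by (auto intro!: AE_I2)
  qed auto
  then have "\<forall>\<^sub>F n in sequentially. (\<integral>\<omega>. excess (real n) (X \<omega>) \<partial>M) < e"
    using e by (intro order_tendstoD(2)) auto
  then obtain n where "(\<integral>\<omega>. excess (real n) (X \<omega>) \<partial>M) < e" by (auto simp: eventually_sequentially)
  then show ?thesis by (intro exI[of _ "real n"]) auto
qed

section \<open>Martingales sampled at bounded stopping times\<close>

context usual_filtered_prob_space
begin

lemma cond_exp_subalgebra: "t \<in> {0..T} \<Longrightarrow> sigma_finite_subalgebra M (F t)"
  by (intro finite_measure_subalgebra_is_sigma_finite)
     (auto simp: finite_measure_subalgebra_def finite_measure_subalgebra_axioms_def
        subalgebra_F intro: finite_measure_axioms)

lemma martingale_adapted: "martingale M F T X \<Longrightarrow> adapted F T X"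
  by (simp add: martingale_def)

lemma martingale_integrable: "martingale M F T X \<Longrightarrow> t \<in> {0..T} \<Longrightarrow> integrable M (X t)"
  by (simp add: martingale_def)

lemma martingale_integral_eq:
  assumes X: "martingale M F T X" and st: "0 \<le> s" "s \<le> t" "t \<le> T" and A: "A \<in> sets (F s)"
  shows "(\<integral>\<omega>. indicator A \<omega> * X t \<omega> \<partial>M) = (\<integral>\<omega>. indicator A \<omega> * X s \<omega> \<partial>M)"
proof -
  interpret sigma_finite_subalgebra M "F s" by (rule cond_exp_subalgebra) (use st in auto)
  have AM: "A \<in> sets M" using sets_F[of s] A st by auto
  have it: "integrable M (X t)" "integrable M (X s)" using martingale_integrable[OF X] st by auto
  have ae: "AE \<omega> in M. real_cond_exp M (F s) (X t) \<omega> = X s \<omega>" using X st by (auto simp: martingale_def)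
  have "(\<integral>\<omega>\<in>A. X t \<omega> \<partial>M) = (\<integral>\<omega>\<in>A. real_cond_exp M (F s) (X t) \<omega> \<partial>M)"
    by (rule real_cond_exp_intA[OF it(1) A])
  also have "\<dots> = (\<integral>\<omega>\<in>A. X s \<omega> \<partial>M)"
    using ae AM it by (intro set_lebesgue_integral_cong_AE) auto
  finally show ?thesis by (simp add: set_lebesgue_integral_def)
qed

text \<open>Integrals over the events of \<open>F s\<close> characterize the conditional
  expectation. This is the form in which martingales are stopped and added below.\<close>

lemma martingaleI:
  assumes a: "adapted F T X" and i: "\<And>t. t \<in> {0..T} \<Longrightarrow> integrable M (X t)"
    and eq: "\<And>s t A. 0 \<le> s \<Longrightarrow> s \<le> t \<Longrightarrow> t \<le> T \<Longrightarrow> A \<in> sets (F s) \<Longrightarrow>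
      (\<integral>\<omega>. indicator A \<omega> * X t \<omega> \<partial>M) = (\<integral>\<omega>. indicator A \<omega> * X s \<omega> \<partial>M)"
  shows "martingale M F T X"
  unfolding martingale_def
proof (intro conjI ballI a i)
  fix s t assume s: "s \<in> {0..T}" and t: "t \<in> {s..T}"
  interpret sigma_finite_subalgebra M "F s" by (rule cond_exp_subalgebra[OF s])
  show "AE \<omega> in M. real_cond_exp M (F s) (X t) \<omega> = X s \<omega>"
    by (rule real_cond_exp_charact)
       (use eq[of s t] i[of t] i[of s] s t adaptedD[OF a s] in \<open>auto simp: set_lebesgue_integral_def\<close>)
qed

lemma integrable_indicator_mult:
  "A \<in> sets M \<Longrightarrow> integrable M f \<Longrightarrow> integrable M (\<lambda>\<omega>. indicator A \<omega> * (f \<omega> :: real))"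
  using integrable_mult_indicator[of A M f] by simp

text \<open>
  Jensen's inequality is elementary here, because the sets on which \<open>X s\<close> lies above \<open>K\<close> or
  below \<open>-K\<close> are \<open>F s\<close>-measurable.
\<close>

lemma martingale_excess_le:
  assumes X: "martingale M F T X" and st: "0 \<le> s" "s \<le> t" "t \<le> T" and A: "A \<in> sets (F s)" and K: "0 \<le> K"
  shows "(\<integral>\<omega>. indicator A \<omega> * excess K (X s \<omega>) \<partial>M) \<le> (\<integral>\<omega>. indicator A \<omega> * excess K (X t \<omega>) \<partial>M)"
proof -
  have s: "s \<in> {0..T}" using st by auto
  have i: "integrable M (X s)" "integrable M (X t)" using martingale_integrable[OF X] st by auto
  have [measurable]: "X s \<in> borel_measurable (F s)" by (rule adaptedD[OF martingale_adapted[OF X] s])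
  have [measurable]: "A \<in> sets (F s)" by fact
  define B where "B = {\<omega> \<in> space (F s). \<omega> \<in> A \<and> K < X s \<omega>}"
  define C where "C = {\<omega> \<in> space (F s). \<omega> \<in> A \<and> X s \<omega> < - K}"
  have BC: "B \<in> sets (F s)" "C \<in> sets (F s)" unfolding B_def C_def by measurable
  have AM: "A \<in> sets M" and BM: "B \<in> sets M" and CM: "C \<in> sets M" using sets_F[OF s] A BC by auto
  have As: "A \<subseteq> space (F s)" by (rule sets.sets_into_space[OF A])
  have ie: "integrable M (\<lambda>\<omega>. excess K (X t \<omega>))"
    by (rule Bochner_Integration.integrable_bound[OF i(2)])
       (use i excess_le[OF K] excess_nonneg in \<open>auto intro!: AE_I2\<close>)
  have "(\<integral>\<omega>. indicator A \<omega> * excess K (X s \<omega>) \<partial>M)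
      = (\<integral>\<omega>. (indicator B \<omega> * X s \<omega> - K * indicator B \<omega>) + (- (indicator C \<omega> * X s \<omega>) - K * indicator C \<omega>) \<partial>M)"
    using As K by (intro Bochner_Integration.integral_cong)
      (auto simp: indicator_def excess_def B_def C_def max_def)
  also have "\<dots> = ((\<integral>\<omega>. indicator B \<omega> * X s \<omega> \<partial>M) - K * measure M B)
      + (- (\<integral>\<omega>. indicator C \<omega> * X s \<omega> \<partial>M) - K * measure M C)"
    using BM CM i by (simp add: integrable_indicator_mult emeasure_eq_measure)
  also have "\<dots> = ((\<integral>\<omega>. indicator B \<omega> * X t \<omega> \<partial>M) - K * measure M B)
      + (- (\<integral>\<omega>. indicator C \<omega> * X t \<omega> \<partial>M) - K * measure M C)"
    using martingale_integral_eq[OF X st] BC by simp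
  also have "\<dots> = (\<integral>\<omega>. (indicator B \<omega> * X t \<omega> - K * indicator B \<omega>) + (- (indicator C \<omega> * X t \<omega>) - K * indicator C \<omega>) \<partial>M)"
    using BM CM i by (simp add: integrable_indicator_mult emeasure_eq_measure)
  \<comment> \<open>On \<open>B\<close> the excess of \<open>X t\<close> is at least
    \<open>X t - K\<close>, on \<open>C\<close> at least \<open>- X t - K\<close>, and elsewhere it
    is nonnegative; \<open>0 \<le> K\<close> makes \<open>B\<close> and \<open>C\<close>
    disjoint.\<close>
  also have "\<dots> \<le> (\<integral>\<omega>. indicator A \<omega> * excess K (X t \<omega>) \<partial>M)"
  proof (rule integral_mono)
    show "integrable M (\<lambda>\<omega>. (indicator B \<omega> * X t \<omega> - K * indicator B \<omega>) + (- (indicator C \<omega> * X t \<omega>) - K * indicator C \<omega>))"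
      using BM CM i
      by (intro Bochner_Integration.integrable_add Bochner_Integration.integrable_diff
          Bochner_Integration.integrable_minus integrable_mult_right integrable_real_indicator
          integrable_indicator_mult) (auto simp: emeasure_eq_measure)
    show "integrable M (\<lambda>\<omega>. indicator A \<omega> * excess K (X t \<omega>))"
      by (rule integrable_indicator_mult[OF AM ie])
    show "(indicator B \<omega> * X t \<omega> - K * indicator B \<omega>) + (- (indicator C \<omega> * X t \<omega>) - K * indicator C \<omega>)
        \<le> indicator A \<omega> * excess K (X t \<omega>)" for \<omega>
      using K by (auto simp: indicator_def excess_def B_def C_def)
  qed
  finally show ?thesis .
qed

text \<open>
  The time \<open>\<rho>\<close> is approximated from above by grid-valued times. The preceding lemma bounds the
  truncation excess of the sampled variables uniformly, so they converge in mean.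
\<close>

lemma optional_sampling:
  assumes X: "martingale M F T X" "cadlag_process M T X" and st: "0 \<le> s" "s \<le> t" "t \<le> T"
    and \<rho>: "\<And>\<omega>. \<omega> \<in> space M \<Longrightarrow> \<rho> \<omega> \<in> {s..t}"
    and stop: "\<And>r. r \<in> {s..<t} \<Longrightarrow> {\<omega> \<in> space M. \<rho> \<omega> \<le> r} \<in> sets (F r)"
  shows "integrable M (\<lambda>\<omega>. X (\<rho> \<omega>) \<omega>)"
    and "A \<in> sets (F s) \<Longrightarrow> (\<integral>\<omega>. indicator A \<omega> * X (\<rho> \<omega>) \<omega> \<partial>M) = (\<integral>\<omega>. indicator A \<omega> * X t \<omega> \<partial>M)"
proof -
  \<comment> \<open>\<open>p n\<close> is a grid of \<open>n + 1\<close> equal steps from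
    \<open>s\<close> to \<open>t\<close>, capped at \<open>t\<close>. \<open>J n\<close> rounds
    \<open>\<rho>\<close> up to it, so \<open>p n (J n \<omega>)\<close> lies between
    \<open>\<rho> \<omega>\<close> and \<open>\<rho> \<omega> + h n\<close>.\<close>
  define h where "h n = (t - s) / real (Suc n)" for n
  define p where "p n i = min t (s + h n * real i)" for n i
  define J where "J n \<omega> = (LEAST i. \<rho> \<omega> \<le> p n i)" for n \<omega>
  define Z where "Z n \<omega> = X (p n (J n \<omega>)) \<omega>" for n \<omega>
  have h0: "0 \<le> h n" for n using st by (simp add: h_def)
  have p_last: "p n (Suc n) = t" for n by (simp add: p_def h_def)
  have p_in: "p n i \<in> {s..t}" for n i using st h0[of n] by (auto simp: p_def)
  have p_mono: "i \<le> j \<Longrightarrow> p n i \<le> p n j" for n i j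
    unfolding p_def by (rule min.mono[OF order_refl]) (simp add: mult_left_mono h0)
  have J: "J n \<omega> \<le> Suc n" "\<rho> \<omega> \<le> p n (J n \<omega>)" "p n (J n \<omega>) \<le> \<rho> \<omega> + h n"
    and J_le: "J n \<omega> \<le> i \<longleftrightarrow> \<rho> \<omega> \<le> p n i" if \<omega>: "\<omega> \<in> space M" for n i \<omega>
  proof -
    have ex: "\<rho> \<omega> \<le> p n (Suc n)" using \<rho>[OF \<omega>] p_last by auto
    show "J n \<omega> \<le> Suc n" unfolding J_def
      by (rule Least_le[of "\<lambda>i. \<rho> \<omega> \<le> p n i", OF ex])
    show le: "\<rho> \<omega> \<le> p n (J n \<omega>)" unfolding J_def
      by (rule LeastI[of "\<lambda>i. \<rho> \<omega> \<le> p n i", OF ex])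
    show "J n \<omega> \<le> i \<longleftrightarrow> \<rho> \<omega> \<le> p n i" for i
      using le p_mono[of "J n \<omega>" i n] Least_le[of "\<lambda>i. \<rho> \<omega> \<le> p n i" i] by (auto simp: J_def)
    show "p n (J n \<omega>) \<le> \<rho> \<omega> + h n"
    proof (cases "J n \<omega>")
      case 0
      then show ?thesis using \<rho>[OF \<omega>] h0[of n] by (auto simp: p_def)
    next
      case (Suc j)
      then have "\<not> \<rho> \<omega> \<le> p n j" using not_less_Least[of j "\<lambda>i. \<rho> \<omega> \<le> p n i"] by (simp add: J_def)
      moreover have "p n (Suc j) \<le> p n j + h n" using h0[of n] by (auto simp: p_def algebra_simps)
      ultimately show ?thesis using Suc by simp
    qed
  qed
  \<comment> \<open>The hypothesis on \<open>\<rho>\<close> covers times before \<open>t\<close>; at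
    the last grid point the event is the whole space.\<close>
  have p_F: "{\<omega> \<in> space M. \<rho> \<omega> \<le> p n i} \<in> sets (F (p n i))" for n i
  proof (cases "p n i < t")
    case True
    then show ?thesis using stop p_in[of n i] by auto
  next
    case False
    then have "{\<omega> \<in> space M. \<rho> \<omega> \<le> p n i} = space (F (p n i))"
      using \<rho> p_in[of n i] space_F[of "p n i"] st by fastforce
    then show ?thesis by simp
  qed
  have p_T: "p n i \<in> {0..T}" for n i using p_in[of n i] st by auto
  define B where "B n i = {\<omega> \<in> space M. J n \<omega> = i}" for n i
  \<comment> \<open>Rounding up, and not down, makes this event known at the grid time
    itself.\<close>
  have B: "B n i \<in> sets (F (p n i))" for n i
  proof (cases i)
    case 0
    then have "B n i = {\<omega> \<in> space M. \<rho> \<omega> \<le> p n i}" using J_le[of _ n 0] by (auto simp: B_def)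
    then show ?thesis using p_F by simp
  next
    case (Suc j)
    have "J n \<omega> = i \<longleftrightarrow> \<rho> \<omega> \<le> p n i \<and> \<not> \<rho> \<omega> \<le> p n j" if "\<omega> \<in> space M" for \<omega>
      unfolding J_le[OF that, symmetric] using Suc by auto
    then have "B n i = {\<omega> \<in> space M. \<rho> \<omega> \<le> p n i} - {\<omega> \<in> space M. \<rho> \<omega> \<le> p n j}"
      by (auto simp: B_def)
    moreover have "{\<omega> \<in> space M. \<rho> \<omega> \<le> p n j} \<in> sets (F (p n i))"
      using F_mono[of "p n j" "p n i"] p_F[of n j] p_T[of n j] p_T[of n i] p_mono[of j i n] Suc by auto
    ultimately show ?thesis using p_F[of n i] by auto
  qed
  have BM: "B n i \<in> sets M" for n i using sets_F[OF p_T B] .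
  note Xi = martingale_integrable[OF X(1) p_T]
  \<comment> \<open>Stated for a general \<open>g\<close> because it serves the identity,
    \<open>excess K\<close> and the constant 1; the last case says that the events
    \<open>B n i\<close> partition the space.\<close>
  have decomp: "g (Z n \<omega>) = (\<Sum>i\<le>Suc n. indicator (B n i) \<omega> * g (X (p n i) \<omega>))"
    if "\<omega> \<in> space M" for g :: "real \<Rightarrow> real" and n \<omega>
  proof -
    have "(\<Sum>i\<le>Suc n. indicator (B n i) \<omega> * g (X (p n i) \<omega>))
        = (\<Sum>i\<le>Suc n. if i = J n \<omega> then g (X (p n i) \<omega>) else 0)"
      using that by (intro sum.cong) (auto simp: B_def)
    also have "\<dots> = g (Z n \<omega>)" using J(1)[OF that, of n] by (simp add: Z_def)
    finally show ?thesis by simp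
  qed
  have one: "(\<Sum>i\<le>Suc n. indicator (B n i) \<omega>) = (1::real)" if "\<omega> \<in> space M" for n \<omega>
    using decomp[OF that, of "\<lambda>_. 1" n] by simp
  have it: "integrable M (X t)" using martingale_integrable[OF X(1), of t] st by auto
  have Zi: "integrable M (Z n)" for n
  proof -
    have "integrable M (\<lambda>\<omega>. \<Sum>i\<le>Suc n. indicator (B n i) \<omega> * X (p n i) \<omega>)"
      by (intro Bochner_Integration.integrable_sum integrable_indicator_mult BM Xi)
    then show ?thesis
      by (rule Bochner_Integration.integrable_cong[THEN iffD1, rotated -1])
         (use decomp[of _ "\<lambda>x. x"] in auto)
  qed
  have Z_eq: "(\<integral>\<omega>. indicator A \<omega> * Z n \<omega> \<partial>M) = (\<integral>\<omega>. indicator A \<omega> * X t \<omega> \<partial>M)" if A: "A \<in> sets (F s)" for A n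
  proof -
    have AM: "A \<in> sets M" using sets_F[of s] A st by auto
    have AB: "A \<inter> B n i \<in> sets (F (p n i))" for i
      using B[of n i] F_mono[of s "p n i"] p_T[of n i] p_in[of n i] st A by auto
    have "(\<integral>\<omega>. indicator A \<omega> * Z n \<omega> \<partial>M) = (\<integral>\<omega>. (\<Sum>i\<le>Suc n. indicator (A \<inter> B n i) \<omega> * X (p n i) \<omega>) \<partial>M)"
    proof (intro Bochner_Integration.integral_cong refl)
      fix \<omega> assume \<omega>: "\<omega> \<in> space M"
      show "indicator A \<omega> * Z n \<omega> = (\<Sum>i\<le>Suc n. indicator (A \<inter> B n i) \<omega> * X (p n i) \<omega>)"
        unfolding decomp[OF \<omega>, of "\<lambda>x. x"] by (simp only: sum_distrib_left indicator_inter_arith mult.assoc)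
    qed
    also have "\<dots> = (\<Sum>i\<le>Suc n. \<integral>\<omega>. indicator (A \<inter> B n i) \<omega> * X (p n i) \<omega> \<partial>M)"
      by (intro Bochner_Integration.integral_sum integrable_indicator_mult sets.Int AM BM Xi)
    also have "\<dots> = (\<Sum>i\<le>Suc n. \<integral>\<omega>. indicator (A \<inter> B n i) \<omega> * X t \<omega> \<partial>M)"
      using p_T p_in st AB by (intro sum.cong refl martingale_integral_eq[OF X(1), symmetric]) auto
    also have "\<dots> = (\<integral>\<omega>. (\<Sum>i\<le>Suc n. indicator (A \<inter> B n i) \<omega> * X t \<omega>) \<partial>M)"
      by (intro Bochner_Integration.integral_sum[symmetric] integrable_indicator_mult sets.Int AM BM it)
    also have "\<dots> = (\<integral>\<omega>. indicator A \<omega> * X t \<omega> \<partial>M)"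
    proof (intro Bochner_Integration.integral_cong refl)
      fix \<omega> assume "\<omega> \<in> space M"
      then have "indicator A \<omega> * X t \<omega> * (\<Sum>i\<le>Suc n. indicator (B n i) \<omega>) = indicator A \<omega> * X t \<omega>"
        using one by simp
      then show "(\<Sum>i\<le>Suc n. indicator (A \<inter> B n i) \<omega> * X t \<omega>) = indicator A \<omega> * X t \<omega>"
        by (simp add: sum_distrib_left indicator_inter_arith mult_ac del: sum.atMost_Suc)
    qed
    finally show ?thesis .
  qed
  have iexc: "integrable M (\<lambda>\<omega>. excess K (f \<omega>))" if "integrable M f" "0 \<le> K" for f :: "'a \<Rightarrow> real" and K
    by (rule Bochner_Integration.integrable_bound[OF that(1)])
       (use that excess_le[OF that(2)] excess_nonneg in \<open>auto intro!: AE_I2\<close>)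
  have Z_exc: "(\<integral>\<omega>. excess K (Z n \<omega>) \<partial>M) \<le> (\<integral>\<omega>. excess K (X t \<omega>) \<partial>M)" if K: "0 \<le> K" for K n
  proof -
    have "(\<integral>\<omega>. excess K (Z n \<omega>) \<partial>M) = (\<integral>\<omega>. (\<Sum>i\<le>Suc n. indicator (B n i) \<omega> * excess K (X (p n i) \<omega>)) \<partial>M)"
      by (intro Bochner_Integration.integral_cong decomp refl)
    also have "\<dots> = (\<Sum>i\<le>Suc n. \<integral>\<omega>. indicator (B n i) \<omega> * excess K (X (p n i) \<omega>) \<partial>M)"
      by (intro Bochner_Integration.integral_sum integrable_indicator_mult BM iexc Xi K)
    also have "\<dots> \<le> (\<Sum>i\<le>Suc n. \<integral>\<omega>. indicator (B n i) \<omega> * excess K (X t \<omega>) \<partial>M)"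
      using p_T p_in st by (intro sum_mono martingale_excess_le[OF X(1)] B K) auto
    also have "\<dots> = (\<integral>\<omega>. (\<Sum>i\<le>Suc n. indicator (B n i) \<omega> * excess K (X t \<omega>)) \<partial>M)"
      by (intro Bochner_Integration.integral_sum[symmetric] integrable_indicator_mult BM iexc it K)
    also have "\<dots> = (\<integral>\<omega>. excess K (X t \<omega>) \<partial>M)"
      by (intro Bochner_Integration.integral_cong refl) (simp add: sum_distrib_right[symmetric] one del: sum.atMost_Suc)
    finally show ?thesis .
  qed
  have Z_lim: "(\<lambda>n. Z n \<omega>) \<longlonglongrightarrow> X (\<rho> \<omega>) \<omega>" if \<omega>: "\<omega> \<in> space M" for \<omega>
  proof -
    have "continuous (at_right (\<rho> \<omega>)) (\<lambda>r. X (max 0 (min r T)) \<omega>)"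
      by (rule cadlag_on_clamp[OF cadlag_processD[OF X(2) \<omega>]]) (use T_pos in auto)
    \<comment> \<open>The rounded times may coincide with \<open>\<rho> \<omega>\<close>, so
      continuity is needed on the closed half-line and not only along
      \<open>at_right\<close>.\<close>
    then have c: "continuous (at (\<rho> \<omega>) within {\<rho> \<omega>..}) (\<lambda>r. X (max 0 (min r T)) \<omega>)"
      by (simp add: continuous_within at_within_def Diff_insert atLeast_def greaterThan_def
          set_diff_eq order_le_less conj_commute cong: conj_cong)
    have "(\<lambda>n. p n (J n \<omega>)) \<longlonglongrightarrow> \<rho> \<omega>"
    proof (rule tendsto_sandwich[where f = "\<lambda>_. \<rho> \<omega>" and h = "\<lambda>n. \<rho> \<omega> + h n"])
      have "(\<lambda>n. (t - s) * inverse (real (Suc n))) \<longlonglongrightarrow> (t - s) * 0"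
        by (intro tendsto_intros LIMSEQ_inverse_real_of_nat)
      then have "h \<longlonglongrightarrow> 0" by (simp add: h_def[abs_def] divide_inverse)
      from tendsto_add[OF tendsto_const[of "\<rho> \<omega>"] this]
      show "(\<lambda>n. \<rho> \<omega> + h n) \<longlonglongrightarrow> \<rho> \<omega>" by simp
    qed (use J[OF \<omega>] in auto)
    then have "((\<lambda>r. X (max 0 (min r T)) \<omega>) \<circ> (\<lambda>n. p n (J n \<omega>))) \<longlonglongrightarrow> X (max 0 (min (\<rho> \<omega>) T)) \<omega>"
      using c J(2)[OF \<omega>] unfolding continuous_within_sequentially by auto
    moreover have "max 0 (min (p n i) T) = p n i" for n i using p_T[of n i] by auto
    moreover have "max 0 (min (\<rho> \<omega>) T) = \<rho> \<omega>" using \<rho>[OF \<omega>] st by auto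
    ultimately show ?thesis by (simp add: o_def Z_def)
  qed
  have [measurable]: "Z n \<in> borel_measurable M" for n using Zi by auto
  have Xm[measurable]: "(\<lambda>\<omega>. X (\<rho> \<omega>) \<omega>) \<in> borel_measurable M"
    by (rule borel_measurable_LIMSEQ_real[OF Z_lim]) auto
  \<comment> \<open>Fatou's lemma transfers the uniform bound from the sampled variables to their
    limit; \<open>K = 0\<close> then yields integrability.\<close>
  have X_exc: "(\<integral>\<^sup>+\<omega>. ennreal (excess K (X (\<rho> \<omega>) \<omega>)) \<partial>M) \<le> ennreal (\<integral>\<omega>. excess K (X t \<omega>) \<partial>M)"
    if K: "0 \<le> K" for K
  proof -
    have "(\<integral>\<^sup>+\<omega>. ennreal (excess K (X (\<rho> \<omega>) \<omega>)) \<partial>M) = (\<integral>\<^sup>+\<omega>. liminf (\<lambda>n. ennreal (excess K (Z n \<omega>))) \<partial>M)"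
    proof (rule nn_integral_cong)
      fix \<omega> assume "\<omega> \<in> space M"
      have "(\<lambda>n. ennreal (excess K (Z n \<omega>))) \<longlonglongrightarrow> ennreal (excess K (X (\<rho> \<omega>) \<omega>))"
        by (intro tendsto_ennrealI continuous_on_tendsto_compose[OF continuous_excess Z_lim[OF \<open>\<omega> \<in> space M\<close>]]) auto
      from lim_imp_Liminf[OF _ this]
      show "ennreal (excess K (X (\<rho> \<omega>) \<omega>)) = liminf (\<lambda>n. ennreal (excess K (Z n \<omega>)))" by simp
    qed
    also have "\<dots> \<le> liminf (\<lambda>n. \<integral>\<^sup>+\<omega>. ennreal (excess K (Z n \<omega>)) \<partial>M)"
      by (rule nn_integral_liminf) measurable
    also have "\<dots> \<le> liminf (\<lambda>n. ennreal (\<integral>\<omega>. excess K (X t \<omega>) \<partial>M))"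
    proof (intro Liminf_mono always_eventually allI)
      fix n
      have "(\<integral>\<^sup>+\<omega>. ennreal (excess K (Z n \<omega>)) \<partial>M) = ennreal (\<integral>\<omega>. excess K (Z n \<omega>) \<partial>M)"
        by (intro nn_integral_eq_integral iexc Zi K AE_I2 excess_nonneg)
      then show "(\<integral>\<^sup>+\<omega>. ennreal (excess K (Z n \<omega>)) \<partial>M) \<le> ennreal (\<integral>\<omega>. excess K (X t \<omega>) \<partial>M)"
        using Z_exc[OF K] by (simp add: ennreal_leI)
    qed
    finally show ?thesis by (simp add: Liminf_const)
  qed
  show int: "integrable M (\<lambda>\<omega>. X (\<rho> \<omega>) \<omega>)"
  proof (rule integrableI_bounded[OF Xm])
    show "(\<integral>\<^sup>+\<omega>. ennreal (norm (X (\<rho> \<omega>) \<omega>)) \<partial>M) < \<infinity>"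
      using X_exc[of 0] by (simp add: excess_def order_le_less_trans)
  qed
  assume A: "A \<in> sets (F s)"
  have AM: "A \<in> sets M" using sets_F[of s] A st by auto
  define c where "c K x = max (-K) (min x K)" for K x :: real
  have "\<bar>(\<integral>\<omega>. indicator A \<omega> * X (\<rho> \<omega>) \<omega> \<partial>M) - (\<integral>\<omega>. indicator A \<omega> * X t \<omega> \<partial>M)\<bar> \<le> 0 + e" if e: "0 < e" for e
  proof -
    \<comment> \<open>The error splits into the excess of
      \<open>X (\<rho> \<omega>) \<omega>\<close>, the excess of \<open>Z n\<close> and the distance
      of the clipped values. The level \<open>K\<close> makes the first two small for all
      \<open>n\<close> at once; bounded convergence makes the third small for some
      \<open>n\<close>.\<close>
    obtain K where K: "0 \<le> K" "(\<integral>\<omega>. excess K (X t \<omega>) \<partial>M) < e / 3"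
      using excess_integral_small[OF it, of "e / 3"] e by auto
    have cc: "continuous_on UNIV (c K)" unfolding c_def by (intro continuous_intros)
    have [measurable]: "c K \<in> borel_measurable borel" by (rule borel_measurable_continuous_onI[OF cc])
    have "(\<lambda>n. \<integral>\<omega>. \<bar>c K (X (\<rho> \<omega>) \<omega>) - c K (Z n \<omega>)\<bar> \<partial>M) \<longlonglongrightarrow> (\<integral>\<omega>. 0 \<partial>M)"
    proof (rule integral_dominated_convergence[where w = "\<lambda>_. 2 * K"])
      show "AE \<omega> in M. (\<lambda>n. \<bar>c K (X (\<rho> \<omega>) \<omega>) - c K (Z n \<omega>)\<bar>) \<longlonglongrightarrow> 0"
      proof (rule AE_I2)
        fix \<omega> assume "\<omega> \<in> space M"
        have "(\<lambda>n. c K (Z n \<omega>)) \<longlonglongrightarrow> c K (X (\<rho> \<omega>) \<omega>)"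
          by (rule continuous_on_tendsto_compose[OF cc Z_lim[OF \<open>\<omega> \<in> space M\<close>]]) auto
        from tendsto_rabs[OF tendsto_diff[OF tendsto_const[of "c K (X (\<rho> \<omega>) \<omega>)"] this]]
        show "(\<lambda>n. \<bar>c K (X (\<rho> \<omega>) \<omega>) - c K (Z n \<omega>)\<bar>) \<longlonglongrightarrow> 0" by simp
      qed
      show "AE \<omega> in M. norm \<bar>c K (X (\<rho> \<omega>) \<omega>) - c K (Z n \<omega>)\<bar> \<le> 2 * K" for n
        using K(1) by (intro AE_I2) (auto simp: c_def max_def min_def)
    qed auto
    then have "\<forall>\<^sub>F n in sequentially. (\<integral>\<omega>. \<bar>c K (X (\<rho> \<omega>) \<omega>) - c K (Z n \<omega>)\<bar> \<partial>M) < e / 3"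
      using e by (intro order_tendstoD(2)) auto
    then obtain n where n: "(\<integral>\<omega>. \<bar>c K (X (\<rho> \<omega>) \<omega>) - c K (Z n \<omega>)\<bar> \<partial>M) < e / 3"
      by (auto simp: eventually_sequentially)
    have ic: "integrable M (\<lambda>\<omega>. \<bar>c K (X (\<rho> \<omega>) \<omega>) - c K (Z n \<omega>)\<bar>)"
      by (rule integrable_const_bound[where B = "2 * K"])
         (use K(1) in \<open>auto simp: c_def max_def min_def intro!: AE_I2\<close>)
    have "\<bar>(\<integral>\<omega>. indicator A \<omega> * X (\<rho> \<omega>) \<omega> \<partial>M) - (\<integral>\<omega>. indicator A \<omega> * X t \<omega> \<partial>M)\<bar>
        = \<bar>\<integral>\<omega>. indicator A \<omega> * X (\<rho> \<omega>) \<omega> - indicator A \<omega> * Z n \<omega> \<partial>M\<bar>"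
      unfolding Z_eq[OF A, of n, symmetric]
      by (subst Bochner_Integration.integral_diff) (auto intro: integrable_indicator_mult AM int Zi)
    also have "\<dots> \<le> (\<integral>\<omega>. \<bar>indicator A \<omega> * X (\<rho> \<omega>) \<omega> - indicator A \<omega> * Z n \<omega>\<bar> \<partial>M)"
      by (rule integral_abs_bound)
    also have "\<dots> \<le> (\<integral>\<omega>. excess K (X (\<rho> \<omega>) \<omega>) + excess K (Z n \<omega>) + \<bar>c K (X (\<rho> \<omega>) \<omega>) - c K (Z n \<omega>)\<bar> \<partial>M)"
    proof (rule integral_mono)
      show "integrable M (\<lambda>\<omega>. \<bar>indicator A \<omega> * X (\<rho> \<omega>) \<omega> - indicator A \<omega> * Z n \<omega>\<bar>)"
        by (intro integrable_abs Bochner_Integration.integrable_diff integrable_indicator_mult AM int Zi)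
      show "integrable M (\<lambda>\<omega>. excess K (X (\<rho> \<omega>) \<omega>) + excess K (Z n \<omega>) + \<bar>c K (X (\<rho> \<omega>) \<omega>) - c K (Z n \<omega>)\<bar>)"
        by (intro Bochner_Integration.integrable_add iexc int Zi ic K)
      fix \<omega>
      have "\<bar>indicator A \<omega> * X (\<rho> \<omega>) \<omega> - indicator A \<omega> * Z n \<omega>\<bar> \<le> \<bar>X (\<rho> \<omega>) \<omega> - Z n \<omega>\<bar>"
        by (auto simp: indicator_def)
      also have "\<dots> \<le> excess K (X (\<rho> \<omega>) \<omega>) + excess K (Z n \<omega>) + \<bar>c K (X (\<rho> \<omega>) \<omega>) - c K (Z n \<omega>)\<bar>"
        unfolding c_def by (rule diff_le_excess_clip[OF K(1)])
      finally show "\<bar>indicator A \<omega> * X (\<rho> \<omega>) \<omega> - indicator A \<omega> * Z n \<omega>\<bar>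
        \<le> excess K (X (\<rho> \<omega>) \<omega>) + excess K (Z n \<omega>) + \<bar>c K (X (\<rho> \<omega>) \<omega>) - c K (Z n \<omega>)\<bar>" .
    qed
    also have "\<dots> = (\<integral>\<omega>. excess K (X (\<rho> \<omega>) \<omega>) \<partial>M) + (\<integral>\<omega>. excess K (Z n \<omega>) \<partial>M)
        + (\<integral>\<omega>. \<bar>c K (X (\<rho> \<omega>) \<omega>) - c K (Z n \<omega>)\<bar> \<partial>M)"
      using iexc[OF int K(1)] iexc[OF Zi K(1)] ic by simp
    also have "\<dots> \<le> e / 3 + e / 3 + e / 3"
    proof -
      have "ennreal (\<integral>\<omega>. excess K (X (\<rho> \<omega>) \<omega>) \<partial>M) = (\<integral>\<^sup>+\<omega>. ennreal (excess K (X (\<rho> \<omega>) \<omega>)) \<partial>M)"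
        by (intro nn_integral_eq_integral[symmetric] iexc int K AE_I2 excess_nonneg)
      then have "ennreal (\<integral>\<omega>. excess K (X (\<rho> \<omega>) \<omega>) \<partial>M) \<le> ennreal (\<integral>\<omega>. excess K (X t \<omega>) \<partial>M)"
        using X_exc[OF K(1)] by simp
      moreover have "0 \<le> (\<integral>\<omega>. excess K (X t \<omega>) \<partial>M)" by (rule Bochner_Integration.integral_nonneg) (rule excess_nonneg)
      ultimately have "(\<integral>\<omega>. excess K (X (\<rho> \<omega>) \<omega>) \<partial>M) \<le> (\<integral>\<omega>. excess K (X t \<omega>) \<partial>M)"
        by (simp only: ennreal_le_iff)
      then show ?thesis using K(2) Z_exc[OF K(1), of n] n by linarith
    qed
    finally show ?thesis by simp
  qed
  then have "\<bar>(\<integral>\<omega>. indicator A \<omega> * X (\<rho> \<omega>) \<omega> \<partial>M) - (\<integral>\<omega>. indicator A \<omega> * X t \<omega> \<partial>M)\<bar> \<le> 0"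
    by (rule field_le_epsilon)
  then show "(\<integral>\<omega>. indicator A \<omega> * X (\<rho> \<omega>) \<omega> \<partial>M) = (\<integral>\<omega>. indicator A \<omega> * X t \<omega> \<partial>M)" by simp
qed

lemma stopping_time_sets:
  assumes "stopping_time (\<lambda>t. F (max 0 (min t T))) \<sigma>" "r \<in> {0..T}"
  shows "{\<omega> \<in> space M. \<sigma> \<omega> \<le> r} \<in> sets (F r)"
  using stopping_timeD[OF assms(1), of r] assms(2) space_F[OF assms(2)]
  by (simp add: Measurable.pred_def min_absorb1 max_absorb2)

text \<open>An event of \<open>F s\<close> is cut along \<open>\<sigma> \<omega> \<le> s\<close>. On
  the one part the stopped process has the same value at \<open>s\<close> and \<open>t\<close>; on
  the other the time \<open>min t (\<sigma> \<omega>)\<close> lies in [s, t], where optional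
  sampling applies.\<close>

lemma stopped_martingale:
  assumes X: "martingale M F T X" "cadlag_process M T X"
    and \<sigma>: "stopping_time (\<lambda>t. F (max 0 (min t T))) \<sigma>" "\<And>\<omega>. \<omega> \<in> space M \<Longrightarrow> \<sigma> \<omega> \<in> {0..T}"
  shows "martingale M F T (\<lambda>t \<omega>. X (min t (\<sigma> \<omega>)) \<omega>)"
proof (rule martingaleI)
  show "adapted F T (\<lambda>t \<omega>. X (min t (\<sigma> \<omega>)) \<omega>)" unfolding adapted_def
  proof
    fix t assume t: "t \<in> {0..T}"
    have "(\<lambda>\<omega>. min t (\<sigma> \<omega>)) \<in> borel_measurable (F t)"
    proof (rule borel_measurableI_le)
      fix r
      show "{\<omega> \<in> space (F t). min t (\<sigma> \<omega>) \<le> r} \<in> sets (F t)"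
      proof (cases "t \<le> r")
        case True
        then have "{\<omega> \<in> space (F t). min t (\<sigma> \<omega>) \<le> r} = space (F t)" by (auto simp: min_le_iff_disj)
        then show ?thesis by simp
      next
        case False
        show ?thesis
        proof (cases "0 \<le> r")
          case True
          then have "{\<omega> \<in> space M. \<sigma> \<omega> \<le> r} \<in> sets (F t)"
            using stopping_time_sets[OF \<sigma>(1), of r] F_mono[of r t] t False by auto
          then show ?thesis using False space_F[OF t] by (simp add: min_le_iff_disj)
        next
          case r: False
          then have "{\<omega> \<in> space (F t). min t (\<sigma> \<omega>) \<le> r} = {}"
            using \<sigma>(2) t False space_F[OF t] by (force simp: min_le_iff_disj)
          then show ?thesis by (simp only: sets.empty_sets)
        qed
      qed
    qed
    then have "(\<lambda>\<omega>. (min t (\<sigma> \<omega>), \<omega>)) \<in> F t \<rightarrow>\<^sub>M borel \<Otimes>\<^sub>M F t"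
      by (intro measurable_Pair measurable_ident_sets refl)
    from measurable_compose[OF this adapted_joint_measurable[OF martingale_adapted[OF X(1)] X(2) t]]
    have "(\<lambda>\<omega>. X (max 0 (min (min t (\<sigma> \<omega>)) t)) \<omega>) \<in> borel_measurable (F t)" by simp
    moreover have "max 0 (min (min t (\<sigma> \<omega>)) t) = min t (\<sigma> \<omega>)" if "\<omega> \<in> space (F t)" for \<omega>
      using \<sigma>(2)[of \<omega>] that space_F[OF t] t by (auto simp: min_def)
    ultimately show "(\<lambda>\<omega>. X (min t (\<sigma> \<omega>)) \<omega>) \<in> borel_measurable (F t)"
      by (subst measurable_cong[where g = "\<lambda>\<omega>. X (max 0 (min (min t (\<sigma> \<omega>)) t)) \<omega>"]) auto
  qed
  show i: "integrable M (\<lambda>\<omega>. X (min t (\<sigma> \<omega>)) \<omega>)" if t: "t \<in> {0..T}" for t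
  proof (rule optional_sampling(1)[OF X, of 0 t])
    show "min t (\<sigma> \<omega>) \<in> {0..t}" if "\<omega> \<in> space M" for \<omega> using \<sigma>(2)[OF that] t by auto
    show "{\<omega> \<in> space M. min t (\<sigma> \<omega>) \<le> r} \<in> sets (F r)" if "r \<in> {0..<t}" for r
      using stopping_time_sets[OF \<sigma>(1), of r] that t by (simp add: min_le_iff_disj)
  qed (use t in auto)
  fix s t A assume st: "0 \<le> s" "s \<le> t" "t \<le> T" and A: "A \<in> sets (F s)"
  have s: "s \<in> {0..T}" and t: "t \<in> {0..T}" using st by auto
  define A1 where "A1 = A \<inter> {\<omega> \<in> space M. \<sigma> \<omega> \<le> s}"
  define A2 where "A2 = A - {\<omega> \<in> space M. \<sigma> \<omega> \<le> s}"
  have A12: "A1 \<in> sets (F s)" "A2 \<in> sets (F s)"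
    unfolding A1_def A2_def using A stopping_time_sets[OF \<sigma>(1) s] by auto
  have AM: "A1 \<in> sets M" "A2 \<in> sets M" using sets_F[OF s] A12 by auto
  have AS: "A \<subseteq> space M" using sets.sets_into_space[OF A] space_F[OF s] by simp
  have split: "(\<integral>\<omega>. indicator A \<omega> * f \<omega> \<partial>M) = (\<integral>\<omega>. indicator A1 \<omega> * f \<omega> \<partial>M) + (\<integral>\<omega>. indicator A2 \<omega> * f \<omega> \<partial>M)"
    if "integrable M f" for f :: "'a \<Rightarrow> real"
  proof -
    have "(\<integral>\<omega>. indicator A \<omega> * f \<omega> \<partial>M) = (\<integral>\<omega>. indicator A1 \<omega> * f \<omega> + indicator A2 \<omega> * f \<omega> \<partial>M)"
      by (intro Bochner_Integration.integral_cong) (auto simp: indicator_def A1_def A2_def)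
    then show ?thesis
      using that AM by (simp add: integrable_indicator_mult)
  qed
  have 1: "(\<integral>\<omega>. indicator A1 \<omega> * X (min t (\<sigma> \<omega>)) \<omega> \<partial>M) = (\<integral>\<omega>. indicator A1 \<omega> * X (min s (\<sigma> \<omega>)) \<omega> \<partial>M)"
    using st by (intro Bochner_Integration.integral_cong) (auto simp: indicator_def A1_def min_absorb2)
  \<comment> \<open>The maximum with \<open>s\<close> changes nothing on \<open>A2\<close> and gives
    a time with values in [s, t] everywhere.\<close>
  let ?\<rho> = "\<lambda>\<omega>. max s (min t (\<sigma> \<omega>))"
  have \<rho>: "?\<rho> \<omega> \<in> {s..t}" if "\<omega> \<in> space M" for \<omega> using st by auto
  have \<rho>s: "{\<omega> \<in> space M. ?\<rho> \<omega> \<le> r} \<in> sets (F r)" if "r \<in> {s..<t}" for r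
    using stopping_time_sets[OF \<sigma>(1), of r] that st by (simp add: min_le_iff_disj)
  have "(\<integral>\<omega>. indicator A2 \<omega> * X (min t (\<sigma> \<omega>)) \<omega> \<partial>M) = (\<integral>\<omega>. indicator A2 \<omega> * X (?\<rho> \<omega>) \<omega> \<partial>M)"
    using st AS by (intro Bochner_Integration.integral_cong) (auto simp: indicator_def A2_def max_def min_def)
  also have "\<dots> = (\<integral>\<omega>. indicator A2 \<omega> * X t \<omega> \<partial>M)"
    by (rule optional_sampling(2)[OF X st \<rho> \<rho>s A12(2)])
  also have "\<dots> = (\<integral>\<omega>. indicator A2 \<omega> * X s \<omega> \<partial>M)"
    by (rule martingale_integral_eq[OF X(1) st A12(2)])
  also have "\<dots> = (\<integral>\<omega>. indicator A2 \<omega> * X (min s (\<sigma> \<omega>)) \<omega> \<partial>M)"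
    using AS by (intro Bochner_Integration.integral_cong) (auto simp: indicator_def A2_def min_def)
  finally show "(\<integral>\<omega>. indicator A \<omega> * X (min t (\<sigma> \<omega>)) \<omega> \<partial>M) = (\<integral>\<omega>. indicator A \<omega> * X (min s (\<sigma> \<omega>)) \<omega> \<partial>M)"
    using split[OF i[OF t]] split[OF i[OF s]] 1 by simp
qed

section \<open>Linear combinations of strategies\<close>

lemma adapted_lincomb:
  assumes "adapted F T X" "adapted F T Y" shows "adapted F T (\<lambda>t \<omega>. a * X t \<omega> + b * Y t \<omega>)"
  unfolding adapted_def
  by (intro ballI borel_measurable_add borel_measurable_times borel_measurable_const
      adaptedD[OF assms(1)] adaptedD[OF assms(2)])

lemma cadlag_process_lincomb:
  assumes "cadlag_process M T X" "cadlag_process M T Y"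
  shows "cadlag_process M T (\<lambda>t \<omega>. a * X t \<omega> + b * Y t \<omega>)"
  unfolding cadlag_process_def
  by (intro ballI cadlag_on_add cadlag_on_cmult cadlag_processD[OF assms(1)] cadlag_processD[OF assms(2)])

lemma martingale_lincomb:
  assumes X: "martingale M F T X" and Y: "martingale M F T Y"
  shows "martingale M F T (\<lambda>t \<omega>. a * X t \<omega> + b * Y t \<omega>)"
proof (rule martingaleI)
  show "adapted F T (\<lambda>t \<omega>. a * X t \<omega> + b * Y t \<omega>)"
    by (intro adapted_lincomb martingale_adapted X Y)
  show "integrable M (\<lambda>\<omega>. a * X t \<omega> + b * Y t \<omega>)" if "t \<in> {0..T}" for t
    using martingale_integrable[OF X that] martingale_integrable[OF Y that] by simp
  fix s t A assume st: "0 \<le> s" "s \<le> t" "t \<le> T" and A: "A \<in> sets (F s)"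
  then have AM: "A \<in> sets M" using sets_F[of s A] by auto
  have "(\<integral>\<omega>. indicator A \<omega> * (a * X r \<omega> + b * Y r \<omega>) \<partial>M)
      = a * (\<integral>\<omega>. indicator A \<omega> * X r \<omega> \<partial>M) + b * (\<integral>\<omega>. indicator A \<omega> * Y r \<omega> \<partial>M)" if "r \<in> {0..T}" for r
  proof -
    have "(\<integral>\<omega>. indicator A \<omega> * (a * X r \<omega> + b * Y r \<omega>) \<partial>M)
        = (\<integral>\<omega>. a * (indicator A \<omega> * X r \<omega>) + b * (indicator A \<omega> * Y r \<omega>) \<partial>M)"
      by (simp add: algebra_simps)
    then show ?thesis
      using integrable_indicator_mult[OF AM martingale_integrable[OF X that]]
        integrable_indicator_mult[OF AM martingale_integrable[OF Y that]] by simp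
  qed
  then show "(\<integral>\<omega>. indicator A \<omega> * (a * X t \<omega> + b * Y t \<omega>) \<partial>M)
      = (\<integral>\<omega>. indicator A \<omega> * (a * X s \<omega> + b * Y s \<omega>) \<partial>M)"
    using martingale_integral_eq[OF X st A] martingale_integral_eq[OF Y st A] st by simp
qed

lemma local_martingale_lincomb:
  assumes X: "local_martingale M F T X" and Y: "local_martingale M F T Y"
  shows "local_martingale M F T (\<lambda>t \<omega>. a * X t \<omega> + b * Y t \<omega>)"
proof -
  let ?G = "\<lambda>t. F (max 0 (min t T))"
  obtain \<sigma> :: "nat \<Rightarrow> 'a \<Rightarrow> real" where \<sigma>: "\<And>n. stopping_time ?G (\<sigma> n)"
    "\<And>n \<omega>. \<omega> \<in> space M \<Longrightarrow> \<sigma> n \<omega> \<in> {0..T}" "\<And>n \<omega>. \<omega> \<in> space M \<Longrightarrow> \<sigma> n \<omega> \<le> \<sigma> (Suc n) \<omega>"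
    "AE \<omega> in M. \<exists>n. \<sigma> n \<omega> = T" "\<And>n. martingale M F T (\<lambda>t \<omega>. X (min t (\<sigma> n \<omega>)) \<omega> - X 0 \<omega>)"
    using X unfolding local_martingale_def by blast
  obtain \<tau> :: "nat \<Rightarrow> 'a \<Rightarrow> real" where \<tau>: "\<And>n. stopping_time ?G (\<tau> n)"
    "\<And>n \<omega>. \<omega> \<in> space M \<Longrightarrow> \<tau> n \<omega> \<in> {0..T}" "\<And>n \<omega>. \<omega> \<in> space M \<Longrightarrow> \<tau> n \<omega> \<le> \<tau> (Suc n) \<omega>"
    "AE \<omega> in M. \<exists>n. \<tau> n \<omega> = T" "\<And>n. martingale M F T (\<lambda>t \<omega>. Y (min t (\<tau> n \<omega>)) \<omega> - Y 0 \<omega>)"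
    using Y unfolding local_martingale_def by blast
  have ac: "adapted F T X" "cadlag_process M T X" "adapted F T Y" "cadlag_process M T Y"
    using X Y by (auto simp: local_martingale_def)
  define \<rho> where "\<rho> n \<omega> = min (\<sigma> n \<omega>) (\<tau> n \<omega>)" for n \<omega>
  have \<rho>: "stopping_time ?G (\<rho> n)" "\<omega> \<in> space M \<Longrightarrow> \<rho> n \<omega> \<in> {0..T}" for n \<omega>
    unfolding \<rho>_def using stopping_time_min[OF \<sigma>(1) \<tau>(1)] \<sigma>(2)[of \<omega> n] \<tau>(2)[of \<omega> n] by auto
  have cad: "cadlag_process M T (\<lambda>t \<omega>. Z (min t (\<kappa> \<omega>)) \<omega> - Z 0 \<omega>)"
    if "cadlag_process M T Z" "\<And>\<omega>. \<omega> \<in> space M \<Longrightarrow> \<kappa> \<omega> \<in> {0..T}" for Z :: "real \<Rightarrow> 'a \<Rightarrow> real" and \<kappa>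
    unfolding cadlag_process_def min.commute[of _ "\<kappa> _"]
    by (intro ballI cadlag_on_diff cadlag_on_const cadlag_on_stopped cadlag_processD[OF that(1)] that(2))
  \<comment> \<open>Stopping at the given time and then at the smaller \<open>\<rho> n\<close> is
    stopping at \<open>\<rho> n\<close>, so \<open>stopped_martingale\<close> passes from either
    localizing sequence to the common one.\<close>
  have min\<rho>: "min (min t (\<rho> n \<omega>)) (\<sigma> n \<omega>) = min t (\<rho> n \<omega>)"
    "min (min t (\<rho> n \<omega>)) (\<tau> n \<omega>) = min t (\<rho> n \<omega>)" for t n \<omega>
    by (auto simp: \<rho>_def min_def)
  have "martingale M F T (\<lambda>t \<omega>. a * (X (min t (\<rho> n \<omega>)) \<omega> - X 0 \<omega>) + b * (Y (min t (\<rho> n \<omega>)) \<omega> - Y 0 \<omega>))" for n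
  proof (rule martingale_lincomb)
    have "martingale M F T (\<lambda>t \<omega>. X (min (min t (\<rho> n \<omega>)) (\<sigma> n \<omega>)) \<omega> - X 0 \<omega>)"
      by (rule stopped_martingale[OF \<sigma>(5) cad[OF ac(2) \<sigma>(2)] \<rho>])
    then show "martingale M F T (\<lambda>t \<omega>. X (min t (\<rho> n \<omega>)) \<omega> - X 0 \<omega>)" by (simp only: min\<rho>)
    have "martingale M F T (\<lambda>t \<omega>. Y (min (min t (\<rho> n \<omega>)) (\<tau> n \<omega>)) \<omega> - Y 0 \<omega>)"
      by (rule stopped_martingale[OF \<tau>(5) cad[OF ac(4) \<tau>(2)] \<rho>])
    then show "martingale M F T (\<lambda>t \<omega>. Y (min t (\<rho> n \<omega>)) \<omega> - Y 0 \<omega>)" by (simp only: min\<rho>)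
  qed
  then have mart: "martingale M F T (\<lambda>t \<omega>. a * X (min t (\<rho> n \<omega>)) \<omega> + b * Y (min t (\<rho> n \<omega>)) \<omega> - (a * X 0 \<omega> + b * Y 0 \<omega>))" for n
    by (simp add: algebra_simps)
  have mono: "Z n \<omega> \<le> Z m \<omega>" if "\<omega> \<in> space M" "n \<le> m" "\<And>n \<omega>. \<omega> \<in> space M \<Longrightarrow> Z n \<omega> \<le> Z (Suc n) \<omega>"
    for Z :: "nat \<Rightarrow> 'a \<Rightarrow> real" and n m \<omega>
    using that(3)[OF that(1)] by (rule lift_Suc_mono_le[OF _ that(2)])
  have reach: "AE \<omega> in M. \<exists>n. \<rho> n \<omega> = T"
    using \<sigma>(4) \<tau>(4) AE_space
  proof eventually_elim
    case (elim \<omega>)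
    then obtain n m where nm: "\<sigma> n \<omega> = T" "\<tau> m \<omega> = T" by auto
    \<comment> \<open>Both sequences are nondecreasing and bounded by \<open>T\<close>, so at the
      larger index both have reached \<open>T\<close>.\<close>
    have "T \<le> \<sigma> (max n m) \<omega>" "T \<le> \<tau> (max n m) \<omega>"
      using mono[of \<omega> n "max n m" \<sigma>, OF elim(3) _ \<sigma>(3)]
        mono[of \<omega> m "max n m" \<tau>, OF elim(3) _ \<tau>(3)] nm by auto
    then have "\<rho> (max n m) \<omega> = T"
      using \<sigma>(2)[OF elim(3), of "max n m"] by (auto simp: \<rho>_def min_def)
    then show ?case ..
  qed
  show ?thesis unfolding local_martingale_def
  proof (intro conjI exI[of _ \<rho>] allI ballI adapted_lincomb cadlag_process_lincomb ac \<rho>(1) reach mart)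
    fix n \<omega> assume \<omega>: "\<omega> \<in> space M"
    show "\<rho> n \<omega> \<in> {0..T}" by (rule \<rho>(2)[OF \<omega>])
    show "\<rho> n \<omega> \<le> \<rho> (Suc n) \<omega>" unfolding \<rho>_def by (intro min.mono \<sigma>(3) \<tau>(3) \<omega>)
  qed
qed

lemma finite_variation_on_lincomb:
  assumes "finite_variation_on T f" "finite_variation_on T g"
  shows "finite_variation_on T (\<lambda>t. a * f t + b * g t)"
proof -
  obtain K where K: "\<And>k p. is_partition T k p \<Longrightarrow> (\<Sum>i<k. \<bar>f (p (Suc i)) - f (p i)\<bar>) \<le> K"
    using assms(1) unfolding finite_variation_on_def bdd_above_def by blast
  obtain L where L: "\<And>k p. is_partition T k p \<Longrightarrow> (\<Sum>i<k. \<bar>g (p (Suc i)) - g (p i)\<bar>) \<le> L"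
    using assms(2) unfolding finite_variation_on_def bdd_above_def by blast
  have "(\<Sum>i<k. \<bar>(a * f (p (Suc i)) + b * g (p (Suc i))) - (a * f (p i) + b * g (p i))\<bar>) \<le> \<bar>a\<bar> * K + \<bar>b\<bar> * L"
    if p: "is_partition T k p" for k p
  proof -
    have "(\<Sum>i<k. \<bar>(a * f (p (Suc i)) + b * g (p (Suc i))) - (a * f (p i) + b * g (p i))\<bar>)
        \<le> (\<Sum>i<k. \<bar>a\<bar> * \<bar>f (p (Suc i)) - f (p i)\<bar> + \<bar>b\<bar> * \<bar>g (p (Suc i)) - g (p i)\<bar>)"
    proof (rule sum_mono)
      fix i
      have "(a * f (p (Suc i)) + b * g (p (Suc i))) - (a * f (p i) + b * g (p i))
          = a * (f (p (Suc i)) - f (p i)) + b * (g (p (Suc i)) - g (p i))"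
        by (simp add: algebra_simps)
      then show "\<bar>(a * f (p (Suc i)) + b * g (p (Suc i))) - (a * f (p i) + b * g (p i))\<bar>
          \<le> \<bar>a\<bar> * \<bar>f (p (Suc i)) - f (p i)\<bar> + \<bar>b\<bar> * \<bar>g (p (Suc i)) - g (p i)\<bar>"
        by (metis abs_mult abs_triangle_ineq)
    qed
    also have "\<dots> = \<bar>a\<bar> * (\<Sum>i<k. \<bar>f (p (Suc i)) - f (p i)\<bar>) + \<bar>b\<bar> * (\<Sum>i<k. \<bar>g (p (Suc i)) - g (p i)\<bar>)"
      by (simp add: sum.distrib sum_distrib_left)
    also have "\<dots> \<le> \<bar>a\<bar> * K + \<bar>b\<bar> * L"
      by (intro add_mono mult_left_mono K L p) auto
    finally show ?thesis .
  qed
  then show ?thesis unfolding finite_variation_on_def bdd_above_def by blast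
qed

lemma semimartingale_lincomb:
  assumes X: "semimartingale M F T X" and Y: "semimartingale M F T Y"
  shows "semimartingale M F T (\<lambda>t \<omega>. a * X t \<omega> + b * Y t \<omega>)"
proof -
  obtain N A where NA: "local_martingale M F T N" "finite_variation_process M F T A"
    "AE \<omega> in M. \<forall>t\<in>{0..T}. X t \<omega> = N t \<omega> + A t \<omega>"
    using X unfolding semimartingale_def by blast
  obtain N' A' where NA': "local_martingale M F T N'" "finite_variation_process M F T A'"
    "AE \<omega> in M. \<forall>t\<in>{0..T}. Y t \<omega> = N' t \<omega> + A' t \<omega>"
    using Y unfolding semimartingale_def by blast
  have "finite_variation_process M F T (\<lambda>t \<omega>. a * A t \<omega> + b * A' t \<omega>)"
    using NA(2) NA'(2) unfolding finite_variation_process_def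
    by (auto intro: adapted_lincomb cadlag_process_lincomb finite_variation_on_lincomb)
  moreover have "AE \<omega> in M. \<forall>t\<in>{0..T}. a * X t \<omega> + b * Y t \<omega>
      = (a * N t \<omega> + b * N' t \<omega>) + (a * A t \<omega> + b * A' t \<omega>)"
    using NA(3) NA'(3) by eventually_elim (simp add: algebra_simps)
  ultimately show ?thesis
    using X Y local_martingale_lincomb[OF NA(1) NA'(1), of a b] unfolding semimartingale_def
    by (blast intro: adapted_lincomb cadlag_process_lincomb)
qed

section \<open>Square integrability of the running supremum, and strategies as an affine
  space\<close>

lemma sup_square_measurable:
  assumes X: "adapted F T X" "cadlag_process M T X"
  shows "(\<lambda>\<omega>. SUP t\<in>{0..T}. ennreal ((X t \<omega>)\<^sup>2)) \<in> borel_measurable M"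
proof -
  note sub = dense_times_subset[OF less_imp_le[OF T_pos]]
  have "(SUP t\<in>{0..T}. ennreal ((X t \<omega>)\<^sup>2)) = (SUP t\<in>dense_times T. ennreal ((X t \<omega>)\<^sup>2))"
    if \<omega>: "\<omega> \<in> space M" for \<omega>
  proof (rule antisym)
    show "(SUP t\<in>{0..T}. ennreal ((X t \<omega>)\<^sup>2)) \<le> (SUP t\<in>dense_times T. ennreal ((X t \<omega>)\<^sup>2))"
    proof (rule SUP_least, rule ccontr)
      fix t assume t: "t \<in> {0..T}"
        and less: "\<not> ennreal ((X t \<omega>)\<^sup>2) \<le> (SUP t\<in>dense_times T. ennreal ((X t \<omega>)\<^sup>2))"
      define c where "c = (SUP t\<in>dense_times T. ennreal ((X t \<omega>)\<^sup>2))"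
      have "open {x :: real. c < ennreal (x\<^sup>2)}"
        by (intro open_Collect_less continuous_on_const continuous_on_ennreal continuous_intros)
      then have "\<exists>s\<in>dense_times T. X s \<omega> \<in> {x. c < ennreal (x\<^sup>2)}"
        by (rule cadlag_on_dense_times[OF cadlag_processD[OF X(2) \<omega>] _ t])
           (use less in \<open>simp add: c_def not_le\<close>)
      then obtain s where "s \<in> dense_times T" "c < ennreal ((X s \<omega>)\<^sup>2)" by auto
      moreover from this(1) have "ennreal ((X s \<omega>)\<^sup>2) \<le> c" unfolding c_def by (rule SUP_upper)
      ultimately show False by simp
    qed
  qed (rule SUP_subset_mono[OF sub order_refl])
  moreover have "(\<lambda>\<omega>. SUP t\<in>dense_times T. ennreal ((X t \<omega>)\<^sup>2)) \<in> borel_measurable M"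
  proof (rule borel_measurable_SUP[OF countable_dense_times])
    fix t assume "t \<in> dense_times T"
    then have [measurable]: "X t \<in> borel_measurable M" using adapted_measurable[OF X(1)] sub by auto
    show "(\<lambda>\<omega>. ennreal ((X t \<omega>)\<^sup>2)) \<in> borel_measurable M" by measurable
  qed
  ultimately show ?thesis by (simp cong: measurable_cong)
qed

lemma sup_square_lincomb:
  assumes X: "adapted F T X" "cadlag_process M T X" "(\<integral>\<^sup>+ \<omega>. (SUP t\<in>{0..T}. ennreal ((X t \<omega>)\<^sup>2)) \<partial>M) < \<infinity>"
    and Y: "adapted F T Y" "cadlag_process M T Y" "(\<integral>\<^sup>+ \<omega>. (SUP t\<in>{0..T}. ennreal ((Y t \<omega>)\<^sup>2)) \<partial>M) < \<infinity>"
  shows "(\<integral>\<^sup>+ \<omega>. (SUP t\<in>{0..T}. ennreal ((a * X t \<omega> + b * Y t \<omega>)\<^sup>2)) \<partial>M) < \<infinity>"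
proof -
  note [measurable] = sup_square_measurable[OF X(1,2)] sup_square_measurable[OF Y(1,2)]
  let ?S = "\<lambda>X \<omega>. SUP t\<in>{0..T}. ennreal ((X t \<omega>)\<^sup>2)"
  have "(\<integral>\<^sup>+ \<omega>. ?S (\<lambda>t \<omega>. a * X t \<omega> + b * Y t \<omega>) \<omega> \<partial>M)
      \<le> (\<integral>\<^sup>+ \<omega>. ennreal (2 * a\<^sup>2) * ?S X \<omega> + ennreal (2 * b\<^sup>2) * ?S Y \<omega> \<partial>M)"
  proof (rule nn_integral_mono, rule SUP_least)
    fix \<omega> t assume t: "t \<in> {0..T}"
    have "(a * X t \<omega> + b * Y t \<omega>)\<^sup>2 \<le> 2 * a\<^sup>2 * (X t \<omega>)\<^sup>2 + 2 * b\<^sup>2 * (Y t \<omega>)\<^sup>2"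
      using zero_le_power2[of "a * X t \<omega> - b * Y t \<omega>"] by (simp add: power2_eq_square algebra_simps)
    then have "ennreal ((a * X t \<omega> + b * Y t \<omega>)\<^sup>2) \<le> ennreal (2 * a\<^sup>2 * (X t \<omega>)\<^sup>2 + 2 * b\<^sup>2 * (Y t \<omega>)\<^sup>2)"
      by (rule ennreal_leI)
    also have "\<dots> = ennreal (2 * a\<^sup>2) * ennreal ((X t \<omega>)\<^sup>2) + ennreal (2 * b\<^sup>2) * ennreal ((Y t \<omega>)\<^sup>2)"
      by (simp add: ennreal_plus ennreal_mult)
    also have "\<dots> \<le> ennreal (2 * a\<^sup>2) * ?S X \<omega> + ennreal (2 * b\<^sup>2) * ?S Y \<omega>"
      by (intro add_mono mult_left_mono SUP_upper t) auto
    finally show "ennreal ((a * X t \<omega> + b * Y t \<omega>)\<^sup>2) \<le> ennreal (2 * a\<^sup>2) * ?S X \<omega> + ennreal (2 * b\<^sup>2) * ?S Y \<omega>" .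
  qed
  also have "\<dots> = ennreal (2 * a\<^sup>2) * (\<integral>\<^sup>+ \<omega>. ?S X \<omega> \<partial>M) + ennreal (2 * b\<^sup>2) * (\<integral>\<^sup>+ \<omega>. ?S Y \<omega> \<partial>M)"
    by (simp add: nn_integral_add nn_integral_cmult)
  also have "\<dots> < \<infinity>" using X(3) Y(3) by (auto simp: ennreal_mult_less_top ennreal_add_eq_top less_top)
  finally show ?thesis .
qed

text \<open>Later integrability proofs need a real-valued majorant. The supremum may be infinite on
  a null set, where \<open>enn2real\<close> returns 0, so the bound holds only almost
  surely.\<close>

lemma sup_square_dominated:
  assumes X: "adapted F T X" "cadlag_process M T X" "(\<integral>\<^sup>+ \<omega>. (SUP t\<in>{0..T}. ennreal ((X t \<omega>)\<^sup>2)) \<partial>M) < \<infinity>"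
  obtains S where "integrable M S" "AE \<omega> in M. \<forall>t\<in>{0..T}. (X t \<omega>)\<^sup>2 \<le> S \<omega>"
proof -
  define S where "S \<omega> = (SUP t\<in>{0..T}. ennreal ((X t \<omega>)\<^sup>2))" for \<omega>
  have [measurable]: "S \<in> borel_measurable M"
    using sup_square_measurable[OF X(1,2)] by (simp add: S_def[abs_def])
  have S: "(\<integral>\<^sup>+ \<omega>. S \<omega> \<partial>M) < \<infinity>" using X(3) by (simp add: S_def)
  have fin: "AE \<omega> in M. S \<omega> \<noteq> \<infinity>"
    by (rule nn_integral_PInf_AE) (use S in auto)
  show ?thesis
  proof
    show "integrable M (\<lambda>\<omega>. enn2real (S \<omega>))"
    proof (rule integrableI_bounded)
      have "(\<integral>\<^sup>+ \<omega>. ennreal (norm (enn2real (S \<omega>))) \<partial>M) \<le> (\<integral>\<^sup>+ \<omega>. S \<omega> \<partial>M)"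
        using fin by (intro nn_integral_mono_AE, eventually_elim) (simp add: less_top)
      then show "(\<integral>\<^sup>+ \<omega>. ennreal (norm (enn2real (S \<omega>))) \<partial>M) < \<infinity>" using S by auto
    qed measurable
    show "AE \<omega> in M. \<forall>t\<in>{0..T}. (X t \<omega>)\<^sup>2 \<le> enn2real (S \<omega>)"
      using fin
    proof eventually_elim
      case (elim \<omega>)
      show ?case
      proof
        fix t assume "t \<in> {0..T}"
        then have "ennreal ((X t \<omega>)\<^sup>2) \<le> S \<omega>" unfolding S_def by (rule SUP_upper)
        then have "enn2real (ennreal ((X t \<omega>)\<^sup>2)) \<le> enn2real (S \<omega>)"
          using elim by (intro enn2real_mono) (auto simp: less_top)
        then show "(X t \<omega>)\<^sup>2 \<le> enn2real (S \<omega>)" by simp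
      qed
    qed
  qed
qed

lemma strategiesD:
  assumes "Q \<in> strategies M F T XiT"
  shows "adapted F T Q" "cadlag_process M T Q"
    "(\<integral>\<^sup>+ \<omega>. (SUP t\<in>{0..T}. ennreal ((Q t \<omega>)\<^sup>2)) \<partial>M) < \<infinity>" "AE \<omega> in M. Q T \<omega> = Xi M F XiT T \<omega>"
  using assms by (auto simp: strategies_def semimartingale_def)

text \<open>The weights may be negative, since the terminal condition asks only for the sum 1.
  Points of the line outside the segment between two strategies are thus admissible competitors as
  well.\<close>

lemma strategies_affine:
  assumes Q: "Q \<in> strategies M F T XiT" "Q' \<in> strategies M F T XiT" and ab: "a + b = 1"
  shows "(\<lambda>t \<omega>. a * Q t \<omega> + b * Q' t \<omega>) \<in> strategies M F T XiT"
proof -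
  have "semimartingale M F T (\<lambda>t \<omega>. a * Q t \<omega> + b * Q' t \<omega>)"
    using Q by (intro semimartingale_lincomb) (auto simp: strategies_def)
  moreover have "AE \<omega> in M. a * Q T \<omega> + b * Q' T \<omega> = Xi M F XiT T \<omega>"
    using strategiesD(4)[OF Q(1)] strategiesD(4)[OF Q(2)]
    by eventually_elim (simp add: distrib_right[symmetric] ab)
  ultimately show ?thesis
    using sup_square_lincomb[OF strategiesD(1-3)[OF Q(1)] strategiesD(1-3)[OF Q(2)]]
    by (simp add: strategies_def)
qed

end

section \<open>The cost functional\<close>

text \<open>\<open>real_of_ereal\<close> sends infinite values to 0. Boundedness of the path and
  positivity of \<open>T\<close> exclude both infinities, so \<open>Linf_norm\<close> is the actual
  essential supremum.\<close>

lemma cadlag_Linf_norm: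
  assumes f: "cadlag_on T f" and T: "0 < T"
  shows "AE t in lborel. t \<in> {0<..<T} \<longrightarrow> \<bar>f t\<bar> \<le> Linf_norm T f" and "0 \<le> Linf_norm T f"
proof -
  define R where "R = restrict_space lborel {0<..<T}"
  obtain K where K: "\<And>t. t \<in> {0..T} \<Longrightarrow> \<bar>f t\<bar> \<le> K"
    using cadlag_on_bounded[OF f less_imp_le[OF T]] by blast
  have "f \<in> borel_measurable R"
    unfolding R_def
  proof (subst borel_measurable_restrict_space_iff)
    have "set_borel_measurable lborel {0<..<T} f"
      by (rule cadlag_on_set_borel_measurable[OF f less_imp_le[OF T]]) auto
    then show "(\<lambda>t. indicator {0<..<T} t *\<^sub>R f t) \<in> borel_measurable lborel"
      by (simp only: set_borel_measurable_def)
  qed simp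
  then have m: "(\<lambda>t. ereal \<bar>f t\<bar>) \<in> borel_measurable R" by measurable
  \<comment> \<open>Over a null space the essential supremum would be minus infinity; the nontrivial
    filter supplies a point that shows \<open>0 \<le> s\<close>.\<close>
  have R0: "ae_filter R \<noteq> bot"
    using T by (simp add: R_def ae_filter_eq_bot_iff space_restrict_space emeasure_restrict_space)
  define s where "s = esssup R (\<lambda>t. ereal \<bar>f t\<bar>)"
  have AE_s: "AE t in R. ereal \<bar>f t\<bar> \<le> s" unfolding s_def by (rule esssup_AE)
  have "s \<le> ereal K" unfolding s_def
    by (rule esssup_I[OF m]) (auto simp: R_def space_restrict_space intro!: AE_I2 K)
  moreover have "0 \<le> s"
  proof -
    obtain t where "ereal \<bar>f t\<bar> \<le> s" using eventually_happens'[OF R0 AE_s] by blast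
    moreover have "0 \<le> ereal \<bar>f t\<bar>" by simp
    ultimately show ?thesis by (rule order_trans[rotated])
  qed
  ultimately obtain r where r: "s = ereal r" "0 \<le> r" by (cases s) auto
  have L: "Linf_norm T f = r" using r by (simp add: Linf_norm_def s_def R_def)
  show "0 \<le> Linf_norm T f" using r L by simp
  show "AE t in lborel. t \<in> {0<..<T} \<longrightarrow> \<bar>f t\<bar> \<le> Linf_norm T f"
  proof -
    have "AE t in restrict_space lborel {0<..<T}. \<bar>f t\<bar> \<le> r" using AE_s unfolding r(1) R_def by simp
    then show ?thesis unfolding L by (subst (asm) AE_restrict_space_iff) auto
  qed
qed

lemma AE_Icc_of_Ioo:
  assumes "AE t in lborel. t \<in> {0<..<T} \<longrightarrow> P t"
  shows "AE t\<in>{0..T} in lborel. P (t :: real)"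
  using assms AE_lborel_singleton[of 0] AE_lborel_singleton[of T]
  by eventually_elim (auto simp: order_le_less)

lemma cadlag_cauchy_schwarz:
  assumes q: "cadlag_on T q" and t: "t \<in> {0..T}"
  shows "(LBINT s:{0..t}. \<bar>q s\<bar>)\<^sup>2 \<le> t * (LBINT s:{0..t}. (q s)\<^sup>2)"
proof (cases "t = 0")
  case False
  then have t0: "0 < t" using t by auto
  have T: "0 \<le> T" using t by auto
  have i1: "set_integrable lborel {0..t} (\<lambda>s. \<bar>q s\<bar>)"
    by (intro set_integrable_abs cadlag_on_set_integrable[OF q T]) (use t in auto)
  have i2: "set_integrable lborel {0..t} (\<lambda>s. (q s)\<^sup>2)"
    unfolding power2_eq_square
    by (intro cadlag_on_set_integrable[OF cadlag_on_mult[OF q q] T]) (use t in auto)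
  have i0: "set_integrable lborel {0..t} (\<lambda>s. c :: real)" for c
    by (intro borel_integrable_atLeastAtMost' continuous_on_const)
  define I where "I = (LBINT s:{0..t}. \<bar>q s\<bar>)"
  \<comment> \<open>The mean of \<open>\<bar>q s\<bar>\<close>: the integral of the squared
    deviation from it is nonnegative and equals the gap in the inequality divided by
    \<open>t\<close>.\<close>
  define m where "m = I / t"
  have "0 \<le> (LBINT s:{0..t}. (\<bar>q s\<bar> - m)\<^sup>2)"
    unfolding set_lebesgue_integral_def by (intro Bochner_Integration.integral_nonneg) simp
  also have "\<dots> = (LBINT s:{0..t}. (q s)\<^sup>2 + ((- 2 * m) * \<bar>q s\<bar> + m\<^sup>2))"
    by (simp add: power2_diff algebra_simps)
  also have "\<dots> = (LBINT s:{0..t}. (q s)\<^sup>2) + ((- 2 * m) * I + m\<^sup>2 * t)"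
  proof -
    have i3: "set_integrable lborel {0..t} (\<lambda>s. (- 2 * m) * \<bar>q s\<bar>)"
      by (rule set_integrable_mult_right) (rule i1)
    have "(LBINT s:{0..t}. m\<^sup>2) = m\<^sup>2 * t" using t0 by (simp add: set_lebesgue_integral_def)
    moreover have "(LBINT s:{0..t}. (- 2 * m) * \<bar>q s\<bar>) = (- 2 * m) * I"
      unfolding I_def by (rule set_integral_mult_right)
    ultimately show ?thesis
      by (simp only: set_integral_add(2)[OF i2 set_integral_add(1)[OF i3 i0]] set_integral_add(2)[OF i3 i0])
  qed
  also have "\<dots> = (LBINT s:{0..t}. (q s)\<^sup>2) - I\<^sup>2 / t"
    using t0 by (simp add: m_def power2_eq_square field_simps)
  finally show ?thesis using t0 by (simp add: I_def field_simps)
qed (simp add: LBINT_singleton)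

text \<open>The squared norm for a fixed scenario; its expectation is
  \<open>norm_H_sq\<close>.\<close>

definition path_norm ::
  "real \<Rightarrow> (real \<Rightarrow> real) \<Rightarrow> (real \<Rightarrow> real) \<Rightarrow> (real \<Rightarrow> real) \<Rightarrow> (real \<Rightarrow> real) \<Rightarrow> real" where
  "path_norm T \<beta> lam lam' u = (LBINT t:{0..T}. (2 * \<beta> t + lam' t / lam t) / (2 * lam t) * u t * u t)
     + 1 / (2 * lam T) * u T * u T"

section \<open>The weighted norm of a single impact path\<close>

context impact_coefficients
begin

abbreviation "pnorm \<equiv> path_norm T \<beta> lam lam'"
abbreviation "ipath \<equiv> impact_path \<beta> lam lam'"

lemma lam_inverse_cadlag: "cadlag_on T (\<lambda>t. inverse (lam t))"
  by (intro cadlag_on_continuous continuous_on_inverse lam_continuous) (auto dest: lam_pos)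

lemma coefficient_cadlag:
  "cadlag_on T (\<lambda>t. \<beta> t + lam' t / lam t)"
  "cadlag_on T (\<lambda>t. (2 * \<beta> t + lam' t / lam t) / lam t)"
  "cadlag_on T (\<lambda>t. (2 * \<beta> t + lam' t / lam t) / (2 * lam t))"
proof -
  have 1: "cadlag_on T (\<lambda>t. (2 * \<beta> t + lam' t / lam t) / lam t)"
    unfolding divide_inverse
    by (intro cadlag_on_mult cadlag_on_add cadlag_on_const beta_cadlag lam'_cadlag lam_inverse_cadlag)
  then show "cadlag_on T (\<lambda>t. (2 * \<beta> t + lam' t / lam t) / lam t)" .
  show "cadlag_on T (\<lambda>t. \<beta> t + lam' t / lam t)"
    unfolding divide_inverse by (intro cadlag_on_mult cadlag_on_add beta_cadlag lam'_cadlag lam_inverse_cadlag)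
  show "cadlag_on T (\<lambda>t. (2 * \<beta> t + lam' t / lam t) / (2 * lam t))"
    using cadlag_on_cmult[OF 1, of "1 / 2"] by simp
qed

lemma weight_nonneg: "t \<in> {0..T} \<Longrightarrow> 0 \<le> (2 * \<beta> t + lam' t / lam t) / (2 * lam t)"
proof -
  assume t: "t \<in> {0..T}"
  obtain c where "0 < c" "\<forall>t\<in>{0..T}. c < 2 * \<beta> t + lam' t / lam t"
    using coefficients unfolding coefficient_assms_def by blast
  then have "0 < 2 * \<beta> t + lam' t / lam t" using t by force
  then show ?thesis using lam_pos[OF t] by simp
qed

lemma path_norm_integrable:
  "cadlag_on T u \<Longrightarrow> cadlag_on T v \<Longrightarrow>
    set_integrable lborel {0..T} (\<lambda>t. (2 * \<beta> t + lam' t / lam t) / (2 * lam t) * u t * v t)"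
  by (intro cadlag_on_set_integrable[OF _ T_nonneg] cadlag_on_mult coefficient_cadlag) auto

lemma path_norm_nonneg: "0 \<le> pnorm u"
proof -
  have "0 \<le> (LBINT t:{0..T}. (2 * \<beta> t + lam' t / lam t) / (2 * lam t) * u t * u t)"
    unfolding set_lebesgue_integral_def
  proof (rule Bochner_Integration.integral_nonneg)
    show "0 \<le> indicator {0..T} t *\<^sub>R ((2 * \<beta> t + lam' t / lam t) / (2 * lam t) * u t * u t)" for t
    proof (cases "t \<in> {0..T}")
      case True
      have "0 \<le> (2 * \<beta> t + lam' t / lam t) / (2 * lam t) * (u t * u t)"
        by (intro mult_nonneg_nonneg weight_nonneg[OF True] zero_le_square)
      then show ?thesis using True by (simp only: indicator_simps scaleR_one mult.assoc)
    qed (simp only: indicator_simps scaleR_zero_left order_refl not_False_eq_True)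
  qed
  moreover have "0 \<le> 1 / (2 * lam T) * u T * u T"
    unfolding mult.assoc using lam_pos[of T] T_nonneg by (intro mult_nonneg_nonneg[OF _ zero_le_square]) auto
  ultimately show ?thesis unfolding path_norm_def by (rule add_nonneg_nonneg)
qed

lemma path_norm_cong: "(\<And>t. t \<in> {0..T} \<Longrightarrow> u t = v t) \<Longrightarrow> pnorm u = pnorm v"
  unfolding path_norm_def using T_nonneg
  by (intro arg_cong2[where f = "(+)"] set_lebesgue_integral_cong) auto

text \<open>The interpolation identity of a quadratic form, valid for every real \<open>s\<close>.
  The coefficient \<open>s\<^sup>2 - s\<close> of the norm of the difference is negative inside (0,
  1) and positive outside [0, 1].\<close>

lemma path_norm_interpolate:
  assumes u: "cadlag_on T u" and v: "cadlag_on T v"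
  shows "pnorm (\<lambda>t. (1 - s) * u t + s * v t)
    = (1 - s) * pnorm u + s * pnorm v + (s\<^sup>2 - s) * pnorm (\<lambda>t. v t - u t)"
proof -
  let ?w = "\<lambda>t. (2 * \<beta> t + lam' t / lam t) / (2 * lam t)"
  have i: "set_integrable lborel {0..T} (\<lambda>t. ?w t * u t * u t)"
    "set_integrable lborel {0..T} (\<lambda>t. ?w t * v t * v t)"
    "set_integrable lborel {0..T} (\<lambda>t. ?w t * (v t - u t) * (v t - u t))"
    by (intro path_norm_integrable u v cadlag_on_diff)+
  have eq: "w * ((1 - s) * a + s * b) * ((1 - s) * a + s * b)
      = (1 - s) * (w * a * a) + (s * (w * b * b) + (s\<^sup>2 - s) * (w * (b - a) * (b - a)))" for w a b :: real
    by (simp add: power2_eq_square algebra_simps)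
  have "(LBINT t:{0..T}. ?w t * ((1 - s) * u t + s * v t) * ((1 - s) * u t + s * v t))
      = (1 - s) * (LBINT t:{0..T}. ?w t * u t * u t) + (s * (LBINT t:{0..T}. ?w t * v t * v t)
        + (s\<^sup>2 - s) * (LBINT t:{0..T}. ?w t * (v t - u t) * (v t - u t)))"
    unfolding eq using i
    by (simp add: set_integral_add(2) set_integral_add(1) del: times_divide_eq_left times_divide_eq_right)
  then show ?thesis
    unfolding path_norm_def eq by (simp add: distrib_left del: times_divide_eq_left times_divide_eq_right)
qed

lemma C_H_sq_nonneg: "0 \<le> C_H_sq T \<beta> lam lam'"
proof -
  have "0 \<le> 1 / lam T" using lam_pos[of T] T_nonneg by simp
  then show ?thesis unfolding C_H_sq_def by (simp add: le_max_iff_disj)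
qed

text \<open>The norm weights time by half of the quotient inside \<open>Linf_norm\<close> and the
  terminal value by half of \<open>1 / lam T\<close>; \<open>C_H_sq\<close> is the larger of the two
  bounds.\<close>

lemma path_norm_le:
  assumes u: "cadlag_on T u"
  shows "pnorm u \<le> C_H_sq T \<beta> lam lam' * ((LBINT t:{0..T}. (u t)\<^sup>2) + (u T)\<^sup>2)"
proof -
  let ?C = "C_H_sq T \<beta> lam lam'" and ?g = "\<lambda>t. (2 * \<beta> t + lam' t / lam t) / lam t"
  have i: "set_integrable lborel {0..T} (\<lambda>t. (u t)\<^sup>2)"
    unfolding power2_eq_square by (intro cadlag_on_set_integrable[OF cadlag_on_mult[OF u u] T_nonneg]) auto
  have "(LBINT t:{0..T}. (2 * \<beta> t + lam' t / lam t) / (2 * lam t) * u t * u t) \<le> (LBINT t:{0..T}. ?C * (u t)\<^sup>2)"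
  proof (rule set_integral_mono_AE)
    show "set_integrable lborel {0..T} (\<lambda>t. (2 * \<beta> t + lam' t / lam t) / (2 * lam t) * u t * u t)"
      by (rule path_norm_integrable[OF u u])
    show "set_integrable lborel {0..T} (\<lambda>t. ?C * (u t)\<^sup>2)"
      by (intro set_integrable_mult_right impI i)
    show "AE t\<in>{0..T} in lborel. (2 * \<beta> t + lam' t / lam t) / (2 * lam t) * u t * u t \<le> ?C * (u t)\<^sup>2"
      using AE_Icc_of_Ioo[OF cadlag_Linf_norm(1)[OF coefficient_cadlag(2) T_pos]]
    proof (eventually_elim, intro impI)
      fix t assume *: "t \<in> {0..T} \<longrightarrow> \<bar>?g t\<bar> \<le> Linf_norm T ?g" and t: "t \<in> {0..T}"
      have "(2 * \<beta> t + lam' t / lam t) / (2 * lam t) = 1 / 2 * ?g t" by simp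
      also have "\<dots> \<le> 1 / 2 * max (Linf_norm T ?g) (1 / lam T)"
        by (rule mult_left_mono[OF order_trans[OF abs_ge_self order_trans[OF mp[OF * t] max.cobounded1]]]) simp
      finally have "(2 * \<beta> t + lam' t / lam t) / (2 * lam t) \<le> ?C" unfolding C_H_sq_def .
      then show "(2 * \<beta> t + lam' t / lam t) / (2 * lam t) * u t * u t \<le> ?C * (u t)\<^sup>2"
        unfolding power2_eq_square mult.assoc by (rule mult_right_mono) simp
    qed
  qed
  also have "\<dots> = ?C * (LBINT t:{0..T}. (u t)\<^sup>2)" by (rule set_integral_mult_right)
  finally have 1: "(LBINT t:{0..T}. (2 * \<beta> t + lam' t / lam t) / (2 * lam t) * u t * u t)
    \<le> ?C * (LBINT t:{0..T}. (u t)\<^sup>2)" .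
  have "1 / (2 * lam T) = 1 / 2 * (1 / lam T)" by simp
  also have "\<dots> \<le> ?C" unfolding C_H_sq_def by (rule mult_left_mono[OF max.cobounded2]) simp
  finally have "1 / (2 * lam T) * (u T * u T) \<le> ?C * (u T)\<^sup>2"
    unfolding power2_eq_square by (rule mult_right_mono) simp
  then show ?thesis using 1 unfolding path_norm_def distrib_left mult.assoc by linarith
qed

text \<open>What remains after \<open>lam t * q t\<close> is an integral with the factor
  \<open>exp (B s - B t)\<close>, at most 1 because \<open>\<beta>\<close> is positive. Writing
  \<open>\<beta> * lam + lam'\<close> as \<open>lam * (\<beta> + lam' / lam)\<close> brings in the
  two norms, and Cauchy-Schwarz on [0, t] gives the factor \<open>t\<close>.\<close>

lemma impact_path_zero_remainder:
  assumes q: "cadlag_on T q" and t: "t \<in> {0..T}"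
  shows "(ipath 0 q t - lam t * q t)\<^sup>2
    \<le> (Linf_norm T lam * Linf_norm T (\<lambda>t. \<beta> t + lam' t / lam t))\<^sup>2 * (t * (LBINT s:{0..T}. (q s)\<^sup>2))"
proof -
  define B where "B t = (LBINT s:{0..t}. \<beta> s)" for t
  define D where "D = Linf_norm T lam * Linf_norm T (\<lambda>t. \<beta> t + lam' t / lam t)"
  have L0: "0 \<le> Linf_norm T lam" by (rule cadlag_Linf_norm(2)[OF lam_cadlag T_pos])
  have B_mono: "B s \<le> B t" if "s \<in> {0..t}" for s
  proof -
    have "B t = B s + (LBINT r:{s..t}. \<beta> r)"
      unfolding B_def using that t
      by (intro set_integral_split cadlag_on_set_integrable[OF beta_cadlag T_nonneg]) auto
    moreover have "0 \<le> (LBINT r:{s..t}. \<beta> r)"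
      unfolding set_lebesgue_integral_def
      using beta_pos that t by (intro Bochner_Integration.integral_nonneg) (auto simp: indicator_def less_imp_le)
    ultimately show ?thesis by simp
  qed
  let ?k = "\<lambda>s. exp (- B t) * (exp (B s) * ((\<beta> s * lam s + lam' s) * q s))"
  have ik: "set_integrable lborel {0..t} ?k"
    unfolding B_def using t
    by (intro cadlag_on_set_integrable[OF cadlag_on_cmult[OF impact_integrand_cadlag[OF q]] T_nonneg]) auto
  have iq: "set_integrable lborel {0..t} (\<lambda>s. D * \<bar>q s\<bar>)"
    using t by (intro set_integrable_mult_right set_integrable_abs cadlag_on_set_integrable[OF q T_nonneg]) auto
  have "ipath 0 q t - lam t * q t = - (LBINT s:{0..t}. ?k s)"
    by (simp add: impact_path_def B_def)
  then have "\<bar>ipath 0 q t - lam t * q t\<bar> \<le> (LBINT s:{0..t}. \<bar>?k s\<bar>)"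
    using set_integral_norm_bound[OF ik] by simp
  also have "\<dots> \<le> (LBINT s:{0..t}. D * \<bar>q s\<bar>)"
  proof (rule set_integral_mono_AE[OF set_integrable_abs[OF ik] iq])
    show "AE s\<in>{0..t} in lborel. \<bar>?k s\<bar> \<le> D * \<bar>q s\<bar>"
      using AE_Icc_of_Ioo[OF cadlag_Linf_norm(1)[OF lam_cadlag T_pos]]
        AE_Icc_of_Ioo[OF cadlag_Linf_norm(1)[OF coefficient_cadlag(1) T_pos]]
    proof (eventually_elim, intro impI)
      fix s assume l: "s \<in> {0..T} \<longrightarrow> \<bar>lam s\<bar> \<le> Linf_norm T lam"
        and a: "s \<in> {0..T} \<longrightarrow> \<bar>\<beta> s + lam' s / lam s\<bar> \<le> Linf_norm T (\<lambda>t. \<beta> t + lam' t / lam t)"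
        and s: "s \<in> {0..t}"
      then have sT: "s \<in> {0..T}" using t by auto
      have "\<beta> s * lam s + lam' s = lam s * (\<beta> s + lam' s / lam s)"
        using lam_pos[OF sT] by (simp add: field_simps)
      then have "\<bar>\<beta> s * lam s + lam' s\<bar> = \<bar>lam s\<bar> * \<bar>\<beta> s + lam' s / lam s\<bar>" by (simp add: abs_mult)
      also have "\<dots> \<le> D" unfolding D_def using l a sT L0 by (intro mult_mono) auto
      finally have 1: "\<bar>\<beta> s * lam s + lam' s\<bar> * \<bar>q s\<bar> \<le> D * \<bar>q s\<bar>" by (rule mult_right_mono) simp
      have "\<bar>?k s\<bar> = (exp (- B t) * exp (B s)) * (\<bar>\<beta> s * lam s + lam' s\<bar> * \<bar>q s\<bar>)"
        by (simp add: abs_mult)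
      also have "\<dots> \<le> 1 * (\<bar>\<beta> s * lam s + lam' s\<bar> * \<bar>q s\<bar>)"
        using B_mono[OF s] by (intro mult_right_mono) (auto simp: exp_add[symmetric])
      finally show "\<bar>?k s\<bar> \<le> D * \<bar>q s\<bar>" using 1 by linarith
    qed
  qed
  also have "\<dots> = D * (LBINT s:{0..t}. \<bar>q s\<bar>)" by simp
  finally have "\<bar>ipath 0 q t - lam t * q t\<bar>\<^sup>2 \<le> (D * (LBINT s:{0..t}. \<bar>q s\<bar>))\<^sup>2"
    by (rule power_mono) simp
  then have "(ipath 0 q t - lam t * q t)\<^sup>2 \<le> D\<^sup>2 * (LBINT s:{0..t}. \<bar>q s\<bar>)\<^sup>2"
    by (simp add: power_mult_distrib)
  also have "\<dots> \<le> D\<^sup>2 * (t * (LBINT s:{0..t}. (q s)\<^sup>2))"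
    by (intro mult_left_mono cadlag_cauchy_schwarz[OF q t]) simp
  also have "\<dots> \<le> D\<^sup>2 * (t * (LBINT s:{0..T}. (q s)\<^sup>2))"
  proof (intro mult_left_mono)
    have "(LBINT s:{0..T}. (q s)\<^sup>2) = (LBINT s:{0..t}. (q s)\<^sup>2) + (LBINT s:{t..T}. (q s)\<^sup>2)"
      unfolding power2_eq_square using t
      by (intro set_integral_split cadlag_on_set_integrable[OF cadlag_on_mult[OF q q] T_nonneg]) auto
    moreover have "0 \<le> (LBINT s:{t..T}. (q s)\<^sup>2)"
      unfolding set_lebesgue_integral_def by (intro Bochner_Integration.integral_nonneg) simp
    ultimately show "(LBINT s:{0..t}. (q s)\<^sup>2) \<le> (LBINT s:{0..T}. (q s)\<^sup>2)" by simp
  qed (use t in auto)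
  finally show ?thesis unfolding D_def .
qed

text \<open>Origin of \<open>L_Y\<close>: the 2 comes from
  \<open>(x + r)\<^sup>2 \<le> 2 * x\<^sup>2 + 2 * r\<^sup>2\<close>, and integrating the factor
  \<open>t\<close> of the remainder gives \<open>T\<^sup>2 / 2\<close>, doubled to
  \<open>T\<^sup>2\<close>. At \<open>T\<close> the term \<open>lam T * q T\<close> vanishes, so the
  terminal value is pure remainder and adds one \<open>T\<close>; the total
  \<open>T\<^sup>2 + T\<close> is below \<open>T * (T + 2)\<close>.\<close>

lemma impact_path_zero_L2:
  assumes q: "cadlag_on T q" and qT: "q T = 0"
  shows "(LBINT t:{0..T}. (ipath 0 q t)\<^sup>2) + (ipath 0 q T)\<^sup>2
    \<le> (L_Y T \<beta> lam lam')\<^sup>2 * (LBINT s:{0..T}. (q s)\<^sup>2)"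
proof -
  define L where "L = Linf_norm T lam"
  define A where "A = Linf_norm T (\<lambda>t. \<beta> t + lam' t / lam t)"
  define I where "I = (LBINT s:{0..T}. (q s)\<^sup>2)"
  have iq: "set_integrable lborel {0..T} (\<lambda>t. (q t)\<^sup>2)"
    unfolding power2_eq_square by (intro cadlag_on_set_integrable[OF cadlag_on_mult[OF q q] T_nonneg]) auto
  have iid: "set_integrable lborel {0..T} (\<lambda>t. t)"
    by (intro borel_integrable_atLeastAtMost' continuous_on_id)
  have idI: "(LBINT t:{0..T}. t) = T\<^sup>2 / 2"
    using set_borel_integral_eq_integral(2)[OF iid] integral_unique[OF ident_has_integral[OF T_nonneg]] by simp
  have rem: "(ipath 0 q t - lam t * q t)\<^sup>2 \<le> (L * A)\<^sup>2 * (t * I)" if "t \<in> {0..T}" for t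
    unfolding L_def A_def I_def by (rule impact_path_zero_remainder[OF q that])
  have "(LBINT t:{0..T}. (ipath 0 q t)\<^sup>2) \<le> (LBINT t:{0..T}. 2 * L\<^sup>2 * (q t)\<^sup>2 + (2 * (L * A)\<^sup>2 * I) * t)"
  proof (rule set_integral_mono_AE)
    show "set_integrable lborel {0..T} (\<lambda>t. (ipath 0 q t)\<^sup>2)"
      unfolding power2_eq_square
      by (intro cadlag_on_set_integrable[OF cadlag_on_mult[OF impact_path_cadlag[OF q] impact_path_cadlag[OF q]] T_nonneg]) auto
    show "set_integrable lborel {0..T} (\<lambda>t. 2 * L\<^sup>2 * (q t)\<^sup>2 + (2 * (L * A)\<^sup>2 * I) * t)"
      by (intro set_integral_add(1) set_integrable_mult_right impI iq iid)
    show "AE t\<in>{0..T} in lborel. (ipath 0 q t)\<^sup>2 \<le> 2 * L\<^sup>2 * (q t)\<^sup>2 + (2 * (L * A)\<^sup>2 * I) * t"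
      using AE_Icc_of_Ioo[OF cadlag_Linf_norm(1)[OF lam_cadlag T_pos]]
    proof (eventually_elim, intro impI)
      fix t assume *: "t \<in> {0..T} \<longrightarrow> \<bar>lam t\<bar> \<le> Linf_norm T lam" and t: "t \<in> {0..T}"
      define r where "r = ipath 0 q t - lam t * q t"
      have "(ipath 0 q t)\<^sup>2 \<le> 2 * (lam t * q t)\<^sup>2 + 2 * r\<^sup>2"
        using zero_le_power2[of "lam t * q t - r"] by (simp add: r_def power2_eq_square algebra_simps)
      moreover have "(lam t * q t)\<^sup>2 \<le> L\<^sup>2 * (q t)\<^sup>2"
        unfolding power_mult_distrib using power_mono[of "\<bar>lam t\<bar>" L 2] * t
        by (intro mult_right_mono) (auto simp: L_def)
      moreover have "r\<^sup>2 \<le> (L * A)\<^sup>2 * (t * I)" unfolding r_def by (rule rem[OF t])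
      ultimately show "(ipath 0 q t)\<^sup>2 \<le> 2 * L\<^sup>2 * (q t)\<^sup>2 + (2 * (L * A)\<^sup>2 * I) * t"
        by (simp add: algebra_simps)
    qed
  qed
  also have "\<dots> = 2 * L\<^sup>2 * I + (2 * (L * A)\<^sup>2 * I) * (T\<^sup>2 / 2)"
    using iq iid by (subst set_integral_add(2)) (auto simp: I_def idI)
  finally have 1: "(LBINT t:{0..T}. (ipath 0 q t)\<^sup>2) \<le> 2 * L\<^sup>2 * I + (L * A)\<^sup>2 * I * T\<^sup>2" by simp
  have 2: "(ipath 0 q T)\<^sup>2 \<le> (L * A)\<^sup>2 * (T * I)" using rem[of T] qT T_nonneg by simp
  have I0: "0 \<le> I" unfolding I_def set_lebesgue_integral_def
    by (intro Bochner_Integration.integral_nonneg) simp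
  have "(L_Y T \<beta> lam lam')\<^sup>2 = L\<^sup>2 * (2 + T * (T + 2) * A\<^sup>2)"
    using T_nonneg by (simp add: L_Y_def L_def[symmetric] A_def[symmetric] power_mult_distrib)
  then have "(L_Y T \<beta> lam lam')\<^sup>2 * I = 2 * L\<^sup>2 * I + (L * A)\<^sup>2 * I * T\<^sup>2 + 2 * ((L * A)\<^sup>2 * (T * I))"
    by (simp add: power2_eq_square algebra_simps)
  moreover have "0 \<le> (L * A)\<^sup>2 * (T * I)" using I0 T_nonneg by simp
  ultimately show ?thesis using 1 2 unfolding I_def by linarith
qed

lemma C_J_bound:
  assumes q: "cadlag_on T q" and qT: "q T = 0"
  shows "pnorm (ipath 0 q) \<le> C_J T \<beta> lam lam' * (LBINT s:{0..T}. (q s)\<^sup>2)"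
proof -
  have "pnorm (ipath 0 q) \<le> C_H_sq T \<beta> lam lam' * ((LBINT t:{0..T}. (ipath 0 q t)\<^sup>2) + (ipath 0 q T)\<^sup>2)"
    by (rule path_norm_le[OF impact_path_cadlag[OF q]])
  also have "\<dots> \<le> C_H_sq T \<beta> lam lam' * ((L_Y T \<beta> lam lam')\<^sup>2 * (LBINT s:{0..T}. (q s)\<^sup>2))"
    by (intro mult_left_mono impact_path_zero_L2 q qT C_H_sq_nonneg)
  finally show ?thesis by (simp add: C_J_def mult.assoc)
qed

text \<open>A crude bound, for integrability and for any initial value. The constants are chosen
  before the path, so an integrable majorant of the squared path makes the norm of a random impact
  path integrable.\<close>

lemma path_norm_impact_path_dominated:
  "\<exists>a b. \<forall>q S. cadlag_on T q \<longrightarrow> (\<forall>t\<in>{0..T}. (q t)\<^sup>2 \<le> S) \<longrightarrow> pnorm (ipath y q) \<le> a + b * S"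
proof -
  define C where "C = C_H_sq T \<beta> lam lam'"
  define D where "D = Linf_norm T lam * Linf_norm T (\<lambda>t. \<beta> t + lam' t / lam t)"
  obtain K where K: "0 \<le> K" "\<And>t. t \<in> {0..T} \<Longrightarrow> \<bar>lam t\<bar> \<le> K"
    using cadlag_on_bounded[OF lam_cadlag T_nonneg] by blast
  define c where "c S = 3 * y\<^sup>2 + (3 * K\<^sup>2 + 3 * D\<^sup>2 * T\<^sup>2) * S" for S
  have bound: "pnorm (ipath y q) \<le> C * (T + 1) * c S" if q: "cadlag_on T q" and S: "\<forall>t\<in>{0..T}. (q t)\<^sup>2 \<le> S" for q S
  proof -
    have iq: "set_integrable lborel {0..T} (\<lambda>t. (q t)\<^sup>2)"
      unfolding power2_eq_square by (intro cadlag_on_set_integrable[OF cadlag_on_mult[OF q q] T_nonneg]) auto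
    have ic: "set_integrable lborel {0..T} (\<lambda>t. k :: real)" for k
      by (intro borel_integrable_atLeastAtMost' continuous_on_const)
    have cI: "(LBINT t:{0..T}. k) = T * k" for k :: real
      using T_nonneg by (simp add: set_lebesgue_integral_def)
    have "(LBINT t:{0..T}. (q t)\<^sup>2) \<le> (LBINT t:{0..T}. S)"
      by (rule set_integral_mono[OF iq ic]) (use S in auto)
    then have I: "(LBINT t:{0..T}. (q t)\<^sup>2) \<le> T * S" by (simp only: cI)
    have Y: "(ipath y q t)\<^sup>2 \<le> c S" if t: "t \<in> {0..T}" for t
    proof -
      define r where "r = ipath 0 q t - lam t * q t"
      define e where "e = exp (- (LBINT s:{0..t}. \<beta> s)) * y"
      have Y: "ipath y q t = lam t * q t + r + e" by (simp add: r_def e_def impact_path_def algebra_simps)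
      have "(x1 + x2 + x3)\<^sup>2 \<le> 3 * x1\<^sup>2 + 3 * x2\<^sup>2 + 3 * x3\<^sup>2" for x1 x2 x3 :: real
        using zero_le_power2[of "x1 - x2"] zero_le_power2[of "x1 - x3"] zero_le_power2[of "x2 - x3"]
        by (simp add: power2_eq_square algebra_simps)
      then have "(ipath y q t)\<^sup>2 \<le> 3 * (lam t * q t)\<^sup>2 + 3 * r\<^sup>2 + 3 * e\<^sup>2" unfolding Y .
      moreover have "(lam t * q t)\<^sup>2 \<le> K\<^sup>2 * S"
        unfolding power_mult_distrib using power_mono[OF K(2)[OF t], of 2] S t by (intro mult_mono) auto
      moreover have "r\<^sup>2 \<le> D\<^sup>2 * T\<^sup>2 * S"
      proof -
        have "r\<^sup>2 \<le> D\<^sup>2 * (t * (LBINT s:{0..T}. (q s)\<^sup>2))"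
          unfolding r_def D_def by (rule impact_path_zero_remainder[OF q t])
        also have "\<dots> \<le> D\<^sup>2 * (T * (T * S))"
          using I t S by (intro mult_left_mono mult_mono)
            (auto simp: set_lebesgue_integral_def intro!: Bochner_Integration.integral_nonneg)
        finally show ?thesis by (simp add: power2_eq_square mult.assoc)
      qed
      moreover have "e\<^sup>2 \<le> y\<^sup>2"
      proof -
        have "0 \<le> (LBINT s:{0..t}. \<beta> s)"
          unfolding set_lebesgue_integral_def
          using beta_pos t by (intro Bochner_Integration.integral_nonneg) (auto simp: indicator_def less_imp_le)
        then have "(exp (- (LBINT s:{0..t}. \<beta> s)))\<^sup>2 \<le> 1\<^sup>2" by (intro power_mono) auto
        then have "(exp (- (LBINT s:{0..t}. \<beta> s)))\<^sup>2 * y\<^sup>2 \<le> 1 * y\<^sup>2" by (intro mult_right_mono) auto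
        then show ?thesis by (simp add: e_def power_mult_distrib)
      qed
      ultimately show ?thesis unfolding c_def distrib_right by linarith
    qed
    have iY: "set_integrable lborel {0..T} (\<lambda>t. (ipath y q t)\<^sup>2)"
      unfolding power2_eq_square
      by (intro cadlag_on_set_integrable[OF cadlag_on_mult[OF impact_path_cadlag[OF q] impact_path_cadlag[OF q]] T_nonneg]) auto
    have "(LBINT t:{0..T}. (ipath y q t)\<^sup>2) \<le> (LBINT t:{0..T}. c S)"
      by (rule set_integral_mono[OF iY ic Y])
    then have "(LBINT t:{0..T}. (ipath y q t)\<^sup>2) \<le> T * c S" by (simp only: cI)
    then have "(LBINT t:{0..T}. (ipath y q t)\<^sup>2) + (ipath y q T)\<^sup>2 \<le> (T + 1) * c S"
      using Y[of T] T_nonneg by (simp add: distrib_right)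
    then have "C * ((LBINT t:{0..T}. (ipath y q t)\<^sup>2) + (ipath y q T)\<^sup>2) \<le> C * ((T + 1) * c S)"
      unfolding C_def by (intro mult_left_mono C_H_sq_nonneg)
    then show ?thesis
      using path_norm_le[OF impact_path_cadlag[OF q, of y]] by (simp add: C_def mult.assoc)
  qed
  have "C * (T + 1) * c S = C * (T + 1) * (3 * y\<^sup>2) + C * (T + 1) * (3 * K\<^sup>2 + 3 * D\<^sup>2 * T\<^sup>2) * S" for S
    by (simp add: c_def algebra_simps)
  then show ?thesis using bound by metis
qed

section \<open>From single paths to expectations\<close>

lemma path_norm_measurable:
  assumes Y: "adapted F T Y" "cadlag_process M T Y"
  shows "(\<lambda>\<omega>. pnorm (\<lambda>t. Y t \<omega>)) \<in> borel_measurable M"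
proof -
  have TT: "T \<in> {0..T}" using T_nonneg by simp
  have [measurable]: "Y T \<in> borel_measurable M" by (rule adapted_measurable[OF Y(1) TT])
  have "adapted F T (\<lambda>t \<omega>. (2 * \<beta> t + lam' t / lam t) / (2 * lam t) * Y t \<omega> * Y t \<omega>)"
    unfolding adapted_def by (intro ballI borel_measurable_times borel_measurable_const adaptedD[OF Y(1)])
  moreover have "cadlag_process M T (\<lambda>t \<omega>. (2 * \<beta> t + lam' t / lam t) / (2 * lam t) * Y t \<omega> * Y t \<omega>)"
    unfolding cadlag_process_def by (intro ballI cadlag_on_mult coefficient_cadlag cadlag_processD[OF Y(2)])
  ultimately have "adapted F T (\<lambda>u \<omega>. LBINT t:{0..u}. (2 * \<beta> t + lam' t / lam t) / (2 * lam t) * Y t \<omega> * Y t \<omega>)"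
    by (rule adapted_cadlag_integral(1))
  from adapted_measurable[OF this TT] show ?thesis unfolding path_norm_def by measurable
qed

lemma path_norm_impact_path_integrable:
  assumes Q: "adapted F T Q" "cadlag_process M T Q" "(\<integral>\<^sup>+ \<omega>. (SUP t\<in>{0..T}. ennreal ((Q t \<omega>)\<^sup>2)) \<partial>M) < \<infinity>"
  shows "integrable M (\<lambda>\<omega>. pnorm (ipath y (\<lambda>t. Q t \<omega>)))"
proof -
  obtain S where S: "integrable M S" "AE \<omega> in M. \<forall>t\<in>{0..T}. (Q t \<omega>)\<^sup>2 \<le> S \<omega>"
    by (rule sup_square_dominated[OF Q])
  obtain a b where ab: "\<And>q S. cadlag_on T q \<Longrightarrow> \<forall>t\<in>{0..T}. (q t)\<^sup>2 \<le> S \<Longrightarrow> pnorm (ipath y q) \<le> a + b * S"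
    using path_norm_impact_path_dominated[of y] by blast
  show ?thesis
  proof (rule Bochner_Integration.integrable_bound)
    show "integrable M (\<lambda>\<omega>. a + b * S \<omega>)" using S(1) by auto
    show "(\<lambda>\<omega>. pnorm (ipath y (\<lambda>t. Q t \<omega>))) \<in> borel_measurable M"
      by (rule path_norm_measurable[OF impact_path_adapted[OF Q(1,2)]])
    show "AE \<omega> in M. norm (pnorm (ipath y (\<lambda>t. Q t \<omega>))) \<le> norm (a + b * S \<omega>)"
      using S(2) AE_space
    proof eventually_elim
      case (elim \<omega>)
      have "pnorm (ipath y (\<lambda>t. Q t \<omega>)) \<le> a + b * S \<omega>"
        by (rule ab[OF cadlag_processD[OF Q(2) elim(2)] elim(1)])
      then show ?case using path_norm_nonneg[of "ipath y (\<lambda>t. Q t \<omega>)"] by simp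
    qed
  qed
qed

lemma norm_H_sq_AE:
  assumes Y: "adapted F T Y" "cadlag_process M T Y" and Z: "adapted F T Z" "cadlag_process M T Z"
    and eq: "AE \<omega> in M. \<forall>t\<in>{0..T}. Y t \<omega> = Z t \<omega>"
  shows "norm_H_sq M T \<beta> lam lam' Y = (\<integral>\<omega>. pnorm (\<lambda>t. Z t \<omega>) \<partial>M)"
proof -
  have "norm_H_sq M T \<beta> lam lam' Y = (\<integral>\<omega>. pnorm (\<lambda>t. Y t \<omega>) \<partial>M)"
    by (simp only: norm_H_sq_def inner_H_def path_norm_def)
  also have "\<dots> = (\<integral>\<omega>. pnorm (\<lambda>t. Z t \<omega>) \<partial>M)"
  proof (rule integral_cong_AE[OF path_norm_measurable[OF Y] path_norm_measurable[OF Z]])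
    show "AE \<omega> in M. pnorm (\<lambda>t. Y t \<omega>) = pnorm (\<lambda>t. Z t \<omega>)"
      using eq by eventually_elim (auto intro: path_norm_cong)
  qed
  finally show ?thesis .
qed

lemma J0_eq:
  assumes Q: "adapted F T Q" "cadlag_process M T Q"
  shows "J0 M F T \<beta> lam lam' y Q = (\<integral>\<omega>. pnorm (ipath y (\<lambda>t. Q t \<omega>)) \<partial>M) - y\<^sup>2 / (2 * lam 0)"
  unfolding J0_def
  using norm_H_sq_AE[OF impact_eq_impact_path(1,2)[OF Q] impact_path_adapted[OF Q] impact_eq_impact_path(3)[OF Q]]
  by simp

text \<open>
  With \<open>a\<close> the gap and \<open>d\<close> the right-hand side, minimality along the line through \<open>Q0\<close> and \<open>Q\<close>
  says \<open>0 \<le> s * a + (s\<^sup>2 - s) * d\<close> for all real \<open>s\<close>, of both signs, hence \<open>a = d\<close>.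
\<close>

lemma J0_argmin_gap:
  assumes min: "is_arg_min (J0 M F T \<beta> lam lam' y) (\<lambda>Q. Q \<in> strategies M F T XiT) Q0"
    and Q: "Q \<in> strategies M F T XiT"
  shows "J0 M F T \<beta> lam lam' y Q - J0 M F T \<beta> lam lam' y Q0
      = (\<integral>\<omega>. pnorm (ipath 0 (\<lambda>t. Q t \<omega> - Q0 t \<omega>)) \<partial>M)"
proof -
  let ?J = "J0 M F T \<beta> lam lam' y"
  have Q0: "Q0 \<in> strategies M F T XiT" and le: "\<And>R. R \<in> strategies M F T XiT \<Longrightarrow> ?J Q0 \<le> ?J R"
    using min by (auto simp: is_arg_min_linorder)
  note q = strategiesD[OF Q] and q0 = strategiesD[OF Q0]
  have qc: "cadlag_on T (\<lambda>t. Q t \<omega>)" "cadlag_on T (\<lambda>t. Q0 t \<omega>)" if "\<omega> \<in> space M" for \<omega>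
    using cadlag_processD[OF q(2) that] cadlag_processD[OF q0(2) that] .
  let ?N = "\<lambda>\<omega>. pnorm (ipath y (\<lambda>t. Q t \<omega>))" and ?P = "\<lambda>\<omega>. pnorm (ipath y (\<lambda>t. Q0 t \<omega>))"
  let ?D = "\<lambda>\<omega>. pnorm (ipath 0 (\<lambda>t. Q t \<omega> - Q0 t \<omega>))"
  have iN: "integrable M ?N" "integrable M ?P"
    by (rule path_norm_impact_path_integrable[OF q(1-3)], rule path_norm_impact_path_integrable[OF q0(1-3)])
  have "integrable M (\<lambda>\<omega>. pnorm (ipath 0 (\<lambda>t. 1 * Q t \<omega> + (-1) * Q0 t \<omega>)))"
    by (rule path_norm_impact_path_integrable[OF adapted_lincomb[OF q(1) q0(1)]
          cadlag_process_lincomb[OF q(2) q0(2)] sup_square_lincomb[OF q(1-3) q0(1-3)]])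
  then have iD: "integrable M ?D" by simp
  define a where "a = (\<integral>\<omega>. ?N \<omega> \<partial>M) - (\<integral>\<omega>. ?P \<omega> \<partial>M)"
  define d where "d = (\<integral>\<omega>. ?D \<omega> \<partial>M)"
  have line: "x - c - (p - c) = s * (n - p) + z" if "x = (1 - s) * p + s * n + z" for x p n z c s :: real
    using that by (simp add: algebra_simps)
  have "0 \<le> s * a + (s\<^sup>2 - s) * d" for s
  proof -
    let ?R = "\<lambda>t \<omega>. (1 - s) * Q0 t \<omega> + s * Q t \<omega>"
    have R: "?R \<in> strategies M F T XiT" by (rule strategies_affine[OF Q0 Q]) simp
    have "(\<integral>\<omega>. pnorm (ipath y (\<lambda>t. ?R t \<omega>)) \<partial>M) = (\<integral>\<omega>. (1 - s) * ?P \<omega> + s * ?N \<omega> + (s\<^sup>2 - s) * ?D \<omega> \<partial>M)"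
    proof (rule Bochner_Integration.integral_cong[OF refl])
      fix \<omega> assume \<omega>: "\<omega> \<in> space M"
      \<comment> \<open>The weights sum to 1, so the combination starts at \<open>y\<close>
        again.\<close>
      have "pnorm (ipath y (\<lambda>t. ?R t \<omega>))
          = pnorm (\<lambda>t. (1 - s) * ipath y (\<lambda>t. Q0 t \<omega>) t + s * ipath y (\<lambda>t. Q t \<omega>) t)"
        using impact_path_linear[OF qc(2,1)[OF \<omega>], of _ "1 - s" y s y]
        by (intro path_norm_cong) (simp add: distrib_right[symmetric])
      also have "\<dots> = (1 - s) * ?P \<omega> + s * ?N \<omega>
          + (s\<^sup>2 - s) * pnorm (\<lambda>t. ipath y (\<lambda>t. Q t \<omega>) t - ipath y (\<lambda>t. Q0 t \<omega>) t)"
        by (rule path_norm_interpolate[OF impact_path_cadlag[OF qc(2)[OF \<omega>]] impact_path_cadlag[OF qc(1)[OF \<omega>]]])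
      \<comment> \<open>In the difference the starting values cancel, hence the initial value
        0.\<close>
      also have "pnorm (\<lambda>t. ipath y (\<lambda>t. Q t \<omega>) t - ipath y (\<lambda>t. Q0 t \<omega>) t) = ?D \<omega>"
        using impact_path_linear[OF qc[OF \<omega>], of _ 1 y "-1" y] by (intro path_norm_cong) simp
      finally show "pnorm (ipath y (\<lambda>t. ?R t \<omega>)) = (1 - s) * ?P \<omega> + s * ?N \<omega> + (s\<^sup>2 - s) * ?D \<omega>" .
    qed
    also have "\<dots> = (1 - s) * (\<integral>\<omega>. ?P \<omega> \<partial>M) + s * (\<integral>\<omega>. ?N \<omega> \<partial>M) + (s\<^sup>2 - s) * d"
      using iN iD by (simp add: d_def)
    finally have "?J ?R - ?J Q0 = s * a + (s\<^sup>2 - s) * d"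
      unfolding J0_eq[OF strategiesD(1,2)[OF R]] J0_eq[OF q0(1,2)] a_def by (rule line)
    then show ?thesis using le[OF R] by simp
  qed
  note quad = this
  have d0: "0 \<le> d" unfolding d_def by (intro Bochner_Integration.integral_nonneg path_norm_nonneg)
  have "a = d"
  proof (rule ccontr)
    assume "a \<noteq> d"
    define k where "k = a - d"
    \<comment> \<open>A point of sign opposite to \<open>k\<close>, so close to 0 that
      \<open>k + s * d\<close> keeps the sign of \<open>k\<close>; the \<open>+ 1\<close> covers
      \<open>d = 0\<close>. The product \<open>s * (k + s * d)\<close> is then negative, against
      \<open>quad\<close>.\<close>
    define s where "s = - k / (2 * (d + 1))"
    have "0 \<le> s * k + s\<^sup>2 * d" using quad[of s] by (simp add: k_def algebra_simps)
    also have "\<dots> = s * (k + s * d)" by (simp add: power2_eq_square algebra_simps)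
    also have "k + s * d = k * ((d + 2) / (2 * (d + 1)))" using d0 by (simp add: s_def field_simps)
    also have "s * (k * ((d + 2) / (2 * (d + 1)))) = - (k\<^sup>2 * ((d + 2) / (2 * (d + 1))\<^sup>2))"
      by (simp add: s_def power2_eq_square)
    also have "\<dots> < 0" using d0 \<open>a \<noteq> d\<close> by (simp add: k_def)
    finally show False by simp
  qed
  then show ?thesis by (simp add: J0_eq[OF q(1,2)] J0_eq[OF q0(1,2)] a_def d_def)
qed

text \<open>Impact is affine in the strategy, so almost surely the difference of two impacts is the
  impact of the difference started at 0. This links the gap formula of \<open>J0_argmin_gap\<close>
  to the norm in the theorem.\<close>

lemma norm_H_sq_difference:
  assumes Q: "Q \<in> strategies M F T XiT" and Q0: "Q0 \<in> strategies M F T XiT"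
  shows "norm_H_sq M T \<beta> lam lam' (\<lambda>t \<omega>. impact M F T \<beta> lam y Q t \<omega> - impact M F T \<beta> lam y Q0 t \<omega>)
      = (\<integral>\<omega>. pnorm (ipath 0 (\<lambda>t. Q t \<omega> - Q0 t \<omega>)) \<partial>M)"
proof -
  note q = strategiesD(1,2)[OF Q] and q0 = strategiesD(1,2)[OF Q0]
  note i = impact_eq_impact_path[OF q, of y] and i0 = impact_eq_impact_path[OF q0, of y]
  have d: "adapted F T (\<lambda>t \<omega>. Q t \<omega> - Q0 t \<omega>)" "cadlag_process M T (\<lambda>t \<omega>. Q t \<omega> - Q0 t \<omega>)"
    using adapted_lincomb[OF q(1) q0(1), of 1 "-1"] cadlag_process_lincomb[OF q(2) q0(2), of 1 "-1"] by simp_all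
  show ?thesis
  proof (rule norm_H_sq_AE[OF _ _ impact_path_adapted[OF d]])
    show "adapted F T (\<lambda>t \<omega>. impact M F T \<beta> lam y Q t \<omega> - impact M F T \<beta> lam y Q0 t \<omega>)"
      "cadlag_process M T (\<lambda>t \<omega>. impact M F T \<beta> lam y Q t \<omega> - impact M F T \<beta> lam y Q0 t \<omega>)"
      using adapted_lincomb[OF i(1) i0(1), of 1 "-1"] cadlag_process_lincomb[OF i(2) i0(2), of 1 "-1"] by simp_all
    show "AE \<omega> in M. \<forall>t\<in>{0..T}. impact M F T \<beta> lam y Q t \<omega> - impact M F T \<beta> lam y Q0 t \<omega>
        = ipath 0 (\<lambda>t. Q t \<omega> - Q0 t \<omega>) t"
      using i(3) i0(3) AE_space
    proof eventually_elim
      case (elim \<omega>)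
      show ?case
        using elim impact_path_linear[OF cadlag_processD[OF q(2) elim(3)] cadlag_processD[OF q0(2) elim(3)], of _ 1 y "-1" y]
        by simp
    qed
  qed
qed

text \<open>Both strategies end in the same terminal position, so almost every path of the
  difference vanishes at \<open>T\<close> and \<open>C_J_bound\<close> applies. Integrability on
  both sides is proved from the majorant of the squared path, since a non-integrable right-hand side
  would have the default integral 0.\<close>

lemma path_norm_difference_le:
  assumes Q: "Q \<in> strategies M F T XiT" and Q0: "Q0 \<in> strategies M F T XiT"
  shows "(\<integral>\<omega>. pnorm (ipath 0 (\<lambda>t. Q t \<omega> - Q0 t \<omega>)) \<partial>M)
      \<le> C_J T \<beta> lam lam' * L2_sq M T (\<lambda>t \<omega>. Q t \<omega> - Q0 t \<omega>)"
proof -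
  note q = strategiesD[OF Q] and q0 = strategiesD[OF Q0]
  let ?D = "\<lambda>t \<omega>. Q t \<omega> - Q0 t \<omega>"
  have d: "adapted F T ?D" "cadlag_process M T ?D" "(\<integral>\<^sup>+ \<omega>. (SUP t\<in>{0..T}. ennreal ((?D t \<omega>)\<^sup>2)) \<partial>M) < \<infinity>"
    using adapted_lincomb[OF q(1) q0(1), of 1 "-1"] cadlag_process_lincomb[OF q(2) q0(2), of 1 "-1"]
      sup_square_lincomb[OF q(1-3) q0(1-3), of 1 "-1"] by simp_all
  have D2: "adapted F T (\<lambda>t \<omega>. (?D t \<omega>)\<^sup>2)" "cadlag_process M T (\<lambda>t \<omega>. (?D t \<omega>)\<^sup>2)"
    unfolding power2_eq_square adapted_def cadlag_process_def
    by (intro ballI borel_measurable_times adaptedD[OF d(1)] cadlag_on_mult cadlag_processD[OF d(2)]; assumption)+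
  obtain S where S: "integrable M S" "AE \<omega> in M. \<forall>t\<in>{0..T}. (?D t \<omega>)\<^sup>2 \<le> S \<omega>"
    by (rule sup_square_dominated[OF d])
  have iL: "integrable M (\<lambda>\<omega>. LBINT t:{0..T}. (?D t \<omega>)\<^sup>2)"
  proof (rule Bochner_Integration.integrable_bound)
    show "integrable M (\<lambda>\<omega>. T * S \<omega>)" using S(1) by auto
    show "(\<lambda>\<omega>. LBINT t:{0..T}. (?D t \<omega>)\<^sup>2) \<in> borel_measurable M"
      by (rule adapted_measurable[OF adapted_cadlag_integral(1)[OF D2]]) (use T_nonneg in simp)
    show "AE \<omega> in M. norm (LBINT t:{0..T}. (?D t \<omega>)\<^sup>2) \<le> norm (T * S \<omega>)"
      using S(2) AE_space
    proof eventually_elim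
      case (elim \<omega>)
      have "\<bar>LBINT t:{0..T}. (?D t \<omega>)\<^sup>2\<bar> \<le> S \<omega> * (T - 0)"
        by (rule cadlag_integral_lipschitz[OF cadlag_processD[OF D2(2) elim(2)]]) (use elim T_nonneg in auto)
      then show ?case by (simp add: mult.commute)
    qed
  qed
  have "(\<integral>\<omega>. pnorm (ipath 0 (\<lambda>t. ?D t \<omega>)) \<partial>M) \<le> (\<integral>\<omega>. C_J T \<beta> lam lam' * (LBINT t:{0..T}. (?D t \<omega>)\<^sup>2) \<partial>M)"
  proof (rule integral_mono_AE[OF path_norm_impact_path_integrable[OF d] integrable_mult_right[OF iL]])
    show "AE \<omega> in M. pnorm (ipath 0 (\<lambda>t. ?D t \<omega>)) \<le> C_J T \<beta> lam lam' * (LBINT t:{0..T}. (?D t \<omega>)\<^sup>2)"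
      using q(4) q0(4) AE_space
      by eventually_elim (intro C_J_bound cadlag_processD[OF d(2)]; simp)
  qed
  then show ?thesis by (simp add: L2_sq_def)
qed

text \<open>\<open>V\<close> at 0 is attained by \<open>Q0\<close>. An absolutely continuous
  strategy is a strategy with a nonnegative penalty added, which gives the lower bound;
  \<open>Q\<close> itself is the competitor for the upper bound.\<close>

lemma V_gap:
  assumes min: "is_arg_min (J0 M F T \<beta> lam lam' y) (\<lambda>Q. Q \<in> strategies M F T XiT) Q0"
    and Q: "Q \<in> ac_strategies M F T XiT" and \<epsilon>: "0 < \<epsilon>"
  shows "0 \<le> V M F T \<beta> lam lam' y XiT \<epsilon> - V M F T \<beta> lam lam' y XiT 0"
    and "V M F T \<beta> lam lam' y XiT \<epsilon> - V M F T \<beta> lam lam' y XiT 0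
      \<le> ereal (J0 M F T \<beta> lam lam' y Q - J0 M F T \<beta> lam lam' y Q0 + \<epsilon> * L2_sq M T (rate M F T Q))"
proof -
  let ?J = "J0 M F T \<beta> lam lam' y" and ?V = "V M F T \<beta> lam lam' y XiT"
  have Q0: "Q0 \<in> strategies M F T XiT" and le: "\<And>R. R \<in> strategies M F T XiT \<Longrightarrow> ?J Q0 \<le> ?J R"
    using min by (auto simp: is_arg_min_linorder)
  have V0: "?V 0 = ereal (?J Q0)"
    unfolding V_def by (auto intro!: antisym INF_lower2[OF Q0] INF_greatest le)
  have L2: "0 \<le> L2_sq M T X" for X
    unfolding L2_sq_def set_lebesgue_integral_def by (intro Bochner_Integration.integral_nonneg) simp
  have "?J Q0 \<le> J_eps M F T \<beta> lam lam' y \<epsilon> R" if "R \<in> ac_strategies M F T XiT" for R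
    using le[of R] that mult_nonneg_nonneg[OF less_imp_le[OF \<epsilon>] L2[of "rate M F T R"]]
    by (simp add: J_eps_def ac_strategies_def)
  then have lower: "ereal (?J Q0) \<le> ?V \<epsilon>"
    using \<epsilon> unfolding V_def by (auto intro!: INF_greatest)
  have upper: "?V \<epsilon> \<le> ereal (J_eps M F T \<beta> lam lam' y \<epsilon> Q)"
    using \<epsilon> Q unfolding V_def by (auto intro: INF_lower)
  \<comment> \<open>Caught between two real numbers, the infimum is finite, and the subtraction in
    \<open>ereal\<close> is an ordinary one.\<close>
  obtain v where v: "?V \<epsilon> = ereal v" using lower upper by (cases "?V \<epsilon>") auto
  show "0 \<le> ?V \<epsilon> - ?V 0" "?V \<epsilon> - ?V 0 \<le> ereal (?J Q - ?J Q0 + \<epsilon> * L2_sq M T (rate M F T Q))"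
    using lower upper unfolding V0 v by (auto simp: J_eps_def)
qed

end

theorem lemma5p3:
  fixes M :: "'a measure" and F :: "real \<Rightarrow> 'a measure" and T y :: real
    and \<beta> lam lam' :: "real \<Rightarrow> real" and XiT :: "'a \<Rightarrow> real" and Q0 :: "real \<Rightarrow> 'a \<Rightarrow> real"
  assumes "usual_filtered_prob_space M F T"
    and "coefficient_assms T \<beta> lam lam'"
    and "XiT \<in> borel_measurable (F T)" and "integrable M (\<lambda>\<omega>. (XiT \<omega>)\<^sup>2)"
    and "stieltjes_condition M F T XiT"
    and "is_arg_min (J0 M F T \<beta> lam lam' y) (\<lambda>Q. Q \<in> strategies M F T XiT) Q0"
  shows
    "(\<forall>Q \<in> strategies M F T XiT.
        0 \<le> J0 M F T \<beta> lam lam' y Q - J0 M F T \<beta> lam lam' y Q0 \<and>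
        J0 M F T \<beta> lam lam' y Q - J0 M F T \<beta> lam lam' y Q0 =
          norm_H_sq M T \<beta> lam lam'
            (\<lambda>t \<omega>. impact M F T \<beta> lam y Q t \<omega> - impact M F T \<beta> lam y Q0 t \<omega>) \<and>
        norm_H_sq M T \<beta> lam lam'
            (\<lambda>t \<omega>. impact M F T \<beta> lam y Q t \<omega> - impact M F T \<beta> lam y Q0 t \<omega>)
          \<le> C_J T \<beta> lam lam' * L2_sq M T (\<lambda>t \<omega>. Q t \<omega> - Q0 t \<omega>)) \<and>
     (\<forall>Q \<in> ac_strategies M F T XiT. \<forall>\<epsilon>>0.
        0 \<le> V M F T \<beta> lam lam' y XiT \<epsilon> - V M F T \<beta> lam lam' y XiT 0 \<and>
        V M F T \<beta> lam lam' y XiT \<epsilon> - V M F T \<beta> lam lam' y XiT 0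
          \<le> ereal (C_J T \<beta> lam lam' * L2_sq M T (\<lambda>t \<omega>. Q t \<omega> - Q0 t \<omega>)
                   + \<epsilon> * L2_sq M T (rate M F T Q)))"
proof -
  interpret impact_coefficients M F T \<beta> lam lam'
    using assms(1,2) by (auto simp: impact_coefficients_def impact_coefficients_axioms_def)
  note min = assms(6)
  have Q0: "Q0 \<in> strategies M F T XiT"
    and le: "\<And>R. R \<in> strategies M F T XiT \<Longrightarrow> J0 M F T \<beta> lam lam' y Q0 \<le> J0 M F T \<beta> lam lam' y R"
    using min by (auto simp: is_arg_min_linorder)
  have bound: "J0 M F T \<beta> lam lam' y Q - J0 M F T \<beta> lam lam' y Q0
      \<le> C_J T \<beta> lam lam' * L2_sq M T (\<lambda>t \<omega>. Q t \<omega> - Q0 t \<omega>)" if "Q \<in> strategies M F T XiT" for Q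
    unfolding J0_argmin_gap[OF min that] by (rule path_norm_difference_le[OF that Q0])
  show ?thesis
  proof (intro conjI ballI allI impI)
    fix Q assume Q: "Q \<in> strategies M F T XiT"
    show "0 \<le> J0 M F T \<beta> lam lam' y Q - J0 M F T \<beta> lam lam' y Q0" using le[OF Q] by simp
    show eq: "J0 M F T \<beta> lam lam' y Q - J0 M F T \<beta> lam lam' y Q0 = norm_H_sq M T \<beta> lam lam'
        (\<lambda>t \<omega>. impact M F T \<beta> lam y Q t \<omega> - impact M F T \<beta> lam y Q0 t \<omega>)"
      unfolding J0_argmin_gap[OF min Q] norm_H_sq_difference[OF Q Q0] ..
    show "norm_H_sq M T \<beta> lam lam' (\<lambda>t \<omega>. impact M F T \<beta> lam y Q t \<omega> - impact M F T \<beta> lam y Q0 t \<omega>)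
        \<le> C_J T \<beta> lam lam' * L2_sq M T (\<lambda>t \<omega>. Q t \<omega> - Q0 t \<omega>)"
      using bound[OF Q] unfolding eq .
  next
    fix Q and \<epsilon> :: real assume Q: "Q \<in> ac_strategies M F T XiT" and \<epsilon>: "0 < \<epsilon>"
    show "0 \<le> V M F T \<beta> lam lam' y XiT \<epsilon> - V M F T \<beta> lam lam' y XiT 0"
      by (rule V_gap(1)[OF min Q \<epsilon>])
    have "Q \<in> strategies M F T XiT" using Q by (simp add: ac_strategies_def)
    from bound[OF this] have "ereal (J0 M F T \<beta> lam lam' y Q - J0 M F T \<beta> lam lam' y Q0 + \<epsilon> * L2_sq M T (rate M F T Q))
        \<le> ereal (C_J T \<beta> lam lam' * L2_sq M T (\<lambda>t \<omega>. Q t \<omega> - Q0 t \<omega>) + \<epsilon> * L2_sq M T (rate M F T Q))"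
      by simp
    with V_gap(2)[OF min Q \<epsilon>]
    show "V M F T \<beta> lam lam' y XiT \<epsilon> - V M F T \<beta> lam lam' y XiT 0
        \<le> ereal (C_J T \<beta> lam lam' * L2_sq M T (\<lambda>t \<omega>. Q t \<omega> - Q0 t \<omega>) + \<epsilon> * L2_sq M T (rate M F T Q))"
      by (rule order_trans)
  qed
qed

end
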